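(* In the control problem described in the context, suppose the operating cost $e$ has no downward jumps, i.e. $e(\tau_k)\ge e(\tau_k^-)$ at every discontinuity point $\tau_k$. Let $\Lambda(t,s):=\int_t^s\lambda(r)\,dr$ and $$\underline\delta(t):=\pi e^{-\Lambda(t,T)-K(T-t)}\min\left\{\Lambda(t,T),\ \frac{\Lambda(t,T)^{N-1}}{(N-1)!}\right\}.$$ (i) (Sufficient) If $\dot e(t)>-\lambda(t)\min\left\{\underline\delta(t),\ \pi e^{-\Lambda(t,T)}\right\}$ at every $t$ in the open intervals $(\tau_k,\tau_{k+1})$, $k=0,\ldots,m$, then $i_t^{\min}$ is increasing in $t$. (ii) (Necessary) If $i_t^{\min}$ is increasing in $t$, then $\dot e(t)\ge-\lambda(t)\bigl(\pi-e(t)\bigr)$ whenever $\Delta_{i_t^{\min}-1}(t)=e(t)$ (for $t$ in the open intervals $(\tau_k,\tau_{k+1})$, $k=0,\ldots,m$).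
   Context: Let $N\ge1$ and $K\ge 1$ be integers, $T\in(0,\infty)$, $\pi>0$, and $\mathcal S=\{0,1,\ldots,N\}$; write $a\wedge b=\min\{a,b\}$. The functions $\lambda,e:[0,T]\to(0,\infty)$ are deterministic, bounded, right-continuous, with $\inf_{t\in[0,T]}\lambda(t)>0$ and $\inf_{t\in[0,T]}e(t)>0$, and there is a finite list $0=\tau_0<\tau_1<\cdots<\tau_m<\tau_{m+1}=T$ (containing all the discontinuity points of $\lambda$ and $e$) such that both are continuously differentiable on each open interval $(\tau_k,\tau_{k+1})$; the left limits $e(\tau_k^-)$, $k\ge1$, exist. The state $I(t)\in\mathcal S$ is the number of depleted units. When $I(t)=i$ the feasible actions are $\mathcal U(i)=\{0,1,\ldots,i\wedge K\}$. Under action $u$ at time $t$, the state jumps from $i$ to $i+1$ at rate $\lambda(t)$ if $i<N$, and from $i$ to $i-1$ at rate $u$; in state $N$ arrivals (at rate $\lambda(t)$) are lost and leave the state unchanged. The cost rate is $c(t,i,u)=e(t)u+\pi\lambda(t)\mathbf 1_{\{i=N\}}$. A control $u=\{u(t)\}$ is admissible if it is non-anticipative and $u(t)\in\mathcal U(I(t))$ at all times. The cost-to-go is $J^u(t,i)=\mathbb E\left[\int_t^T c(s,I(s),u(s))\,ds\,\middle|\,I(t)=i\right]$, and the value function is $V(t,i)=\inf_u J^u(t,i)$ for $(t,i)\in[0,T]\times\mathcal S$, with $V(T,i)=0$. The marginal costs are $\Delta_0(t):=V(t,0)$ and $\Delta_i(t):=V(t,i)-V(t,i-1)$ for $i=1,\ldots,N$.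 Let $\mathcal I_t:=\{i\in\{1,\ldots,N\}:\Delta_i(t)>e(t)\}$ and $i_t^{\min}:=\min\mathcal I_t$, with the convention $i_t^{\min}=N+1$ if $\mathcal I_t=\emptyset$. "Increasing" means non-decreasing, on $[0,T]$.
   Formalization: Part (ii) is stated only for i_t^min ≥ 2: when i_t^min = 1 the condition reads Δ_0(t) = V(t,0) = e(t), and the claimed bound on ė(t) can then fail. *)

theory Defs
  imports "HOL-Probability.Probability"
begin

definition grid :: "real \<Rightarrow> nat \<Rightarrow> (nat \<Rightarrow> real) \<Rightarrow> bool" where
  "grid T m \<tau> \<longleftrightarrow> \<tau> 0 = 0 \<and> \<tau> (m + 1) = T \<and> (\<forall>k\<le>m. \<tau> k < \<tau> (k + 1))"

(* The last clause makes every discontinuity point in [0,T] one of the grid points. *)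
definition rate_function :: "real \<Rightarrow> nat \<Rightarrow> (nat \<Rightarrow> real) \<Rightarrow> (real \<Rightarrow> real) \<Rightarrow> bool" where
  "rate_function T m \<tau> f \<longleftrightarrow>
     (\<forall>t\<in>{0..T}. 0 < f t) \<and>
     bounded (f ` {0..T}) \<and>
     (\<forall>t\<in>{0..<T}. continuous (at_right t) f) \<and>
     0 < (INF t\<in>{0..T}. f t) \<and>
     (\<forall>k\<le>m. f C1_differentiable_on {\<tau> k<..<\<tau> (k + 1)})"

definition has_left_limits :: "nat \<Rightarrow> (nat \<Rightarrow> real) \<Rightarrow> (real \<Rightarrow> real) \<Rightarrow> bool" where
  "has_left_limits m \<tau> f \<longleftrightarrow> (\<forall>k\<in>{1..m + 1}. \<exists>l. (f \<longlongrightarrow> l) (at_left (\<tau> k)))"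

(* At a grid point where f is continuous the inequality holds trivially, so nothing is
   lost by not restricting to discontinuity points; at 0 there is no left limit. *)
definition no_downward_jumps :: "nat \<Rightarrow> (nat \<Rightarrow> real) \<Rightarrow> (real \<Rightarrow> real) \<Rightarrow> bool" where
  "no_downward_jumps m \<tau> f \<longleftrightarrow> (\<forall>k\<in>{1..m + 1}. Lim (at_left (\<tau> k)) f \<le> f (\<tau> k))"

definition feasible :: "nat \<Rightarrow> nat \<Rightarrow> nat set" where
  "feasible K i = {0..min i K}"

(* Rate of jumps from i to j (for i \<noteq> j) when arrivals have rate l and action a is used. *)
definition jump_rate :: "nat \<Rightarrow> real \<Rightarrow> nat \<Rightarrow> nat \<Rightarrow> nat \<Rightarrow> real" where
  "jump_rate N l a i j =
     (if j = i + 1 \<and> i < N then l else if i = j + 1 then real a else 0)"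

definition running_cost :: "nat \<Rightarrow> real \<Rightarrow> real \<Rightarrow> real \<Rightarrow> nat \<Rightarrow> nat \<Rightarrow> real" where
  "running_cost N \<pi> l c i a = c * real a + \<pi> * l * (if i = N then 1 else 0)"

(* Right-continuous and piecewise constant on [0,T], with all jumps in a finite set D. *)
definition step_path :: "real \<Rightarrow> (real \<Rightarrow> nat) \<Rightarrow> bool" where
  "step_path T x \<longleftrightarrow>
     (\<exists>D. finite D \<and> (\<forall>t\<in>{0..T}. \<forall>s\<in>{t..T}. D \<inter> {t<..s} = {} \<longrightarrow> x s = x t))"

definition jump_times :: "(real \<Rightarrow> nat) \<Rightarrow> nat \<Rightarrow> nat \<Rightarrow> real \<Rightarrow> real \<Rightarrow> real set" where
  "jump_times x i j s r = {v\<in>{s<..r}. (\<forall>\<^sub>F w in at_left v. x w = i) \<and> x v = j}"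

(* A state process X together with an admissible control u on a filtered probability space.
   Non-anticipation is adaptedness to F, with joint measurability in (t, \<omega>) so that time
   integrals make sense. The last assumption says that the number of jumps from i to j has
   the F-intensity jump_rate (lam v) (u v) i j while X is in state i; for the pairs whose
   jump_rate is 0 it excludes such jumps almost surely. *)
locale controlled_chain = prob_space M + filtration "space M" F
  for M :: "'w measure" and F :: "real \<Rightarrow> 'w measure" +
  fixes N K :: nat and T :: real and lam :: "real \<Rightarrow> real"
    and X u :: "real \<Rightarrow> 'w \<Rightarrow> nat"
  assumes subalgebra_F: "t \<in> {0..T} \<Longrightarrow> subalgebra M (F t)"
    and X_adapted: "t \<in> {0..T} \<Longrightarrow> X t \<in> F t \<rightarrow>\<^sub>M count_space UNIV"
    and u_adapted: "t \<in> {0..T} \<Longrightarrow> u t \<in> F t \<rightarrow>\<^sub>M count_space UNIV"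
    and X_measurable:
      "(\<lambda>(t, \<omega>). X t \<omega>) \<in> restrict_space borel {0..T} \<Otimes>\<^sub>M M \<rightarrow>\<^sub>M count_space UNIV"
    and u_measurable:
      "(\<lambda>(t, \<omega>). u t \<omega>) \<in> restrict_space borel {0..T} \<Otimes>\<^sub>M M \<rightarrow>\<^sub>M count_space UNIV"
    and X_state: "t \<in> {0..T} \<Longrightarrow> \<omega> \<in> space M \<Longrightarrow> X t \<omega> \<in> {0..N}"
    and u_feasible: "t \<in> {0..T} \<Longrightarrow> \<omega> \<in> space M \<Longrightarrow> u t \<omega> \<in> feasible K (X t \<omega>)"
    and X_step: "AE \<omega> in M. step_path T (\<lambda>t. X t \<omega>)"
    and X_intensity:
      "i \<in> {0..N} \<Longrightarrow> j \<in> {0..N} \<Longrightarrow> i \<noteq> j \<Longrightarrow> 0 \<le> s \<Longrightarrow> s \<le> r \<Longrightarrow> r \<le> T \<Longrightarrow> A \<in> sets (F s) \<Longrightarrow>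
        (\<integral>\<^sup>+\<omega>\<in>A. of_nat (card (jump_times (\<lambda>t. X t \<omega>) i j s r)) \<partial>M) =
        (\<integral>\<^sup>+\<omega>\<in>A. (\<integral>\<^sup>+v\<in>{s..r}.
            ennreal (if X v \<omega> = i then jump_rate N (lam v) (u v \<omega>) i j else 0) \<partial>lborel) \<partial>M)"

(* Expected cost over [t,T] under the conditional probability given X t = i;
   meaningful when that event has positive probability. *)
definition cost_to_go ::
  "nat \<Rightarrow> real \<Rightarrow> real \<Rightarrow> (real \<Rightarrow> real) \<Rightarrow> (real \<Rightarrow> real) \<Rightarrow>
   'w measure \<Rightarrow> (real \<Rightarrow> 'w \<Rightarrow> nat) \<Rightarrow> (real \<Rightarrow> 'w \<Rightarrow> nat) \<Rightarrow> real \<Rightarrow> nat \<Rightarrow> real" where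
  "cost_to_go N T \<pi> lam e M X u t i =
     (LINT \<omega>|uniform_measure M {\<omega>\<in>space M. X t \<omega> = i}.
        (LBINT s:{t..T}. running_cost N \<pi> (lam s) (e s) (X s \<omega>) (u s \<omega>)))"

(* The infimum ranges over all filtered probability spaces whose sample points are real
   sequences. Fixing this type is needed to form the set in HOL; it is rich enough to carry
   any countable family of real random variables. *)
definition value_fun ::
  "nat \<Rightarrow> nat \<Rightarrow> real \<Rightarrow> real \<Rightarrow> (real \<Rightarrow> real) \<Rightarrow> (real \<Rightarrow> real) \<Rightarrow> real \<Rightarrow> nat \<Rightarrow> real" where
  "value_fun N K T \<pi> lam e t i =
     Inf {cost_to_go N T \<pi> lam e M X u t i | (M :: (nat \<Rightarrow> real) measure) F X u.
            controlled_chain M F N K T lam X u \<and> 0 < measure M {\<omega>\<in>space M. X t \<omega> = i}}"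

definition marginal_cost ::
  "nat \<Rightarrow> nat \<Rightarrow> real \<Rightarrow> real \<Rightarrow> (real \<Rightarrow> real) \<Rightarrow> (real \<Rightarrow> real) \<Rightarrow> nat \<Rightarrow> real \<Rightarrow> real" where
  "marginal_cost N K T \<pi> lam e i t =
     (if i = 0 then value_fun N K T \<pi> lam e t 0
      else value_fun N K T \<pi> lam e t i - value_fun N K T \<pi> lam e t (i - 1))"

definition active_states ::
  "nat \<Rightarrow> nat \<Rightarrow> real \<Rightarrow> real \<Rightarrow> (real \<Rightarrow> real) \<Rightarrow> (real \<Rightarrow> real) \<Rightarrow> real \<Rightarrow> nat set" where
  "active_states N K T \<pi> lam e t = {i\<in>{1..N}. e t < marginal_cost N K T \<pi> lam e i t}"

definition i_min ::
  "nat \<Rightarrow> nat \<Rightarrow> real \<Rightarrow> real \<Rightarrow> (real \<Rightarrow> real) \<Rightarrow> (real \<Rightarrow> real) \<Rightarrow> real \<Rightarrow> nat" where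
  "i_min N K T \<pi> lam e t =
     (if active_states N K T \<pi> lam e t = {} then N + 1
      else Min (active_states N K T \<pi> lam e t))"

definition cum_rate :: "(real \<Rightarrow> real) \<Rightarrow> real \<Rightarrow> real \<Rightarrow> real" where
  "cum_rate lam t s = (LBINT r:{t..s}. lam r)"

definition delta_lower :: "nat \<Rightarrow> nat \<Rightarrow> real \<Rightarrow> real \<Rightarrow> (real \<Rightarrow> real) \<Rightarrow> real \<Rightarrow> real" where
  "delta_lower N K T \<pi> lam t =
     \<pi> * exp (- cum_rate lam t T - real K * (T - t)) *
     min (cum_rate lam t T) (cum_rate lam t T ^ (N - 1) / fact (N - 1))"

end

theory Submission
  imports Defs
begin

text \<open>
The value function is the solution \<open>W\<close> of the Hamilton-Jacobi-Bellman equation, and the theorem is a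
statement about this system of ordinary differential equations. Put \<open>\<Delta>\<^sub>i = W\<^sub>i - W\<^sub>i\<^sub>-\<^sub>1\<close> for
\<open>1 \<le> i \<le> N\<close> and \<open>\<Delta>\<^sub>N\<^sub>+\<^sub>1 = \<pi>\<close>. The minimising action is \<open>min i K\<close> if \<open>\<Delta>\<^sub>i > e\<close> and \<open>0\<close> otherwise, whence
\<open>\<Delta>\<^sub>i' = - \<lambda> (\<Delta>\<^sub>i\<^sub>+\<^sub>1 - \<Delta>\<^sub>i) + min i K (\<Delta>\<^sub>i - e)\<^sup>+ - min (i - 1) K (\<Delta>\<^sub>i\<^sub>-\<^sub>1 - e)\<^sup>+\<close>.

The gaps \<open>\<Delta>\<^sub>i\<^sub>+\<^sub>1 - \<Delta>\<^sub>i\<close> satisfy a cooperative system with nonnegative final values, so they are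
nonnegative (\<open>gap_nonneg\<close>): the value function is convex in the state. The same comparison argument,
run from \<open>i = N\<close> downwards, bounds them from below by the quantity that occurs in the sufficient
condition (\<open>gap_ge_delta_lower\<close>). By convexity \<open>\<Delta>\<^sub>i\<^sub>-\<^sub>1 \<le> e\<close> when \<open>\<Delta>\<^sub>i = e\<close>, so at a contact between
\<open>\<Delta>\<^sub>i\<close> and \<open>e\<close> the control terms vanish and \<open>(e - \<Delta>\<^sub>i)' = e' + \<lambda> (\<Delta>\<^sub>i\<^sub>+\<^sub>1 - \<Delta>\<^sub>i)\<close>. Under the sufficient
condition this is positive, and \<open>\<Delta>\<^sub>i\<close> can never rise above \<open>e\<close> (\<open>stays_below_on_horizon\<close>; upward jumps
of \<open>e\<close> only help), which says that \<open>i\<^sub>m\<^sub>i\<^sub>n\<close> is increasing. Conversely, if \<open>i\<^sub>m\<^sub>i\<^sub>n\<close> is increasing, then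
\<open>e - \<Delta>\<^sub>i\<close> stays nonnegative after a contact at \<open>i = i\<^sub>m\<^sub>i\<^sub>n - 1\<close>; so its derivative is nonnegative
there, and \<open>\<Delta>\<^sub>i\<^sub>+\<^sub>1 \<le> \<pi>\<close> gives the necessary condition (\<open>slope_at_crossing\<close>).

Most of the work is the identification of the value function with \<open>W\<close> (\<open>value_fun_eq\<close>). For the lower
bound, the intensity assumption on a controlled chain yields the forward equation for the state
probabilities on an event of the past; integrating it by parts against \<open>W\<close> is Dynkin's formula, and
the equation for \<open>W\<close> compares the result with the running cost (\<open>verification\<close>). Equality holds for
the threshold feedback, so a chain with this feedback has to be exhibited. It is built on the
space of real sequences by thinning a Poisson process of constant rate, with independent exponential
waiting times and uniform marks as coordinates; its intensities are computed one period between
Poisson points at a time (\<open>intensity\<close>).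
\<close>

section \<open>Backward integral equations\<close>

text \<open>The exponential weight below turns the factor \<open>C * (T - t)\<close> of the integral operator into
\<open>C / L\<close>; this integral is where the \<open>1 / L\<close> comes from.\<close>

lemma integral_exp_weight:
  fixes L t T :: real
  assumes "0 < L" "t \<le> T"
  shows "((\<lambda>s. exp (L * (t - s))) has_integral (1 - exp (L * (t - T))) / L) {t..T}"
proof -
  have "((\<lambda>s. exp (L * (t - s))) has_integral
     (- exp (L * (t - T)) / L) - (- exp (L * (t - t)) / L)) {t..T}"
    using assms
    by (intro fundamental_theorem_of_calculus)
       (auto intro!: derivative_eq_intros simp: has_real_derivative_iff_has_vector_derivative[symmetric])
  thus ?thesis by (simp add: diff_divide_distrib)
qed

lemma bounded_measurable_integrable_on:
  fixes f :: "real \<Rightarrow> real"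
  assumes "f \<in> borel_measurable borel" "\<And>s. s \<in> {a..b} \<Longrightarrow> \<bar>f s\<bar> \<le> B"
  shows "set_integrable lborel {a..b} f" "f integrable_on {a..b}"
proof -
  show 1: "set_integrable lborel {a..b} f"
    unfolding set_integrable_def
  proof (rule integrableI_bounded_set[where A="{a..b}" and B=B])
    show "(\<lambda>x. indicat_real {a..b} x *\<^sub>R f x) \<in> borel_measurable lborel"
      using assms(1) by measurable
    show "emeasure lborel {a..b} < \<infinity>"
      by (cases "a \<le> b") (simp_all)
  qed (use assms in \<open>auto simp: indicator_def\<close>)
  show "f integrable_on {a..b}"
    using set_borel_integral_eq_integral(1)[OF 1] .
qed

text \<open>Picard's theorem for a countable system run backwards from the value \<open>0\<close> at time \<open>T\<close>, with
coefficients that are only measurable in time. A single contraction covers the whole horizon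
because the unknown is weighted by \<open>exp (- L * (T - t))\<close> with \<open>L > C\<close>. The pairs (index, time)
form one metric space, so that bounded continuous functions on it are a Banach space.\<close>

theorem ode_solution_exists:
  fixes H :: "nat \<Rightarrow> real \<Rightarrow> (nat \<Rightarrow> real) \<Rightarrow> real" and C B T :: real
  assumes T: "0 \<le> T" and C: "0 \<le> C"
    and lip: "\<And>i s x y d. s \<in> {0..T} \<Longrightarrow> (\<And>j. \<bar>x j - y j\<bar> \<le> d) \<Longrightarrow> \<bar>H i s x - H i s y\<bar> \<le> C * d"
    and bd: "\<And>i s. s \<in> {0..T} \<Longrightarrow> \<bar>H i s (\<lambda>_. 0)\<bar> \<le> B"
    and meas: "\<And>i w. (\<And>j. w j \<in> borel_measurable borel) \<Longrightarrow> (\<lambda>s. H i s (\<lambda>j. w j s)) \<in> borel_measurable borel"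
  obtains W :: "nat \<Rightarrow> real \<Rightarrow> real" and B' where
    "\<And>i. continuous_on UNIV (W i)" "\<And>i t. \<bar>W i t\<bar> \<le> B'"
    "\<And>i t. t \<in> {0..T} \<Longrightarrow> W i t = integral {t..T} (\<lambda>s. H i s (\<lambda>j. W j s))"
proof -
  define L where "L = 2 * C + 1"
  have L: "0 < L" "C / L < 1" using C by (auto simp: L_def)
  define cl where "cl t = max 0 (min T t)" for t
  have cl: "cl t \<in> {0..T}" "t \<in> {0..T} \<Longrightarrow> cl t = t" for t using T by (auto simp: cl_def)
  \<comment> \<open>the unknown is \<open>exp (- L (T - t)) W\<close>, which makes the integral operator a contraction\<close>
  define g where "g w i s = H i s (\<lambda>j. exp (L * (T - s)) * apply_bcontfun w (discrete j, cl s))"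
    for w :: "(nat discrete \<times> real) \<Rightarrow>\<^sub>C real" and i s
  define G where "G w p = exp (- L * (T - cl (snd p))) * integral {cl (snd p)..T} (g w (of_discrete (fst p)))"
    for w and p :: "nat discrete \<times> real"
  have wb: "\<bar>apply_bcontfun w p\<bar> \<le> norm w" for w :: "(nat discrete \<times> real) \<Rightarrow>\<^sub>C real" and p
    using norm_bounded[of w p] by simp
  have wcont: "continuous_on UNIV (\<lambda>s. apply_bcontfun w (discrete j, cl s))" for w :: "(nat discrete \<times> real) \<Rightarrow>\<^sub>C real" and j
    unfolding cl_def
    by (rule continuous_on_compose2[OF continuous_on_apply_bcontfun[of UNIV]]) (auto intro!: continuous_intros)
  have gm: "g w i \<in> borel_measurable borel" for w i
  proof -
    have "(\<lambda>s. exp (L * (T - s)) * apply_bcontfun w (discrete j, cl s)) \<in> borel_measurable borel" for j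
      by (intro borel_measurable_continuous_onI continuous_intros wcont)
    from meas[of "\<lambda>j s. exp (L * (T - s)) * apply_bcontfun w (discrete j, cl s)", OF this]
    show ?thesis unfolding g_def .
  qed
  define Bw where "Bw w = C * (exp (L * T) * norm w) + B" for w :: "(nat discrete \<times> real) \<Rightarrow>\<^sub>C real"
  have gb: "\<bar>g w i s\<bar> \<le> Bw w" if "s \<in> {0..T}" for w i s
  proof -
    have "\<bar>g w i s - H i s (\<lambda>_. 0)\<bar> \<le> C * (exp (L * T) * norm w)"
      unfolding g_def
    proof (rule lip[OF that])
      fix j
      have "\<bar>exp (L * (T - s)) * apply_bcontfun w (discrete j, cl s)\<bar> \<le> exp (L * T) * norm w"
        unfolding abs_mult using that L by (intro mult_mono wb) auto
      thus "\<bar>exp (L * (T - s)) * apply_bcontfun w (discrete j, cl s) - 0\<bar> \<le> exp (L * T) * norm w" by simp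
    qed
    thus ?thesis using bd[OF that, of i] by (auto simp: Bw_def)
  qed
  have Bw0: "0 \<le> Bw w" for w
    using gb[of 0 w 0] T by auto
  have gi: "g w i integrable_on {a..T}" if "a \<in> {0..T}" for w i a
    by (rule bounded_measurable_integrable_on(2)[OF gm, where B="Bw w"]) (use that gb in auto)
  have gi': "g w i integrable_on {0..T}" for w i
    using gi[of 0] T by auto
  have Icont: "continuous_on {0..T} (\<lambda>t. integral {t..T} (g w i))" for w i
    using indefinite_integral_continuous_1'[OF gi'] .
  have clc: "continuous_on UNIV cl" unfolding cl_def by (intro continuous_intros)
  \<comment> \<open>continuity in the time variable suffices, since the index is discrete\<close>
  have Gcont: "continuous_on UNIV (G w)" for w
  proof -
    have i: "continuous_on UNIV (\<lambda>t. G w (i, t))" for i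
    proof -
      have "continuous_on UNIV (\<lambda>t. integral {cl t..T} (g w (of_discrete i)))"
        by (rule continuous_on_compose2[OF Icont clc]) (use cl in auto)
      thus ?thesis unfolding G_def by (auto intro!: continuous_intros clc)
    qed
    have "isCont (G w) p" for p
    proof (cases p)
      case (Pair i t)
      have "((\<lambda>q. G w (i, snd q)) \<longlongrightarrow> G w (i, t)) (at (i, t))"
        using i[of i] by (auto simp: continuous_on_eq_continuous_at isCont_def intro!: isCont_tendsto_compose[where g="\<lambda>t. G w (i,t)"] tendsto_eq_intros)
      moreover have "\<forall>\<^sub>F q in at (i, t). fst q = i"
      proof -
        have "open ({i} \<times> (UNIV :: real set))" by (intro open_Times) (auto simp: Discrete_Topology.open_discrete)
        thus ?thesis
          unfolding eventually_at_topological by (intro exI[of _ "{i} \<times> UNIV"]) auto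
      qed
      hence "\<forall>\<^sub>F q in at (i, t). G w (i, snd q) = G w q"
        by eventually_elim auto
      ultimately show ?thesis unfolding Pair isCont_def by (rule Lim_transform_eventually)
    qed
    thus ?thesis by (simp add: continuous_on_eq_continuous_at)
  qed
  have Gbd: "\<bar>G w p\<bar> \<le> T * Bw w" for w p
  proof -
    let ?t = "cl (snd p)"
    have "\<bar>integral {?t..T} (g w (of_discrete (fst p)))\<bar> \<le> Bw w * (T - ?t)"
    proof -
      have "\<bar>integral {?t..T} (g w (of_discrete (fst p)))\<bar> \<le> integral {?t..T} (\<lambda>_. Bw w)"
        using gi[OF cl(1)] gb cl(1)[of "snd p"]
        by (subst real_norm_def[symmetric], intro integral_norm_bound_integral) auto
      thus ?thesis using cl(1)[of "snd p"] by (simp add: mult.commute)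
    qed
    also have "\<dots> \<le> Bw w * T" using cl(1)[of "snd p"] Bw0 by (intro mult_left_mono) auto
    finally have 1: "\<bar>integral {?t..T} (g w (of_discrete (fst p)))\<bar> \<le> Bw w * T" .
    have "exp (- L * (T - ?t)) \<le> 1" using L cl(1)[of "snd p"] by auto
    with 1 have "exp (- L * (T - ?t)) * \<bar>integral {?t..T} (g w (of_discrete (fst p)))\<bar> \<le> 1 * (Bw w * T)"
      by (intro mult_mono) auto
    thus ?thesis by (simp add: G_def abs_mult mult.commute)
  qed
  have Gbc: "G w \<in> bcontfun" for w
    using Gcont Gbd by (intro bcontfun_normI[where b="T * Bw w"]) auto
  have contr: "dist (Bcontfun (G w)) (Bcontfun (G w')) \<le> C / L * dist w w'" for w w'
  proof (rule dist_bound)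
    fix p :: "nat discrete \<times> real"
    let ?t = "cl (snd p)" let ?i = "of_discrete (fst p)" let ?d = "dist w w'"
    have t: "?t \<in> {0..T}" by (rule cl)
    have "\<bar>integral {?t..T} (g w ?i) - integral {?t..T} (g w' ?i)\<bar>
        = \<bar>integral {?t..T} (\<lambda>s. g w ?i s - g w' ?i s)\<bar>"
      using gi[OF t] by (simp add: integral_diff)
    also have "\<dots> \<le> integral {?t..T} (\<lambda>s. C * (exp (L * (T - ?t)) * ?d) * exp (L * (?t - s)))"
    proof (subst real_norm_def[symmetric], rule integral_norm_bound_integral)
      show "(\<lambda>s. g w ?i s - g w' ?i s) integrable_on {?t..T}"
        using gi[OF t] by (intro integrable_diff)
      show "(\<lambda>s. C * (exp (L * (T - ?t)) * ?d) * exp (L * (?t - s))) integrable_on {?t..T}"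
        by (intro integrable_continuous_real continuous_intros)
      fix s assume s: "s \<in> {?t..T}"
      have "\<bar>g w ?i s - g w' ?i s\<bar> \<le> C * (exp (L * (T - s)) * ?d)"
        unfolding g_def
      proof (rule lip)
        show "s \<in> {0..T}" using s t by auto
        fix j
        have "\<bar>apply_bcontfun w (discrete j, cl s) - apply_bcontfun w' (discrete j, cl s)\<bar> \<le> ?d"
          using dist_bounded[of w "(discrete j, cl s)" w'] by (simp add: dist_real_def)
        thus "\<bar>exp (L * (T - s)) * apply_bcontfun w (discrete j, cl s) - exp (L * (T - s)) * apply_bcontfun w' (discrete j, cl s)\<bar>
           \<le> exp (L * (T - s)) * ?d"
          unfolding right_diff_distrib[symmetric] abs_mult by (intro mult_mono) auto
      qed
      also have "exp (L * (T - s)) = exp (L * (T - ?t)) * exp (L * (?t - s))"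
        by (simp add: exp_add[symmetric] algebra_simps)
      finally show "norm (g w ?i s - g w' ?i s) \<le> C * (exp (L * (T - ?t)) * ?d) * exp (L * (?t - s))"
        by (simp add: algebra_simps)
    qed
    also have "\<dots> = C * (exp (L * (T - ?t)) * ?d) * ((1 - exp (L * (?t - T))) / L)"
      using integral_exp_weight[OF L(1), of ?t T] t
      by (simp add: integral_unique)
    also have "\<dots> \<le> C * (exp (L * (T - ?t)) * ?d) * (1 / L)"
      using L C by (intro mult_left_mono divide_right_mono) auto
    finally have *: "\<bar>integral {?t..T} (g w ?i) - integral {?t..T} (g w' ?i)\<bar> \<le> exp (L * (T - ?t)) * (C / L * ?d)"
      by (simp add: algebra_simps)
    have "\<bar>G w p - G w' p\<bar> = exp (- L * (T - ?t)) * \<bar>integral {?t..T} (g w ?i) - integral {?t..T} (g w' ?i)\<bar>"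
      by (simp add: G_def right_diff_distrib[symmetric] abs_mult)
    also have "\<dots> \<le> exp (- L * (T - ?t)) * (exp (L * (T - ?t)) * (C / L * ?d))"
      by (intro mult_left_mono *) auto
    also have "\<dots> = C / L * ?d" by (simp add: mult.assoc[symmetric] exp_add[symmetric])
    finally show "dist (apply_bcontfun (Bcontfun (G w)) p) (apply_bcontfun (Bcontfun (G w')) p) \<le> C / L * ?d"
      by (simp add: Bcontfun_inverse Gbc dist_real_def)
  qed
  have "\<exists>!w. Bcontfun (G w) = w"
    by (rule banach_fix_type[where c="C / L" and f="\<lambda>w. Bcontfun (G w)"]) (use contr L C in auto)
  then obtain w where w: "Bcontfun (G w) = w" by auto
  have Gw: "apply_bcontfun w p = G w p" for p
    using Bcontfun_inverse[OF Gbc[of w]] w by metis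
  define W where "W i t = exp (L * (T - cl t)) * apply_bcontfun w (discrete i, cl t)" for i t
  show ?thesis
  proof
    show "continuous_on UNIV (W i)" for i
      unfolding W_def by (intro continuous_intros clc wcont)
    show "\<bar>W i t\<bar> \<le> exp (L * T) * norm w" for i t
      unfolding W_def abs_mult using L cl(1)[of t] by (intro mult_mono wb) auto
    fix i t assume t: "t \<in> {0..T}"
    have "W i t = exp (L * (T - t)) * (exp (- L * (T - t)) * integral {t..T} (g w i))"
      using t by (simp add: W_def cl(2) Gw G_def discrete_inverse)
    also have "\<dots> = integral {t..T} (g w i)" by (simp add: mult.assoc[symmetric] exp_add[symmetric])
    also have "\<dots> = integral {t..T} (\<lambda>s. H i s (\<lambda>j. W j s))"
      by (rule integral_cong) (use t in \<open>simp add: g_def W_def cl(2)\<close>)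
    finally show "W i t = integral {t..T} (\<lambda>s. H i s (\<lambda>j. W j s))" .
  qed
qed

section \<open>A minimum principle for right derivatives\<close>

text \<open>Lift all functions by \<open>\<epsilon> * exp ((L + 1) * (T - t))\<close> and look at the last time \<open>s\<close> at which some
lifted function is not positive. Right of \<open>s\<close> all of them are positive, so at \<open>s\<close> one of them
vanishes and attains the minimum; its right derivative is then at most \<open>- \<epsilon> * exp ((L + 1) * (T - s)) < 0\<close>,
which pushes it below zero right of \<open>s\<close>. Only right derivatives enter, so coefficients that jump but
are right-continuous do no harm.\<close>

lemma minimum_principle:
  fixes D D' :: "'i \<Rightarrow> real \<Rightarrow> real" and L T :: real
  assumes fin: "finite I"
    and cont: "\<And>i. i \<in> I \<Longrightarrow> continuous_on {0..T} (D i)"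
    and final: "\<And>i. i \<in> I \<Longrightarrow> 0 \<le> D i T"
    and deriv: "\<And>i t. i \<in> I \<Longrightarrow> t \<in> {0..<T} \<Longrightarrow> (D i has_real_derivative D' i t) (at_right t)"
    and neg: "\<And>i t. i \<in> I \<Longrightarrow> t \<in> {0..<T} \<Longrightarrow> D i t < 0 \<Longrightarrow> (\<And>j. j \<in> I \<Longrightarrow> D i t \<le> D j t) \<Longrightarrow>
      D' i t \<le> - L * D i t"
    and i0: "i0 \<in> I" and t0: "t0 \<in> {0..T}"
  shows "0 \<le> D i0 t0"
proof (rule ccontr)
  assume "\<not> 0 \<le> D i0 t0"
  hence neg0: "D i0 t0 < 0" by simp
  define L1 where "L1 = L + 1"
  define \<epsilon> where "\<epsilon> = - D i0 t0 / (2 * exp (L1 * (T - t0)))"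
  have \<epsilon>: "0 < \<epsilon>" using neg0 by (simp add: \<epsilon>_def divide_neg_pos)
  define E where "E i t = D i t + \<epsilon> * exp (L1 * (T - t))" for i t
  have Econt: "continuous_on {0..T} (E i)" if "i \<in> I" for i
    unfolding E_def by (intro continuous_intros cont that)
  have E0: "E i0 t0 < 0" using neg0 by (simp add: E_def \<epsilon>_def)
  have ET: "0 < E i T" if "i \<in> I" for i using final[OF that] \<epsilon> by (simp add: E_def)
  \<comment> \<open>the closed set of bad times; its maximum is the time considered above\<close>
  define S where "S = (\<Union>i\<in>I. {t \<in> {t0..T}. E i t \<le> 0})"
  have "compact S"
    unfolding S_def
  proof (intro compact_UN fin)
    fix i assume i: "i \<in> I"
    have "continuous_on {t0..T} (E i)" using t0 by (intro continuous_on_subset[OF Econt[OF i]]) auto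
    hence "closed ({t0..T} \<inter> E i -` {..0})"
      by (rule continuous_closed_preimage) auto
    moreover have "bounded ({t0..T} \<inter> E i -` {..0})" by (rule bounded_subset[OF bounded_closed_interval]) auto
    moreover have "{t \<in> {t0..T}. E i t \<le> 0} = {t0..T} \<inter> E i -` {..0}" by auto
    ultimately show "compact {t \<in> {t0..T}. E i t \<le> 0}"
      by (simp add: compact_eq_bounded_closed)
  qed
  moreover have "t0 \<in> S" using E0 i0 t0 unfolding S_def by (auto intro: less_imp_le)
  ultimately obtain s where s: "s \<in> S" "\<And>t. t \<in> S \<Longrightarrow> t \<le> s"
    using compact_attains_sup[of S] by auto
  obtain i where i: "i \<in> I" "s \<in> {t0..T}" "E i s \<le> 0" using s(1) by (auto simp: S_def)
  have sT: "s < T" using ET[OF i(1)] i by (cases "s = T") auto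
  have s0: "s \<in> {0..<T}" using i t0 sT by auto
  have after: "0 < E j t" if "j \<in> I" "s < t" "t \<le> T" for j t
    using s(2)[of t] that i(2) by (force simp: S_def)
  have Es: "0 \<le> E j s" if j: "j \<in> I" for j
  proof (rule tendsto_lowerbound[where F="at_right s"])
    have "(E j has_real_derivative D' j s - \<epsilon> * (L1 * exp (L1 * (T - s)))) (at_right s)"
      unfolding E_def by (rule derivative_eq_intros deriv j s0 refl)+ simp
    thus "(E j \<longlongrightarrow> E j s) (at_right s)"
      using DERIV_continuous continuous_within by blast
    have "\<forall>\<^sub>F t in at_right s. t \<in> {s<..<T}"
      using sT by (auto simp: eventually_at_right_field)
    thus "\<forall>\<^sub>F t in at_right s. 0 \<le> E j t"
      by eventually_elim (use after[OF j] in \<open>auto intro: less_imp_le\<close>)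
  qed simp
  have Ei: "E i s = 0" using Es[OF i(1)] i by simp
  hence Di: "D i s = - \<epsilon> * exp (L1 * (T - s))" by (simp add: E_def)
  have min: "D i s \<le> D j s" if "j \<in> I" for j
    using Es[OF that] Ei by (simp add: E_def)
  have "D i s < 0" using \<epsilon> Di by simp
  from neg[OF i(1) s0 this min] have "D' i s \<le> - L * D i s" .
  moreover have "\<epsilon> * (L1 * exp (L1 * (T - s))) = - L1 * D i s" using Di by simp
  ultimately have less: "D' i s - \<epsilon> * (L1 * exp (L1 * (T - s))) < 0"
    using \<open>D i s < 0\<close> by (simp add: L1_def algebra_simps)
  have "(E i has_real_derivative D' i s - \<epsilon> * (L1 * exp (L1 * (T - s)))) (at_right s)"
    unfolding E_def by (rule derivative_eq_intros deriv i(1) s0 refl)+ simp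
  from has_real_derivative_neg_dec_right[OF this less] obtain d where
    d: "d > 0" "\<And>h. 0 < h \<Longrightarrow> h < d \<Longrightarrow> E i (s + h) < E i s" by auto
  define h where "h = min (d / 2) (T - s)"
  have "0 < h" "h < d" "s + h \<le> T" using d(1) sT by (auto simp: h_def)
  with d(2)[of h] after[OF i(1), of "s + h"] Ei show False by auto
qed

text \<open>The sequence \<open>x ^ k / fact k\<close> increases while \<open>k \<le> x\<close> and decreases afterwards, so on \<open>1, ..., n\<close>
it is smallest at an end point. This explains the two entries of the minimum in \<open>delta_lower\<close>.\<close>

lemma power_over_fact_ge_min:
  fixes x :: real
  assumes "0 \<le> x" "1 \<le> k" "k \<le> n"
  shows "min x (x ^ n / fact n) \<le> x ^ k / fact k"
proof (cases "real k \<le> x")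
  case True
  have "x \<le> x ^ j / fact j" if "1 \<le> j" "j \<le> k" for j
    using that
  proof (induction j rule: dec_induct)
    case (step j)
    have "x * 1 \<le> x ^ j / fact j * (x / real (Suc j))"
      using step True assms by (intro mult_mono) (auto simp: field_simps)
    thus ?case by (simp add: field_simps)
  qed simp
  hence "x \<le> x ^ k / fact k" using assms by simp
  thus ?thesis by (rule min.coboundedI1)
next
  case False
  have "x ^ j / fact j \<le> x ^ k / fact k" if "k \<le> j" for j
    using that
  proof (induction j rule: dec_induct)
    case (step j)
    have "x ^ j / fact j * (x / real (Suc j)) \<le> x ^ k / fact k * 1"
      using step False assms by (intro mult_mono) (auto simp: field_simps)
    thus ?case by (simp add: field_simps)
  qed simp
  hence "x ^ n / fact n \<le> x ^ k / fact k" using assms by simp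
  thus ?thesis by (rule min.coboundedI2)
qed

section \<open>The Hamilton-Jacobi-Bellman equation\<close>

text \<open>What the two rate functions contribute to the analysis: bounds, right-continuity and measurability.
The constant \<open>C\<close> is a common upper bound.\<close>

locale depletion_control =
  fixes N K :: nat and T \<pi> C :: real and lam e :: "real \<Rightarrow> real"
  assumes N_ge: "1 \<le> N" and K_ge: "1 \<le> K" and T_pos: "0 < T" and pi_pos: "0 < \<pi>"
    and lam_pos: "t \<in> {0..T} \<Longrightarrow> 0 < lam t" and lam_le: "t \<in> {0..T} \<Longrightarrow> lam t \<le> C"
    and e_pos: "t \<in> {0..T} \<Longrightarrow> 0 < e t" and e_le: "t \<in> {0..T} \<Longrightarrow> e t \<le> C"
    and lam_right: "t \<in> {0..<T} \<Longrightarrow> continuous (at_right t) lam"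
    and e_right: "t \<in> {0..<T} \<Longrightarrow> continuous (at_right t) e"
    and lam_meas: "(\<lambda>t. indicator {0..T} t * lam t) \<in> borel_measurable borel"
    and e_meas: "(\<lambda>t. indicator {0..T} t * e t) \<in> borel_measurable borel"
begin

definition act :: "nat \<Rightarrow> real" where "act i = real (min i K)"

text \<open>The Hamiltonian after minimising over the action: the action contributes \<open>(e - \<Delta>) * u\<close> with
\<open>u \<le> min i K\<close>, and the minimum is \<open>- min i K * max 0 (\<Delta> - e)\<close>. Along a solution of the equation
the expression is minus the time derivative of \<open>x i\<close>. For \<open>i = 0\<close> the truncated subtraction makes \<open>\<Delta> = 0\<close>, and the
factor \<open>act 0 = 0\<close> removes the term.\<close>

definition hjb_rhs :: "(nat \<Rightarrow> real \<Rightarrow> real) \<Rightarrow> nat \<Rightarrow> real \<Rightarrow> real" where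
  "hjb_rhs x i s = (if i < N then lam s * (x (i + 1) s - x i s) else \<pi> * lam s)
     - act i * max 0 (x i s - x (i - 1) s - e s)"

lemma act_bounds: "0 \<le> act i" "act i \<le> real K" "act i \<le> act (Suc i)" "act 0 = 0"
  "act (Suc (Suc i)) + act i \<le> 2 * act (Suc i)"
proof -
  have "min (Suc (Suc i)) K + min i K \<le> 2 * min (Suc i) K" by (simp add: min_def)
  thus "act (Suc (Suc i)) + act i \<le> 2 * act (Suc i)" unfolding act_def by linarith
qed (auto simp: act_def)

lemma C_pos: "0 < C" using lam_pos[of 0] lam_le[of 0] T_pos by auto

lemma hjb_solution_exists:
  obtains W where "\<And>i. continuous_on UNIV (W i)"
    "\<And>i t. i \<le> N \<Longrightarrow> t \<in> {0..T} \<Longrightarrow> W i t = integral {t..T} (hjb_rhs W i)"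
proof -
  define lamT where "lamT t = indicator {0..T} t * lam t" for t
  define eT where "eT t = indicator {0..T} t * e t" for t
  define H where "H i s x = (if N < i then 0 else (if i < N then lamT s * (x (i + 1) - x i) else \<pi> * lamT s)
     - act i * max 0 (x i - x (i - 1) - eT s))" for i s and x :: "nat \<Rightarrow> real"
  have lamT: "\<bar>lamT s\<bar> \<le> C" for s
    using lam_pos[of s] lam_le[of s] C_pos by (auto simp: lamT_def indicator_def)
  have eT: "0 \<le> eT s" for s
    using e_pos[of s] by (auto simp: eT_def indicator_def)
  obtain W B' where W: "\<And>i. continuous_on UNIV (W i)"
    "\<And>i t. t \<in> {0..T} \<Longrightarrow> W i t = integral {t..T} (\<lambda>s. H i s (\<lambda>j. W j s))"
  proof (rule ode_solution_exists[where H=H and C="2 * C + 2 * real K" and B="\<pi> * C" and T=T])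
    fix i s d and x y :: "nat \<Rightarrow> real"
    assume *: "\<And>j. \<bar>x j - y j\<bar> \<le> d"
    have "0 \<le> d" using *[of 0] by linarith
    define gx where "gx x = (if i < N then lamT s * (x (i + 1) - x i) else \<pi> * lamT s)" for x :: "nat \<Rightarrow> real"
    define mx where "mx x = max 0 (x i - x (i - 1) - eT s)" for x :: "nat \<Rightarrow> real"
    have 1: "\<bar>gx x - gx y\<bar> \<le> C * (2 * d)"
    proof (cases "i < N")
      case True
      have "\<bar>lamT s * ((x (i + 1) - y (i + 1)) - (x i - y i))\<bar> \<le> C * (2 * d)"
        unfolding abs_mult using *[of i] *[of "i + 1"] C_pos by (intro mult_mono lamT) auto
      thus ?thesis using True by (simp add: gx_def algebra_simps)
    qed (use \<open>0 \<le> d\<close> C_pos in \<open>auto simp: gx_def\<close>)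
    have max_lip: "\<bar>max 0 a - max 0 b\<bar> \<le> \<bar>a - b\<bar>" for a b :: real by (simp add: max_def)
    have "\<bar>mx x - mx y\<bar> \<le> \<bar>(x i - x (i - 1) - eT s) - (y i - y (i - 1) - eT s)\<bar>"
      unfolding mx_def by (rule max_lip)
    also have "\<dots> \<le> 2 * d" using *[of i] *[of "i - 1"] by linarith
    finally have "\<bar>act i * (mx x - mx y)\<bar> \<le> real K * (2 * d)"
      unfolding abs_mult using act_bounds(1,2)[of i] by (intro mult_mono) auto
    moreover have "H i s x - H i s y = (gx x - gx y) - act i * (mx x - mx y) \<or> H i s x - H i s y = 0"
      unfolding H_def gx_def mx_def by (cases "N < i") (simp, simp only: if_False, simp add: algebra_simps)
    ultimately have "\<bar>H i s x - H i s y\<bar> \<le> C * (2 * d) + real K * (2 * d)"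
      using 1 \<open>0 \<le> d\<close> C_pos by auto
    thus "\<bar>H i s x - H i s y\<bar> \<le> (2 * C + 2 * real K) * d" by (simp add: algebra_simps)
  next
    fix i s
    show "\<bar>H i s (\<lambda>_. 0)\<bar> \<le> \<pi> * C"
      using lamT[of s] eT[of s] pi_pos C_pos by (auto simp: H_def abs_mult)
  next
    fix i and w :: "nat \<Rightarrow> real \<Rightarrow> real"
    assume [measurable]: "\<And>j. w j \<in> borel_measurable borel"
    have [measurable]: "lamT \<in> borel_measurable borel" "eT \<in> borel_measurable borel"
      using lam_meas e_meas by (simp_all add: lamT_def[abs_def] eT_def[abs_def])
    show "(\<lambda>s. H i s (\<lambda>j. w j s)) \<in> borel_measurable borel"
      unfolding H_def by measurable
  qed (use T_pos C_pos in auto)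
  show ?thesis
  proof (rule that[OF W(1)])
    fix i t assume "i \<le> N" "t \<in> {0..T}"
    hence "integral {t..T} (\<lambda>s. H i s (\<lambda>j. W j s)) = integral {t..T} (hjb_rhs W i)"
      by (intro integral_cong) (auto simp: H_def hjb_rhs_def lamT_def eT_def)
    thus "W i t = integral {t..T} (hjb_rhs W i)" using W(2) \<open>t \<in> _\<close> by simp
  qed
qed

end

section \<open>Marginal costs\<close>

text \<open>A solution of the Hamilton-Jacobi-Bellman equation with final value \<open>0\<close>, considered independently of
the control problem; \<open>value_fun_eq\<close> identifies it with the value function.\<close>

locale hjb_solution = depletion_control +
  fixes W :: "nat \<Rightarrow> real \<Rightarrow> real"
  assumes W_cont: "continuous_on UNIV (W i)"
    and W_eq: "i \<le> N \<Longrightarrow> t \<in> {0..T} \<Longrightarrow> W i t = integral {t..T} (hjb_rhs W i)"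
begin

text \<open>The marginal costs, continued by \<open>\<pi>\<close> above \<open>N\<close>: a lost arrival costs \<open>\<pi>\<close>, just as if the state
moved from \<open>N\<close> to a state whose value exceeds \<open>W N\<close> by \<open>\<pi>\<close>. With this convention all rows of the
equation look alike.\<close>

definition delta :: "nat \<Rightarrow> real \<Rightarrow> real" where
  "delta i t = (if i = 0 then W 0 t else if i \<le> N then W i t - W (i - 1) t else \<pi>)"

definition excess :: "nat \<Rightarrow> real \<Rightarrow> real" where
  "excess i t = max 0 (delta i t - e t)"

definition gap :: "nat \<Rightarrow> real \<Rightarrow> real" where
  "gap i t = delta (Suc i) t - delta i t"

definition Lam :: "real \<Rightarrow> real" where
  "Lam t = integral {t..T} lam"

text \<open>The row for state \<open>N\<close> is no exception, because \<open>delta (Suc N) = \<pi>\<close>.\<close>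

lemma hjb_rhs_eq: "i \<le> N \<Longrightarrow> hjb_rhs W i s = lam s * delta (Suc i) s - act i * excess i s"
  by (cases "i = 0") (auto simp: hjb_rhs_def delta_def excess_def act_bounds)

lemma delta_cont: "continuous_on S (delta i)"
proof -
  have "continuous_on UNIV (delta i)"
    unfolding delta_def by (cases "i = 0"; cases "i \<le> N") (auto intro!: continuous_intros W_cont)
  thus ?thesis by (rule continuous_on_subset) auto
qed

lemma W_bounded: obtains B where "\<And>t. t \<in> {0..T} \<Longrightarrow> \<bar>W i t\<bar> \<le> B"
proof -
  have "compact (W i ` {0..T})"
    by (intro compact_continuous_image continuous_on_subset[OF W_cont]) auto
  then obtain B where "\<forall>x\<in>W i ` {0..T}. norm x \<le> B"
    using compact_imp_bounded bounded_iff by metis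
  thus ?thesis by (intro that[of B]) auto
qed

lemma delta_bounded: obtains B where "\<And>t. t \<in> {0..T} \<Longrightarrow> \<bar>delta i t\<bar> \<le> B"
proof -
  have "compact (delta i ` {0..T})"
    by (intro compact_continuous_image delta_cont) auto
  then obtain B where "\<forall>x\<in>delta i ` {0..T}. norm x \<le> B"
    using compact_imp_bounded bounded_iff by metis
  thus ?thesis by (intro that[of B]) auto
qed

lemma lam_integrable: "set_integrable lborel {0..T} lam" "lam integrable_on {0..T}"
proof -
  have b: "\<bar>indicator {0..T} s * lam s\<bar> \<le> C" if "s \<in> {0..T}" for s
    using lam_pos[OF that] lam_le[OF that] that by simp
  note * = bounded_measurable_integrable_on[OF lam_meas b, where a=0 and b=T]
  show "set_integrable lborel {0..T} lam"
    using *(1) by (simp add: set_integrable_def mult.assoc[symmetric] indicator_inter_arith[symmetric])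
  show "lam integrable_on {0..T}"
    by (rule integrable_eq[OF *(2)]) auto
qed

lemma Lam_eq_cum_rate: "t \<in> {0..T} \<Longrightarrow> cum_rate lam t T = Lam t"
  unfolding cum_rate_def Lam_def
  by (rule set_borel_integral_eq_integral(2), rule set_integrable_subset[OF lam_integrable(1)]) auto

lemma hjb_rhs_bounded_measurable:
  assumes "i \<le> N"
  obtains B where "(\<lambda>s. indicator {0..T} s * hjb_rhs W i s) \<in> borel_measurable borel"
    "\<And>s. s \<in> {0..T} \<Longrightarrow> \<bar>hjb_rhs W i s\<bar> \<le> B"
proof -
  obtain B1 where B1: "\<And>t. t \<in> {0..T} \<Longrightarrow> \<bar>delta (Suc i) t\<bar> \<le> B1" using delta_bounded by blast
  obtain B2 where B2: "\<And>t. t \<in> {0..T} \<Longrightarrow> \<bar>delta i t\<bar> \<le> B2" using delta_bounded by blast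
  show ?thesis
  proof
    note [measurable] = lam_meas e_meas
    have [measurable]: "delta i \<in> borel_measurable borel" for i
      by (intro borel_measurable_continuous_onI delta_cont)
    have "(\<lambda>s. (indicator {0..T} s * lam s) * delta (Suc i) s
        - indicator {0..T} s * (act i * max 0 (delta i s - indicator {0..T} s * e s))) \<in> borel_measurable borel"
      by measurable
    also have "(\<lambda>s. (indicator {0..T} s * lam s) * delta (Suc i) s
        - indicator {0..T} s * (act i * max 0 (delta i s - indicator {0..T} s * e s)))
        = (\<lambda>s. indicator {0..T} s * hjb_rhs W i s)"
      by (auto simp: hjb_rhs_eq[OF assms] excess_def indicator_def fun_eq_iff)
    finally show "(\<lambda>s. indicator {0..T} s * hjb_rhs W i s) \<in> borel_measurable borel" .
    fix s assume s: "s \<in> {0..T}"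
    have "\<bar>lam s * delta (Suc i) s\<bar> \<le> C * B1"
      unfolding abs_mult using lam_pos[OF s] lam_le[OF s] B1[OF s] by (intro mult_mono) auto
    moreover have "\<bar>excess i s\<bar> \<le> B2" using B2[OF s] e_pos[OF s] by (auto simp: excess_def)
    hence "\<bar>act i * excess i s\<bar> \<le> real K * B2"
      unfolding abs_mult using act_bounds(1,2)[of i] by (intro mult_mono) auto
    ultimately show "\<bar>hjb_rhs W i s\<bar> \<le> C * B1 + real K * B2"
      unfolding hjb_rhs_eq[OF assms] by linarith
  qed
qed

lemma hjb_rhs_integrable:
  assumes "i \<le> N" "0 \<le> a" "b \<le> T"
  shows "set_integrable lborel {a..b} (hjb_rhs W i)" "hjb_rhs W i integrable_on {a..b}"
proof -
  obtain B where B: "(\<lambda>s. indicator {0..T} s * hjb_rhs W i s) \<in> borel_measurable borel"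
    "\<And>s. s \<in> {0..T} \<Longrightarrow> \<bar>hjb_rhs W i s\<bar> \<le> B" using hjb_rhs_bounded_measurable[OF assms(1)] by blast
  note * = bounded_measurable_integrable_on[OF B(1), where a=0 and b=T and B=B]
  have "set_integrable lborel {0..T} (\<lambda>s. indicator {0..T} s * hjb_rhs W i s)"
    by (rule *) (use B(2) in auto)
  hence "set_integrable lborel {0..T} (hjb_rhs W i)"
    by (simp add: set_integrable_def mult.assoc[symmetric] indicator_inter_arith[symmetric])
  thus 1: "set_integrable lborel {a..b} (hjb_rhs W i)"
    by (rule set_integrable_subset) (use assms in auto)
  show "hjb_rhs W i integrable_on {a..b}"
    using set_borel_integral_eq_integral(1)[OF 1] .
qed

text \<open>Differentiation within \<open>{a..T}\<close> gives right derivatives for \<open>a = t\<close> and two-sided ones for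
\<open>a = 0\<close>; the former exist at every time, the latter only where the coefficients are continuous.\<close>

lemma deriv_of_tail_integral:
  fixes f F :: "real \<Rightarrow> real"
  assumes fi: "f integrable_on {0..T}" and F: "\<And>t. t \<in> {0..T} \<Longrightarrow> F t = integral {t..T} f"
    and a: "0 \<le> a" "t \<in> {a..T}" and f: "continuous (at t within {a..T}) f"
  shows "(F has_real_derivative - f t) (at t within {a..T})"
proof -
  have fa: "f integrable_on {a..T}"
    using integrable_subinterval_real[OF fi] a by auto
  have "((\<lambda>u. integral {a..u} f) has_vector_derivative f t) (at t within {a..T} - {})"
    by (rule integral_has_vector_derivative_continuous_at[OF fa]) (use a f in auto)
  hence "((\<lambda>u. F a - integral {a..u} f) has_real_derivative - f t) (at t within {a..T})"
    by (auto simp: has_real_derivative_iff_has_vector_derivative[symmetric] intro!: derivative_eq_intros)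
  thus ?thesis
  proof (rule has_field_derivative_transform_within[where d=1])
    fix u assume "u \<in> {a..T}"
    thus "F a - integral {a..u} f = F u"
      using Henstock_Kurzweil_Integration.integral_combine[OF _ _ fa, of u] F[of a] F[of u] a by auto
  qed (use a in auto)
qed

lemma right_deriv_of_tail_integral:
  fixes f F :: "real \<Rightarrow> real"
  assumes "f integrable_on {0..T}" "\<And>t. t \<in> {0..T} \<Longrightarrow> F t = integral {t..T} f"
    and t: "t \<in> {0..<T}" and "continuous (at_right t) f"
  shows "(F has_real_derivative - f t) (at_right t)"
  using deriv_of_tail_integral[OF assms(1,2), of t t] assms by (simp add: at_within_Icc_at_right)

lemma delta_cont_within: "continuous (at t within S) (delta i)"
  using delta_cont[of UNIV i] by (simp add: continuous_on_eq_continuous_at continuous_at_imp_continuous_at_within)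

lemma hjb_rhs_cont:
  assumes "i \<le> N" "continuous (at t within S) lam" "continuous (at t within S) e"
  shows "continuous (at t within S) (hjb_rhs W i)"
proof -
  have "hjb_rhs W i = (\<lambda>s. lam s * delta (Suc i) s - act i * max 0 (delta i s - e s))"
    using hjb_rhs_eq[OF assms(1)] by (auto simp: excess_def)
  thus ?thesis by (auto intro!: continuous_intros assms delta_cont_within)
qed

lemma delta_final: "1 \<le> i \<Longrightarrow> i \<le> N \<Longrightarrow> delta i T = 0" "delta (Suc N) T = \<pi>"
  using T_pos W_eq[of i T] W_eq[of "i - 1" T] by (auto simp: delta_def)

text \<open>The right-hand side of the evolution equation of the marginal costs, the difference of two
neighbouring rows.\<close>

definition delta_slope :: "nat \<Rightarrow> real \<Rightarrow> real" where
  "delta_slope i t = (if i \<le> N then - lam t * gap i t + act i * excess i t - act (i - 1) * excess (i - 1) t else 0)"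

lemma delta_right_deriv:
  assumes "1 \<le> i" "t \<in> {0..<T}"
  shows "(delta i has_real_derivative delta_slope i t) (at_right t)"
proof (cases "i \<le> N")
  case True
  have W: "(W j has_real_derivative - hjb_rhs W j t) (at_right t)" if "j \<le> N" for j
    by (rule right_deriv_of_tail_integral) (use assms that hjb_rhs_integrable W_eq hjb_rhs_cont lam_right e_right T_pos in auto)
  have "delta i = (\<lambda>t. W i t - W (i - 1) t)" using True assms by (auto simp: delta_def)
  moreover have "((\<lambda>t. W i t - W (i - 1) t) has_real_derivative - hjb_rhs W i t - - hjb_rhs W (i - 1) t) (at_right t)"
    by (intro derivative_intros W) (use True in auto)
  moreover have "- hjb_rhs W i t - - hjb_rhs W (i - 1) t = delta_slope i t"
    using True assms by (simp add: hjb_rhs_eq delta_slope_def gap_def algebra_simps)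
  ultimately show ?thesis by simp
next
  case False
  hence "delta i = (\<lambda>t. \<pi>)" using assms by (auto simp: delta_def)
  thus ?thesis using False by (simp add: delta_slope_def)
qed

lemma delta_deriv:
  assumes "1 \<le> i" "i \<le> N" "t \<in> {0<..<T}" "isCont lam t" "isCont e t"
  shows "(delta i has_real_derivative delta_slope i t) (at t)"
proof -
  have Icc: "at t within {0..T} = at t" using assms by (intro at_within_interior) auto
  have W: "(W j has_real_derivative - hjb_rhs W j t) (at t)" if "j \<le> N" for j
    using deriv_of_tail_integral[of "hjb_rhs W j" "W j" 0 t] assms that hjb_rhs_integrable(2)[of j 0 T] W_eq[of j]
      hjb_rhs_cont[of j t UNIV] T_pos by (auto simp: Icc)
  have "delta i = (\<lambda>t. W i t - W (i - 1) t)" using assms by (auto simp: delta_def)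
  moreover have "((\<lambda>t. W i t - W (i - 1) t) has_real_derivative - hjb_rhs W i t - - hjb_rhs W (i - 1) t) (at t)"
    by (intro derivative_intros W) (use assms in auto)
  moreover have "- hjb_rhs W i t - - hjb_rhs W (i - 1) t = delta_slope i t"
    using assms by (simp add: hjb_rhs_eq delta_slope_def gap_def algebra_simps)
  ultimately show ?thesis by simp
qed

end

section \<open>Grids\<close>

lemma grid_mono:
  assumes gr: "grid T m \<tau>" and "k \<le> l" "l \<le> Suc m"
  shows "\<tau> k \<le> \<tau> l"
  using assms(2,3)
proof (induction l rule: dec_induct)
  case (step n)
  thus ?case using gr by (force simp: grid_def)
qed simp

lemma grid_bounds:
  assumes gr: "grid T m \<tau>" and "k \<le> Suc m"
  shows "0 \<le> \<tau> k" "\<tau> k \<le> T"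
  using grid_mono[OF gr, of 0 k] grid_mono[OF gr, of k "Suc m"] assms by (auto simp: grid_def)

lemma grid_locate:
  assumes gr: "grid T m \<tau>" and x: "0 \<le> x" "x < T"
  shows "\<exists>k\<le>m. x \<in> {\<tau> k..<\<tau> (k + 1)}"
proof -
  define k where "k = (LEAST k. x < \<tau> (k + 1))"
  have ex: "x < \<tau> (m + 1)" using x gr by (simp add: grid_def)
  have k: "x < \<tau> (k + 1)" "k \<le> m" unfolding k_def by (rule LeastI[of _ m], rule ex) (rule Least_le, rule ex)
  have "\<tau> k \<le> x"
  proof (cases k)
    case 0
    thus ?thesis using x gr by (simp add: grid_def)
  next
    case (Suc j)
    hence "j < (LEAST k. x < \<tau> (k + 1))" by (simp add: k_def)
    from not_less_Least[OF this] show ?thesis using Suc by simp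
  qed
  thus ?thesis using k by auto
qed

lemma C1_pieceD:
  fixes x :: real and f :: "real \<Rightarrow> real"
  assumes "f C1_differentiable_on {\<tau> k<..<\<tau> (k + 1)}" "x \<in> {\<tau> k<..<\<tau> (k + 1)}"
  shows "isCont f x" "(f has_real_derivative deriv f x) (at x)"
proof -
  have "f differentiable (at x)"
    using assms by (auto simp: C1_differentiable_on_eq)
  thus "isCont f x" "(f has_real_derivative deriv f x) (at x)"
    by (auto simp: differentiable_imp_continuous_within DERIV_deriv_iff_real_differentiable)
qed

section \<open>Convexity and lower bounds for the gaps\<close>

context hjb_solution
begin

lemma excess_nonneg: "0 \<le> excess i t"
  by (simp add: excess_def)

lemma excess_step:
  "0 \<le> gap i t \<Longrightarrow> excess i t \<le> excess (Suc i) t"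
  "0 \<le> gap i t \<Longrightarrow> excess (Suc i) t - excess i t \<le> gap i t"
  "gap i t \<le> 0 \<Longrightarrow> excess (Suc i) t \<le> excess i t"
  "gap i t \<le> 0 \<Longrightarrow> excess i t - excess (Suc i) t \<le> - gap i t"
  by (auto simp: gap_def excess_def)

lemma gap_cont: "continuous_on S (gap i)"
  unfolding gap_def by (intro continuous_intros delta_cont)

lemma gap_right_deriv:
  "1 \<le> i \<Longrightarrow> t \<in> {0..<T} \<Longrightarrow>
   (gap i has_real_derivative delta_slope (Suc i) t - delta_slope i t) (at_right t)"
  unfolding gap_def by (intro derivative_intros delta_right_deriv) auto

text \<open>The second difference of \<open>i \<mapsto> act i * excess i\<close>, the contribution of the control to the evolution
of the gaps.\<close>

definition curvature :: "nat \<Rightarrow> real \<Rightarrow> real" where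
  "curvature i t = act (Suc i) * excess (Suc i) t - 2 * act i * excess i t + act (i - 1) * excess (i - 1) t"

lemma gap_slope_eq:
  "i < N \<Longrightarrow> delta_slope (Suc i) t - delta_slope i t = - lam t * (gap (Suc i) t - gap i t) + curvature i t"
  "delta_slope (Suc N) t - delta_slope N t = lam t * gap N t - act N * excess N t + act (N - 1) * excess (N - 1) t"
  by (simp_all add: delta_slope_def curvature_def algebra_simps)

text \<open>For \<open>i = 1\<close> there is no comparison between \<open>excess 0\<close> and \<open>excess 1\<close>; the vanishing coefficient
\<open>act 0\<close> makes up for it.\<close>

lemma lower_product:
  assumes "1 \<le> i" "2 \<le> i \<Longrightarrow> excess (i - 1) t \<le> excess i t + d"
  shows "act (i - 1) * excess (i - 1) t \<le> act (i - 1) * (excess i t + d)"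
  using assms act_bounds(1)[of "i - 1"] act_bounds(4)
  by (cases "i = 1") (auto intro!: mult_left_mono)

lemma act_step: "1 \<le> i \<Longrightarrow> act (i - 1) \<le> act i" "1 \<le> i \<Longrightarrow> act (Suc i) + act (i - 1) \<le> 2 * act i"
  using act_bounds(3)[of "i - 1"] act_bounds(5)[of "i - 1"] by auto

text \<open>Convexity of the value function in the state. In the equation for \<open>gap j\<close> the neighbours \<open>gap (j - 1)\<close>
and \<open>gap (j + 1)\<close> enter with nonnegative coefficients, and the remaining source term is nonnegative
because \<open>act\<close> is concave; so the minimum principle applies, with the final values \<open>0\<close> and, for
\<open>j = N\<close>, \<open>\<pi>\<close>.\<close>

lemma gap_nonneg:
  assumes "1 \<le> i" "i \<le> N" "t \<in> {0..T}"
  shows "0 \<le> gap i t"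
proof (rule minimum_principle[where I="{1..N}" and L="real K" and D=gap
      and D'="\<lambda>i t. delta_slope (Suc i) t - delta_slope i t"])
  fix j assume j: "j \<in> {1..N}"
  show "continuous_on {0..T} (gap j)" by (rule gap_cont)
  show "0 \<le> gap j T"
    using j delta_final(1)[of j] delta_final(1)[of "Suc j"] delta_final(2) pi_pos
    by (cases "j = N") (auto simp: gap_def)
  fix t assume t: "t \<in> {0..<T}"
  show "(gap j has_real_derivative delta_slope (Suc j) t - delta_slope j t) (at_right t)"
    using gap_right_deriv j t by auto
  assume neg: "gap j t < 0" and min: "\<And>k. k \<in> {1..N} \<Longrightarrow> gap j t \<le> gap k t"
  have lam: "0 < lam t" using lam_pos t by auto
  have "excess (j - 1) t \<le> excess j t + - gap j t" if "2 \<le> j"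
  proof -
    have s: "Suc (j - 1) = j" using that by simp
    have "gap j t \<le> gap (j - 1) t" using that j by (intro min) auto
    thus ?thesis
      using excess_step(1,4)[of "j - 1" t, unfolded s] neg by (cases "0 \<le> gap (j - 1) t") auto
  qed
  hence low: "act (j - 1) * excess (j - 1) t \<le> act (j - 1) * (excess j t + - gap j t)"
    using j by (intro lower_product) auto
  have cK: "act (j - 1) * (- gap j t) \<le> real K * (- gap j t)"
    using act_bounds(2) neg by (intro mult_right_mono) auto
  show "delta_slope (Suc j) t - delta_slope j t \<le> - real K * gap j t"
  proof (cases "j < N")
    case True
    have "0 \<le> lam t * (gap (Suc j) t - gap j t)"
      using lam min[of "Suc j"] True by (intro mult_nonneg_nonneg) auto
    moreover have "act (Suc j) * excess (Suc j) t \<le> act (Suc j) * excess j t"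
      using excess_step(3)[of j t] neg act_bounds(1) by (intro mult_left_mono) auto
    moreover have "(act (Suc j) + act (j - 1)) * excess j t \<le> 2 * act j * excess j t"
      using act_step(2)[of j] j excess_nonneg by (intro mult_right_mono) auto
    ultimately show ?thesis
      using low cK unfolding gap_slope_eq(1)[OF True] curvature_def by (simp add: algebra_simps)
  next
    case False
    hence N: "j = N" using j by auto
    have "lam t * gap j t \<le> 0" using lam neg by (simp add: mult_le_0_iff)
    moreover have "act (j - 1) * excess j t \<le> act j * excess j t"
      using act_step(1)[of j] j excess_nonneg by (intro mult_right_mono) auto
    ultimately show ?thesis
      using low cK unfolding N gap_slope_eq(2) by (simp add: algebra_simps)
  qed
qed (use assms in auto)

lemma delta_mono:
  assumes "1 \<le> i" "i \<le> j" "j \<le> Suc N" "t \<in> {0..T}"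
  shows "delta i t \<le> delta j t"
  using assms(2,3)
proof (induction j rule: dec_induct)
  case (step k)
  thus ?case using gap_nonneg[of k t] assms by (auto simp: gap_def)
qed simp

lemma excess_mono:
  assumes "1 \<le> i" "i \<le> N" "t \<in> {0..T}"
  shows "act (i - 1) * excess (i - 1) t \<le> act (i - 1) * excess i t"
proof -
  have "excess (i - 1) t \<le> excess i t + 0" if "2 \<le> i"
    using excess_step(1)[of "i - 1" t] gap_nonneg[of "i - 1" t] that assms by simp
  from lower_product[OF assms(1) this] show ?thesis by simp
qed

text \<open>\<open>excess\<close> is a nondecreasing 1-Lipschitz image of \<open>delta\<close>, so its increments lie between \<open>0\<close> and the
gaps; concavity of \<open>act\<close> disposes of the rest.\<close>

lemma curvature_le:
  assumes "1 \<le> i" "i < N" "t \<in> {0..T}"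
  shows "curvature i t \<le> real K * gap i t"
proof -
  have g: "0 \<le> gap i t" using gap_nonneg assms by auto
  have "act (Suc i) * (excess (Suc i) t - excess i t) \<le> real K * gap i t"
    using excess_step(1,2)[OF g] act_bounds(1,2) by (intro mult_mono) auto
  moreover have "(act (Suc i) + act (i - 1)) * excess i t \<le> 2 * act i * excess i t"
    using act_step(2)[of i] assms excess_nonneg by (intro mult_right_mono) auto
  ultimately show ?thesis
    using excess_mono[of i t] assms unfolding curvature_def by (simp add: algebra_simps)
qed

lemma Lam_deriv: "t \<in> {0..<T} \<Longrightarrow> (Lam has_real_derivative - lam t) (at_right t)"
  by (rule right_deriv_of_tail_integral[OF lam_integrable(2)]) (auto simp: Lam_def lam_right)

lemma Lam_cont: "continuous_on {0..T} Lam"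
  unfolding Lam_def using indefinite_integral_continuous_1'[OF lam_integrable(2)] .

lemma Lam_nonneg: "t \<in> {0..T} \<Longrightarrow> 0 \<le> Lam t"
  unfolding Lam_def
  by (rule integral_nonneg[OF integrable_subinterval_real[OF lam_integrable(2)]]) (auto intro!: less_imp_le lam_pos)

lemma Lam_final: "Lam T = 0" by (simp add: Lam_def)

text \<open>The control can only shrink \<open>delta N\<close>. Without it \<open>gap N\<close> would solve \<open>g' = lam * g\<close> with
\<open>g T = \<pi>\<close>, and this is the bound.\<close>

lemma last_gap_ge:
  assumes "t \<in> {0..T}"
  shows "\<pi> * exp (- Lam t) \<le> gap N t"
proof -
  have "0 \<le> gap N t - \<pi> * exp (- Lam t)"
  proof (rule minimum_principle[where I="{()}" and L=0 and D="\<lambda>_ t. gap N t - \<pi> * exp (- Lam t)"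
      and D'="\<lambda>_ t. delta_slope (Suc N) t - delta_slope N t - \<pi> * (exp (- Lam t) * lam t)"])
    fix t assume t: "t \<in> {0..<T}"
    show "((\<lambda>t. gap N t - \<pi> * exp (- Lam t)) has_real_derivative
       delta_slope (Suc N) t - delta_slope N t - \<pi> * (exp (- Lam t) * lam t)) (at_right t)"
      using Lam_deriv[OF t] gap_right_deriv[OF N_ge t] by (auto intro!: derivative_eq_intros)
    assume neg: "gap N t - \<pi> * exp (- Lam t) < 0"
    have "act (N - 1) * excess (N - 1) t \<le> act (N - 1) * excess N t"
      by (rule excess_mono) (use N_ge t in auto)
    also have "\<dots> \<le> act N * excess N t"
      using act_step(1)[of N] N_ge excess_nonneg by (intro mult_right_mono) auto
    finally have "delta_slope (Suc N) t - delta_slope N t - \<pi> * (exp (- Lam t) * lam t)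
        \<le> lam t * (gap N t - \<pi> * exp (- Lam t))"
      unfolding gap_slope_eq(2) by (simp add: algebra_simps)
    also have "\<dots> \<le> 0" using lam_pos[of t] t neg by (intro mult_nonneg_nonpos) auto
    finally show "delta_slope (Suc N) t - delta_slope N t - \<pi> * (exp (- Lam t) * lam t)
       \<le> - 0 * (gap N t - \<pi> * exp (- Lam t))" by simp
  next
    have "gap N T = \<pi>" using delta_final N_ge by (simp add: gap_def)
    thus "0 \<le> gap N T - \<pi> * exp (- Lam T)" by (simp add: Lam_final)
  qed (use assms in \<open>auto intro!: continuous_intros gap_cont Lam_cont\<close>)
  thus ?thesis by simp
qed

text \<open>These functions solve \<open>B\<^sub>k' = (lam + K) * B\<^sub>k - lam * B\<^sub>k\<^sub>-\<^sub>1\<close>, the equation that the gaps, counted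
downwards from \<open>N\<close>, satisfy with \<open>\<le>\<close>.\<close>

definition gap_bound :: "nat \<Rightarrow> real \<Rightarrow> real" where
  "gap_bound k t = \<pi> * exp (- Lam t - real K * (T - t)) * (Lam t ^ k / fact k)"

lemma gap_bound_right_deriv:
  assumes t: "t \<in> {0..<T}"
  shows "(gap_bound (Suc k) has_real_derivative
     (lam t + real K) * gap_bound (Suc k) t - lam t * gap_bound k t) (at_right t)"
proof -
  have f: "fact (Suc k) = real (Suc k) * fact k" by simp
  have E: "((\<lambda>t. \<pi> * exp (- Lam t - real K * (T - t))) has_real_derivative
      \<pi> * exp (- Lam t - real K * (T - t)) * (lam t + real K)) (at_right t)"
    using Lam_deriv[OF t] by (auto intro!: derivative_eq_intros)
  have P: "((\<lambda>t. Lam t ^ Suc k / fact (Suc k)) has_real_derivative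
      real (Suc k) * (- lam t * Lam t ^ (Suc k - Suc 0)) / fact (Suc k)) (at_right t)"
    by (intro DERIV_cdivide DERIV_power Lam_deriv[OF t])
  have P': "real (Suc k) * (- lam t * Lam t ^ (Suc k - Suc 0)) / fact (Suc k) = - lam t * (Lam t ^ k / fact k)"
    unfolding f by (simp del: of_nat_Suc)
  show ?thesis
    unfolding gap_bound_def
    by (rule DERIV_cong[OF DERIV_mult[OF E P[unfolded P']]]) (simp only: algebra_simps)
qed

text \<open>The gaps are bounded one after the other from \<open>N\<close> downwards: backwards in time, each feeds the one
below it at rate \<open>lam\<close> and loses at most at rate \<open>lam + K\<close>.\<close>

lemma gap_ge_bound:
  assumes "k < N" "t \<in> {0..T}"
  shows "gap_bound k t \<le> gap (N - k) t"
  using assms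
proof (induction k arbitrary: t)
  case 0
  have "exp (- Lam t - real K * (T - t)) \<le> exp (- Lam t)" using 0 by simp
  hence "gap_bound 0 t \<le> \<pi> * exp (- Lam t)"
    unfolding gap_bound_def using pi_pos by simp
  also have "\<dots> \<le> gap N t" by (rule last_gap_ge[OF 0(2)])
  finally show ?case by simp
next
  case (Suc k)
  define i where "i = N - Suc k"
  have i: "1 \<le> i" "i < N" "Suc i = N - k" using Suc.prems by (auto simp: i_def)
  let ?D = "\<lambda>_::unit. \<lambda>t. gap i t - gap_bound (Suc k) t"
  let ?D' = "\<lambda>_::unit. \<lambda>t. delta_slope (Suc i) t - delta_slope i t
      - ((lam t + real K) * gap_bound (Suc k) t - lam t * gap_bound k t)"
  have "0 \<le> ?D () t"
  proof (rule minimum_principle[where I="{()}" and L=0 and D="?D" and D'="?D'"])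
    fix t assume t: "t \<in> {0..<T}"
    show "(?D () has_real_derivative ?D' () t) (at_right t)"
      by (intro derivative_intros gap_bound_right_deriv gap_right_deriv t i)
    assume neg: "?D () t < 0"
    have l: "0 < lam t" using lam_pos t by auto
    have "curvature i t \<le> real K * gap i t" using curvature_le i t by auto
    moreover have "lam t * gap_bound k t \<le> lam t * gap (Suc i) t"
      using Suc.IH[of t] Suc.prems t l unfolding i by (intro mult_left_mono) auto
    ultimately have "?D' () t \<le> (lam t + real K) * ?D () t"
      unfolding gap_slope_eq(1)[OF i(2)] by (simp add: algebra_simps)
    also have "\<dots> \<le> 0" using l neg by (intro mult_nonneg_nonpos) auto
    finally show "?D' () t \<le> - 0 * ?D () t" by simp
  next
    have "gap i T = 0" using delta_final(1)[of i] delta_final(1)[of "Suc i"] i by (simp add: gap_def)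
    thus "0 \<le> ?D () T" by (simp add: gap_bound_def Lam_final)
  next
    show "continuous_on {0..T} (?D ())"
      unfolding gap_bound_def by (intro continuous_intros gap_cont Lam_cont) auto
  qed (use Suc.prems in auto)
  thus ?case by (simp add: i_def)
qed

text \<open>The minimum over all states at once. It is through this bound that the sufficient condition makes
the operating cost decrease more slowly than \<open>lam * gap i\<close> for every \<open>i\<close>.\<close>

lemma gap_ge_delta_lower:
  assumes i: "1 \<le> i" "i \<le> N" and t: "t \<in> {0..T}"
  shows "min (delta_lower N K T \<pi> lam t) (\<pi> * exp (- cum_rate lam t T)) \<le> gap i t"
proof (cases "i = N")
  case True
  thus ?thesis using last_gap_ge[OF t] Lam_eq_cum_rate[OF t] by simp
next
  case False
  have "delta_lower N K T \<pi> lam t = \<pi> * exp (- Lam t - real K * (T - t)) *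
      min (Lam t) (Lam t ^ (N - 1) / fact (N - 1))"
    using Lam_eq_cum_rate[OF t] by (simp add: delta_lower_def)
  also have "\<dots> \<le> gap_bound (N - i) t"
    unfolding gap_bound_def using pi_pos i False
    by (intro mult_left_mono power_over_fact_ge_min Lam_nonneg t) auto
  also have "\<dots> \<le> gap i t" using gap_ge_bound[of "N - i" t] i t False by simp
  finally show ?thesis by simp
qed

section \<open>Comparing marginal and operating cost\<close>

text \<open>While \<open>delta i\<close> exceeds \<open>e\<close>, the difference \<open>f = e - delta i\<close> satisfies \<open>f' > act i * f\<close>: the gap
term is outweighed by the assumption on \<open>e'\<close>, and the excess in state \<open>i\<close> equals \<open>- f\<close>. Hence
\<open>f\<close> cannot become negative. Reversing time puts this into the form of the minimum principle.\<close>

lemma stays_below: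
  assumes i: "1 \<le> i" "i \<le> N" and ab: "0 \<le> a" "b \<le> T" "t \<in> {a..<b}"
    and ea: "continuous (at_right a) e" and lam_c: "\<And>s. s \<in> {a<..<b} \<Longrightarrow> isCont lam s"
    and e': "\<And>s. s \<in> {a<..<b} \<Longrightarrow> (e has_real_derivative e' s) (at s)"
    and slope: "\<And>s. s \<in> {a<..<b} \<Longrightarrow> - lam s * gap i s < e' s"
    and start: "delta i a \<le> e a"
  shows "delta i t \<le> e t"
proof (cases "t = a")
  case False
  hence t: "a < t" "t < b" using ab by auto
  let ?D = "\<lambda>_::unit. \<lambda>r. e (t - r) - delta i (t - r)"
  let ?D' = "\<lambda>_::unit. \<lambda>r. - (e' (t - r) - delta_slope i (t - r))"
  have e_cont: "continuous_on {a..t} e"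
    unfolding continuous_on_eq_continuous_within
  proof
    fix s assume s: "s \<in> {a..t}"
    show "continuous (at s within {a..t}) e"
    proof (cases "s = a")
      case True
      thus ?thesis using ea t by (simp add: at_within_Icc_at_right)
    next
      case False
      hence "isCont e s" using e'[of s] s t by (intro DERIV_isCont) auto
      thus ?thesis by (rule continuous_at_imp_continuous_at_within)
    qed
  qed
  \<comment> \<open>time runs backwards from \<open>t\<close>, so the final value of \<open>?D\<close> is the assumption at \<open>a\<close>\<close>
  have "0 \<le> ?D () 0"
  proof (rule minimum_principle[where I="{()}" and L="act i" and D="?D" and D'="?D'" and T="t - a"])
    show "continuous_on {0..t - a} (?D ())"
    proof (rule continuous_on_diff)
      have flip: "continuous_on {0..t - a} (\<lambda>r. t - r)" by (intro continuous_intros)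
      show "continuous_on {0..t - a} (\<lambda>r. e (t - r))"
        by (rule continuous_on_compose2[OF e_cont flip]) auto
      show "continuous_on {0..t - a} (\<lambda>r. delta i (t - r))"
        by (rule continuous_on_compose2[OF delta_cont[of UNIV] flip]) auto
    qed
    fix r assume r: "r \<in> {0..<t - a}"
    define s where "s = t - r"
    have s: "s \<in> {a<..<b}" "s \<in> {0<..<T}" using r t ab by (auto simp: s_def)
    have De: "(e has_real_derivative e' s) (at s)" by (rule e'[OF s(1)])
    have Dd: "(delta i has_real_derivative delta_slope i s) (at s)"
      by (rule delta_deriv[OF i s(2) lam_c[OF s(1)] DERIV_isCont[OF De]])
    have flip: "((\<lambda>r. t - r) has_real_derivative -1) (at r)"
      by (auto intro!: derivative_eq_intros)
    have "((\<lambda>r. e (t - r) - delta i (t - r)) has_real_derivative (e' s * (-1) - delta_slope i s * (-1))) (at r)"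
      by (rule DERIV_diff[OF DERIV_chain2[OF De[unfolded s_def] flip, folded s_def] DERIV_chain2[OF Dd[unfolded s_def] flip, folded s_def]])
    hence "((\<lambda>r. e (t - r) - delta i (t - r)) has_real_derivative - (e' s - delta_slope i s)) (at_right r)"
      by (rule has_field_derivative_at_within[THEN DERIV_cong]) linarith
    thus "(?D () has_real_derivative ?D' () r) (at_right r)" by (simp only: s_def)
    assume "?D () r < 0"
    hence neg: "e s - delta i s < 0" by (simp only: s_def)
    hence ex: "excess i s = delta i s - e s" by (simp add: excess_def)
    have "0 \<le> act (i - 1) * excess (i - 1) s"
      by (intro mult_nonneg_nonneg act_bounds excess_nonneg)
    moreover have "delta_slope i s = - lam s * gap i s + act i * excess i s - act (i - 1) * excess (i - 1) s"
      using i by (simp only: delta_slope_def if_True)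
    moreover have "- lam s * gap i s < e' s" by (rule slope[OF s(1)])
    moreover have "act i * excess i s = - act i * (e s - delta i s)" unfolding ex by (simp add: algebra_simps)
    ultimately have "- (e' s - delta_slope i s) \<le> - act i * (e s - delta i s)" by linarith
    thus "?D' () r \<le> - act i * ?D () r" by (simp only: s_def)
  qed (use start t in auto)
  thus ?thesis by simp
qed (use start in simp)

text \<open>Within one piece the previous lemma applies; at the end of a piece the inequality passes to the
left limit of \<open>e\<close>, and an upward jump of \<open>e\<close> preserves it. At \<open>T\<close> the marginal cost is \<open>0 < e T\<close>.\<close>

lemma stays_below_on_horizon:
  assumes i: "1 \<le> i" "i \<le> N" and gr: "grid T m \<tau>"
    and C1: "\<And>k. k \<le> m \<Longrightarrow> lam C1_differentiable_on {\<tau> k<..<\<tau> (k + 1)}"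
      "\<And>k. k \<le> m \<Longrightarrow> e C1_differentiable_on {\<tau> k<..<\<tau> (k + 1)}"
    and jumps: "has_left_limits m \<tau> e" "no_downward_jumps m \<tau> e"
    and slope: "\<And>k s. k \<le> m \<Longrightarrow> s \<in> {\<tau> k<..<\<tau> (k + 1)} \<Longrightarrow> - lam s * gap i s < deriv e s"
    and below: "delta i t \<le> e t" and t: "0 \<le> t" "t \<le> s" "s \<le> T"
  shows "delta i s \<le> e s"
proof (cases "s = T")
  case True
  thus ?thesis using delta_final(1)[OF i] e_pos[of T] T_pos by simp
next
  case sT: False
  have piece: "delta i s \<le> e s" if k: "k \<le> m" and a: "a \<in> {\<tau> k..<\<tau> (k + 1)}" "s \<in> {a..<\<tau> (k + 1)}" "delta i a \<le> e a" for a s k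
  proof (rule stays_below[OF i, where a=a and b="\<tau> (k + 1)" and e'="deriv e"])
    show "0 \<le> a" "\<tau> (k + 1) \<le> T" using grid_bounds[OF gr, of k] grid_bounds[OF gr, of "k + 1"] k a by auto
    show "continuous (at_right a) e"
      using grid_bounds[OF gr, of k] grid_bounds[OF gr, of "k + 1"] k a by (intro e_right) auto
    fix s assume s: "s \<in> {a<..<\<tau> (k + 1)}"
    hence s': "s \<in> {\<tau> k<..<\<tau> (k + 1)}" using a by auto
    show "isCont lam s" "(e has_real_derivative deriv e s) (at s)" "- lam s * gap i s < deriv e s"
      using C1_pieceD[OF C1(1)[OF k] s'] C1_pieceD[OF C1(2)[OF k] s'] slope[OF k s'] by auto
  qed (use a in auto)
  have at_end: "delta i (\<tau> (k + 1)) \<le> e (\<tau> (k + 1))"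
    if k: "k \<le> m" and a: "a \<in> {\<tau> k..<\<tau> (k + 1)}" "delta i a \<le> e a" for a k
  proof -
    obtain l where l: "(e \<longlongrightarrow> l) (at_left (\<tau> (k + 1)))"
      using jumps(1) k by (force simp: has_left_limits_def)
    have "l \<le> e (\<tau> (k + 1))"
      using jumps(2) k tendsto_Lim[OF _ l] by (force simp: no_downward_jumps_def)
    moreover have "delta i (\<tau> (k + 1)) \<le> l"
    proof (rule tendsto_le[OF _ l])
      show "(delta i \<longlongrightarrow> delta i (\<tau> (k + 1))) (at_left (\<tau> (k + 1)))"
        using delta_cont_within[of "\<tau> (k + 1)"] by (simp add: continuous_within)
      show "\<forall>\<^sub>F x in at_left (\<tau> (k + 1)). delta i x \<le> e x"
        unfolding eventually_at_left_field
        by (rule exI[of _ a]) (use piece[OF k a(1) _ a(2)] a in auto)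
    qed simp
    ultimately show ?thesis by simp
  qed
  obtain k where k: "k \<le> m" "t \<in> {\<tau> k..<\<tau> (k + 1)}" using grid_locate[OF gr, of t] t sT by auto
  have reach: "delta i (\<tau> l) \<le> e (\<tau> l)" if "Suc k \<le> l" "l \<le> m" for l
    using that
  proof (induction l rule: dec_induct)
    case base
    show ?case using at_end[OF k below] by simp
  next
    case (step l)
    show ?case using at_end[of l "\<tau> l"] step gr by (auto simp: grid_def)
  qed
  obtain l where l: "l \<le> m" "s \<in> {\<tau> l..<\<tau> (l + 1)}" using grid_locate[OF gr, of s] t sT by auto
  show ?thesis
  proof (cases "l \<le> k")
    case True
    have "\<tau> (l + 1) \<le> \<tau> (k + 1)" using grid_mono[OF gr, of "l + 1" "k + 1"] True k by auto
    thus ?thesis using piece[OF k _ below, of s] k l t by auto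
  next
    case False
    thus ?thesis using piece[OF l(1), of "\<tau> l" s] reach[of l] l by auto
  qed
qed

text \<open>The function \<open>e - delta i\<close> vanishes at \<open>t\<close> and is nonnegative afterwards, so its derivative is
nonnegative. At the touching point the control terms vanish and \<open>delta (i + 1) \<le> \<pi>\<close>.\<close>

lemma slope_at_crossing:
  assumes i: "1 \<le> i" "i \<le> N" and t: "0 < t" "t < T" and "isCont lam t"
    and e': "(e has_real_derivative e') (at t)"
    and touch: "delta i t = e t" and later: "\<And>s. t \<le> s \<Longrightarrow> s \<le> T \<Longrightarrow> delta i s \<le> e s"
  shows "- lam t * (\<pi> - e t) \<le> e'"
proof -
  have tT: "t \<in> {0..T}" using t by auto
  have D: "((\<lambda>s. e s - delta i s) has_real_derivative e' - delta_slope i t) (at t)"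
    by (intro derivative_intros e' delta_deriv i DERIV_isCont[OF e'] assms) (use t in auto)
  have "0 \<le> e' - delta_slope i t"
  proof (rule ccontr)
    assume "\<not> ?thesis"
    then obtain d where d: "0 < d" "\<And>h. 0 < h \<Longrightarrow> h < d \<Longrightarrow> e (t + h) - delta i (t + h) < e t - delta i t"
      using has_real_derivative_neg_dec_right[OF D] by auto
    define h where "h = min (d / 2) (T - t)"
    have "0 < h" "h < d" "t + h \<le> T" using d(1) t by (auto simp: h_def)
    thus False using d(2)[of h] later[of "t + h"] touch by auto
  qed
  moreover have "excess i t = 0" using touch by (simp add: excess_def)
  moreover have "act (i - 1) * excess (i - 1) t = 0"
    using excess_mono[OF i tT] \<open>excess i t = 0\<close> act_bounds(1)[of "i - 1"] excess_nonneg[of "i - 1" t]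
    by (metis mult_nonneg_nonneg mult_zero_right order_antisym)
  ultimately have "- lam t * gap i t \<le> e'" using i by (auto simp: delta_slope_def)
  moreover have "gap i t \<le> \<pi> - e t"
    using delta_mono[of "Suc i" "Suc N" t] i tT touch by (simp add: gap_def delta_def)
  hence "lam t * gap i t \<le> lam t * (\<pi> - e t)" using lam_pos[OF tT] by (intro mult_left_mono) auto
  ultimately show ?thesis by simp
qed

end

section \<open>Counting the jumps of a step path\<close>

lemma jump_times_split:
  assumes "s \<le> q" "q \<le> r"
  shows "jump_times x i j s r = jump_times x i j s q \<union> jump_times x i j q r"
    "jump_times x i j s q \<inter> jump_times x i j q r = {}"
  using assms by (auto simp: jump_times_def)

lemma left_value_unique:
  fixes v :: real
  assumes "\<forall>\<^sub>F w in at_left v. x w = i" "\<forall>\<^sub>F w in at_left v. x w = i'"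
  shows "i = i'"
proof -
  have "\<forall>\<^sub>F w in at_left v. i = i'"
    using assms by eventually_elim simp
  thus ?thesis by simp
qed

lemma left_value_on_interval:
  fixes v :: real
  assumes "a < v" "\<And>w. a < w \<Longrightarrow> w < v \<Longrightarrow> x w = c"
  shows "\<forall>\<^sub>F w in at_left v. x w = c"
  unfolding eventually_at_left_field using assms by (intro exI[of _ a]) auto

lemma jump_times_constant_cell:
  assumes "\<And>w. a \<le> w \<Longrightarrow> w \<le> b \<Longrightarrow> x w = c" "i \<noteq> j"
  shows "jump_times x i j a b = {}"
proof -
  have False if v: "v \<in> {a<..b}" "\<forall>\<^sub>F w in at_left v. x w = i" "x v = j" for v
  proof -
    have "\<forall>\<^sub>F w in at_left v. x w = c"
      by (rule left_value_on_interval[of a]) (use v assms in auto)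
    hence "i = c" by (rule left_value_unique[OF v(2)])
    thus False using v assms by auto
  qed
  thus ?thesis by (auto simp: jump_times_def)
qed

lemma jump_times_single_cell:
  assumes d: "a < d" "d \<le> b"
    and before: "\<And>w. a \<le> w \<Longrightarrow> w < d \<Longrightarrow> x w = x a"
    and after: "\<And>w. d \<le> w \<Longrightarrow> w \<le> b \<Longrightarrow> x w = x b"
    and "i \<noteq> j"
  shows "jump_times x i j a b = (if x a = i \<and> x b = j then {d} else {})"
proof -
  have "jump_times x i j d b = {}"
    by (rule jump_times_constant_cell[OF after \<open>i \<noteq> j\<close>])
  moreover have "v = d" if "v \<in> jump_times x i j a d" for v
  proof (rule ccontr)
    assume "v \<noteq> d"
    hence "v < d" "v \<in> jump_times x i j a v" using that by (auto simp: jump_times_def)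
    moreover have "jump_times x i j a v = {}"
      by (rule jump_times_constant_cell[OF before \<open>i \<noteq> j\<close>]) (use \<open>v < d\<close> in auto)
    ultimately show False by simp
  qed
  moreover have "d \<in> jump_times x i j a d \<longleftrightarrow> x a = i \<and> x b = j"
  proof -
    have "\<forall>\<^sub>F w in at_left d. x w = x a"
      by (rule left_value_on_interval[OF d(1) before]) auto
    hence "(\<forall>\<^sub>F w in at_left d. x w = i) \<longleftrightarrow> x a = i"
      using left_value_unique[of x "x a" d i] by auto
    moreover have "x d = x b" by (rule after) (use d in auto)
    ultimately show ?thesis using d by (simp add: jump_times_def)
  qed
  ultimately show ?thesis
    using jump_times_split(1)[of a d b x i j] d by auto
qed

definition grid_point :: "real \<Rightarrow> real \<Rightarrow> nat \<Rightarrow> nat \<Rightarrow> real" where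
  "grid_point s r n k = s + (r - s) * real k / real n"

text \<open>Once the cells are shorter than the distance between any two jump times, a cell contains at most
one jump, which can be read off from the values at its ends. The grid count is measurable in the
sample point, which is not evident for the number of jumps itself.\<close>

lemma jump_count_eq_grid_count:
  assumes x: "step_path T x" and s: "0 \<le> s" "s \<le> r" "r \<le> T" and ij: "i \<noteq> j"
  shows "\<forall>\<^sub>F n in sequentially.
     card (jump_times x i j s r) = (\<Sum>k<n. of_bool (x (grid_point s r n k) = i \<and> x (grid_point s r n (Suc k)) = j))"
proof -
  obtain D where D: "finite D" "\<And>t s. t \<in> {0..T} \<Longrightarrow> s \<in> {t..T} \<Longrightarrow> D \<inter> {t<..s} = {} \<Longrightarrow> x s = x t"
    using x unfolding step_path_def by blast
  \<comment> \<open>the least distance between two points of \<open>D\<close>; the \<open>1\<close> covers the case of a single point\<close>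
  obtain \<delta> where \<delta>: "0 < \<delta>" "\<And>d d'. d \<in> D \<Longrightarrow> d' \<in> D \<Longrightarrow> d \<noteq> d' \<Longrightarrow> \<delta> \<le> \<bar>d - d'\<bar>"
  proof -
    define S where "S = insert 1 ((\<lambda>(d, d'). \<bar>d - d'\<bar>) ` {p \<in> D \<times> D. fst p \<noteq> snd p})"
    have fin: "finite S" using D(1) by (simp add: S_def)
    have "0 < Min S" using fin by (subst Min_gr_iff) (auto simp: S_def)
    moreover have "Min S \<le> \<bar>d - d'\<bar>" if "d \<in> D" "d' \<in> D" "d \<noteq> d'" for d d'
      by (rule Min_le[OF fin]) (use that in \<open>force simp: S_def\<close>)
    ultimately show ?thesis using that by blast
  qed
  have one_cell: "finite (jump_times x i j a b)"
      "card (jump_times x i j a b) = of_bool (x a = i \<and> x b = j)"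
    if ab: "0 \<le> a" "a \<le> b" "b \<le> T" "b - a < \<delta>" for a b
  proof -
    have "card (jump_times x i j a b) = of_bool (x a = i \<and> x b = j) \<and> finite (jump_times x i j a b)"
    proof (cases "D \<inter> {a<..b} = {}")
      case True
      have const: "x w = x a" if "a \<le> w" "w \<le> b" for w
      proof (rule D(2))
        show "D \<inter> {a<..w} = {}" using True that by (auto simp: disjoint_iff)
      qed (use that ab in auto)
      have "x b = x a" by (rule const) (use ab in auto)
      moreover have "jump_times x i j a b = {}" by (rule jump_times_constant_cell[OF const ij])
      ultimately show ?thesis using ij by auto
    next
      case False
      then obtain d where d: "d \<in> D" "a < d" "d \<le> b" by auto
      have uniq: "d' = d" if "d' \<in> D" "a < d'" "d' \<le> b" for d'
      proof (rule ccontr)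
        assume "d' \<noteq> d"
        hence "\<delta> \<le> \<bar>d - d'\<bar>" using \<delta>(2) d that by metis
        thus False using that d ab by linarith
      qed
      have before: "x w = x a" if "a \<le> w" "w < d" for w
      proof (rule D(2))
        have False if v: "v \<in> D" "a < v" "v \<le> w" for v
          using uniq[OF v(1,2)] v(3) \<open>w < d\<close> d by linarith
        thus "D \<inter> {a<..w} = {}" by auto
      qed (use that ab d in auto)
      have from_d: "x w = x d" if "d \<le> w" "w \<le> b" for w
      proof (rule D(2))
        have False if v: "v \<in> D" "d < v" "v \<le> w" for v
          using uniq[OF v(1)] v(2,3) \<open>w \<le> b\<close> d by linarith
        thus "D \<inter> {d<..w} = {}" by auto
      qed (use that ab d in auto)
      have "x b = x d" by (rule from_d) (use d in auto)
      hence after: "x w = x b" if "d \<le> w" "w \<le> b" for w using from_d[OF that] by metis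
      have "jump_times x i j a b = (if x a = i \<and> x b = j then {d} else {})"
        by (rule jump_times_single_cell[OF d(2,3) before after ij])
      thus ?thesis by simp
    qed
    thus "card (jump_times x i j a b) = of_bool (x a = i \<and> x b = j)"
      "finite (jump_times x i j a b)" by auto
  qed
  obtain n0 where n0: "(r - s) / real n < \<delta>" if "n0 < n" for n :: nat
  proof -
    obtain n0 :: nat where "(r - s) / \<delta> < real n0" using reals_Archimedean2 by blast
    hence "(r - s) / real n < \<delta>" if "n0 < n" for n :: nat
    proof -
      have "(r - s) / \<delta> < real n" using \<open>_ < real n0\<close> that by linarith
      thus ?thesis using \<delta>(1) that by (simp add: field_simps)
    qed
    thus ?thesis using that by blast
  qed
  show ?thesis
  proof (rule eventually_sequentiallyI[of "Suc n0"])
    fix n assume "Suc n0 \<le> n"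
    hence n: "0 < n" "(r - s) / real n < \<delta>" using n0 by auto
    have step: "grid_point s r n (Suc k) - grid_point s r n k = (r - s) / real n" for k
      using n by (simp add: grid_point_def field_simps)
    have le: "grid_point s r n k \<le> grid_point s r n (Suc k)" for k
    proof -
      have "0 \<le> (r - s) / real n" using s by simp
      thus ?thesis using step[of k] by linarith
    qed
    have bnd: "s \<le> grid_point s r n k" "k \<le> n \<Longrightarrow> grid_point s r n k \<le> r" for k
    proof -
      show "s \<le> grid_point s r n k" using s by (simp add: grid_point_def)
      assume "k \<le> n"
      hence "(r - s) * (real k / real n) \<le> (r - s) * 1"
        using s n by (intro mult_left_mono) auto
      thus "grid_point s r n k \<le> r" by (simp add: grid_point_def)
    qed
    have "card (jump_times x i j s (grid_point s r n k)) =
        (\<Sum>l<k. of_bool (x (grid_point s r n l) = i \<and> x (grid_point s r n (Suc l)) = j))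
        \<and> finite (jump_times x i j s (grid_point s r n k))" if "k \<le> n" for k
      using that
    proof (induction k)
      case 0
      show ?case by (simp add: grid_point_def jump_times_def)
    next
      case (Suc k)
      let ?a = "grid_point s r n k" and ?b = "grid_point s r n (Suc k)"
      have ab: "0 \<le> ?a" "?a \<le> ?b" "?b \<le> T" "?b - ?a < \<delta>"
        using bnd(1)[of k] bnd(2)[of "Suc k"] Suc.prems s le[of k] step[of k] n by auto
      have fin: "finite (jump_times x i j ?a ?b)"
        by (rule one_cell(1)[OF ab])
      have "jump_times x i j s ?b = jump_times x i j s ?a \<union> jump_times x i j ?a ?b"
        by (rule jump_times_split) (use bnd(1)[of k] le[of k] in auto)
      moreover have "jump_times x i j s ?a \<inter> jump_times x i j ?a ?b = {}"
        by (rule jump_times_split) (use bnd(1)[of k] le[of k] in auto)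
      ultimately show ?case
        using Suc fin one_cell(2)[OF ab] by (simp add: card_Un_disjoint)
    qed
    from this[of n] n show "card (jump_times x i j s r) =
        (\<Sum>k<n. of_bool (x (grid_point s r n k) = i \<and> x (grid_point s r n (Suc k)) = j))"
      by (simp add: grid_point_def)
  qed
qed

text \<open>Telescoping: each step of the grid that enters \<open>j\<close> raises the indicator of \<open>j\<close>, each step that leaves
\<open>j\<close> lowers it.\<close>

lemma grid_count_balance:
  fixes x :: "nat \<Rightarrow> nat"
  assumes "\<And>k. k \<le> n \<Longrightarrow> x k \<le> N" "j \<le> N"
  shows "of_bool (x n = j) + (\<Sum>i\<in>{0..N} - {j}. \<Sum>k<n. of_bool (x k = j \<and> x (Suc k) = i))
    = (of_bool (x 0 = j) + (\<Sum>i\<in>{0..N} - {j}. \<Sum>k<n. of_bool (x k = i \<and> x (Suc k) = j)) :: nat)"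
  using assms(1)
proof (induction n)
  case (Suc n)
  have out: "(\<Sum>i\<in>{0..N} - {j}. of_bool (x n = j \<and> x (Suc n) = i)) = (of_bool (x n = j \<and> x (Suc n) \<noteq> j) :: nat)"
  proof (cases "x n = j \<and> x (Suc n) \<noteq> j")
    case True
    thus ?thesis using Suc.prems[of "Suc n"] by (simp add: of_bool_def)
  qed (auto intro!: sum.neutral)
  have into: "(\<Sum>i\<in>{0..N} - {j}. of_bool (x n = i \<and> x (Suc n) = j)) = (of_bool (x n \<noteq> j \<and> x (Suc n) = j) :: nat)"
  proof (cases "x n \<noteq> j \<and> x (Suc n) = j")
    case True
    thus ?thesis using Suc.prems[of n] by (simp add: of_bool_def)
  qed (auto intro!: sum.neutral)
  have IH: "of_bool (x n = j) + (\<Sum>i\<in>{0..N} - {j}. \<Sum>k<n. of_bool (x k = j \<and> x (Suc k) = i))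
    = (of_bool (x 0 = j) + (\<Sum>i\<in>{0..N} - {j}. \<Sum>k<n. of_bool (x k = i \<and> x (Suc k) = j)) :: nat)"
    by (rule Suc.IH) (use Suc.prems in auto)
  have "of_bool (x (Suc n) = j) + of_bool (x n = j \<and> x (Suc n) \<noteq> j)
     = (of_bool (x n = j) + of_bool (x n \<noteq> j \<and> x (Suc n) = j) :: nat)"
    by (auto simp: of_bool_def)
  thus ?case using IH by (simp only: sum.lessThan_Suc sum.distrib out into)
qed simp

section \<open>Integration by parts\<close>

lemma set_integrable_bounded_Icc:
  fixes f :: "real \<Rightarrow> real"
  assumes "(\<lambda>v. indicator {a..b} v * f v) \<in> borel_measurable borel"
    "\<And>v. v \<in> {a..b} \<Longrightarrow> \<bar>f v\<bar> \<le> B"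
  shows "set_integrable lborel {a..b} f"
  unfolding set_integrable_def
proof (rule integrableI_bounded_set[where A="{a..b}" and B=B])
  show "(\<lambda>x. indicat_real {a..b} x *\<^sub>R f x) \<in> borel_measurable lborel"
    using assms(1) by simp
  show "emeasure lborel {a..b} < \<infinity>"
    by (cases "a \<le> b") simp_all
qed (use assms(2) in \<open>auto simp: indicator_def\<close>)

text \<open>The two functions are merely primitives of bounded measurable functions; the formula is Fubini's
theorem for \<open>f v * g w\<close> on the triangle \<open>v \<le> w\<close>.\<close>

lemma integration_by_parts_primitives:
  fixes f g F G :: "real \<Rightarrow> real"
  assumes ab: "a \<le> b"
    and fm: "(\<lambda>v. indicator {a..b} v * f v) \<in> borel_measurable borel"
    and gm: "(\<lambda>v. indicator {a..b} v * g v) \<in> borel_measurable borel"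
    and fb: "\<And>v. v \<in> {a..b} \<Longrightarrow> \<bar>f v\<bar> \<le> Bf" and gb: "\<And>v. v \<in> {a..b} \<Longrightarrow> \<bar>g v\<bar> \<le> Bg"
    and F: "\<And>r. r \<in> {a..b} \<Longrightarrow> F r = F a + (LBINT v:{a..r}. f v)"
    and G: "\<And>r. r \<in> {a..b} \<Longrightarrow> G r = G a + (LBINT v:{a..r}. g v)"
    and Gm: "(\<lambda>v. indicator {a..b} v * G v) \<in> borel_measurable borel"
    and Gb: "\<And>v. v \<in> {a..b} \<Longrightarrow> \<bar>G v\<bar> \<le> BG"
    and Fm: "(\<lambda>v. indicator {a..b} v * F v) \<in> borel_measurable borel"
    and Fb: "\<And>v. v \<in> {a..b} \<Longrightarrow> \<bar>F v\<bar> \<le> BF"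
  shows "F b * G b - F a * G a = (LBINT v:{a..b}. f v * G v + F v * g v)"
    "set_integrable lborel {a..b} (\<lambda>v. f v * G v + F v * g v)"
proof -
  define f0 where "f0 v = indicator {a..b} v * f v" for v
  define g0 where "g0 v = indicator {a..b} v * g v" for v
  have [measurable]: "f0 \<in> borel_measurable borel" "g0 \<in> borel_measurable borel"
    using fm gm by (simp_all add: f0_def[abs_def] g0_def[abs_def])
  have Bf: "0 \<le> Bf" "0 \<le> Bg" using fb[of a] gb[of a] ab by auto
  have int: "integrable (lborel \<Otimes>\<^sub>M lborel) (\<lambda>(v, w). (if v \<le> w then 1 else 0) * (f0 v * g0 w))"
  proof (rule integrableI_bounded_set[where A="{a..b} \<times> {a..b}" and B="Bf * Bg"])
    show "emeasure (lborel \<Otimes>\<^sub>M lborel) ({a..b} \<times> {a..b}) < \<infinity>"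
      using ab by (simp add: lborel.emeasure_pair_measure_Times ennreal_mult_less_top)
    show "AE p in lborel \<Otimes>\<^sub>M lborel. p \<in> {a..b} \<times> {a..b} \<longrightarrow>
        norm (case p of (v, w) \<Rightarrow> (if v \<le> w then 1 else 0) * (f0 v * g0 w)) \<le> Bf * Bg"
      using fb gb Bf by (auto simp: f0_def g0_def abs_mult intro!: AE_I2 mult_mono)
    show "(\<lambda>(v, w). (if v \<le> w then 1 else 0) * (f0 v * g0 w)) \<in> borel_measurable (lborel \<Otimes>\<^sub>M lborel)"
      by measurable
    show "AE p in lborel \<Otimes>\<^sub>M lborel. p \<notin> {a..b} \<times> {a..b} \<longrightarrow>
        (case p of (v, w) \<Rightarrow> (if v \<le> w then 1 else 0) * (f0 v * g0 w)) = 0"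
      by (intro AE_I2) (auto simp: f0_def g0_def indicator_def)
  qed simp
  have fi: "set_integrable lborel {a..b} f" by (rule set_integrable_bounded_Icc[OF fm fb])
  have gi: "set_integrable lborel {a..b} g" by (rule set_integrable_bounded_Icc[OF gm gb])
  have inner_w: "(\<integral>w. (if v \<le> w then 1 else 0) * (f0 v * g0 w) \<partial>lborel) = f0 v * (G b - G v)" for v
  proof (cases "v \<in> {a..b}")
    case True
    have "(\<integral>w. (if v \<le> w then 1 else 0) * (f0 v * g0 w) \<partial>lborel)
        = (\<integral>w. f0 v * ((if v \<le> w then 1 else 0) * g0 w) \<partial>lborel)"
      by (simp only: mult.left_commute)
    also have "\<dots> = f0 v * (\<integral>w. (if v \<le> w then 1 else 0) * g0 w \<partial>lborel)"
      by (rule integral_mult_right_zero)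
    also have "(\<integral>w. (if v \<le> w then 1 else 0) * g0 w \<partial>lborel) = (LBINT w:{v..b}. g w)"
      unfolding set_lebesgue_integral_def
      by (rule Bochner_Integration.integral_cong) (use True in \<open>auto simp: g0_def indicator_def\<close>)
    also have "\<dots> = G b - G v"
    proof -
      have "(LBINT w:{a..b}. g w) = (LBINT w:{a..v}. g w) + (LBINT w:{v<..b}. g w)"
      proof (subst set_integral_Un[symmetric])
        have "{a..v} \<union> {v<..b} = {a..b}" using True by auto
        thus "(LBINT w:{a..b}. g w) = (LBINT w:{a..v} \<union> {v<..b}. g w)" by simp
      qed (use True in \<open>auto intro!: set_integrable_subset[OF gi]\<close>)
      moreover have "(LBINT w:{v<..b}. g w) = (LBINT w:{v..b}. g w)"
      proof (rule set_integral_cong_set)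
        have "AE w in lborel. w \<noteq> v" by (rule AE_lborel_singleton)
        thus "AE w in lborel. (w \<in> {v..b}) = (w \<in> {v<..b})" by eventually_elim auto
        have gi': "set_integrable lborel {v..b} g" "set_integrable lborel {v<..b} g"
          using True by (auto intro!: set_integrable_subset[OF gi])
        thus "set_borel_measurable lborel {v..b} g" "set_borel_measurable lborel {v<..b} g"
          by (simp_all add: set_borel_measurable_def set_integrable_def)
      qed
      ultimately show ?thesis using G[of b] G[OF True] ab by simp
    qed
    finally show ?thesis .
  qed (simp add: f0_def)
  have inner_v: "(\<integral>v. (if v \<le> w then 1 else 0) * (f0 v * g0 w) \<partial>lborel) = g0 w * (F w - F a)" for w
  proof (cases "w \<in> {a..b}")
    case True
    have "(\<integral>v. (if v \<le> w then 1 else 0) * (f0 v * g0 w) \<partial>lborel)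
        = (\<integral>v. g0 w * ((if v \<le> w then 1 else 0) * f0 v) \<partial>lborel)"
      by (simp only: ac_simps)
    also have "\<dots> = g0 w * (\<integral>v. (if v \<le> w then 1 else 0) * f0 v \<partial>lborel)"
      by (rule integral_mult_right_zero)
    also have "(\<integral>v. (if v \<le> w then 1 else 0) * f0 v \<partial>lborel) = (LBINT v:{a..w}. f v)"
      unfolding set_lebesgue_integral_def
      by (rule Bochner_Integration.integral_cong) (use True in \<open>auto simp: f0_def indicator_def\<close>)
    also have "\<dots> = F w - F a" using F[OF True] by simp
    finally show ?thesis .
  qed (simp add: g0_def)
  have eq: "(\<integral>v. f0 v * (G b - G v) \<partial>lborel) = (\<integral>w. g0 w * (F w - F a) \<partial>lborel)"
    using lborel_pair.Fubini_integral[OF int] by (simp add: inner_w inner_v)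
  have fG: "set_integrable lborel {a..b} (\<lambda>v. f v * G v)"
  proof (rule set_integrable_bounded_Icc[where B="Bf * BG"])
    have "(\<lambda>v. (indicator {a..b} v * f v) * (indicator {a..b} v * G v)) \<in> borel_measurable borel"
      using fm Gm by (rule borel_measurable_times)
    also have "(\<lambda>v. (indicator {a..b} v * f v) * (indicator {a..b} v * G v)) = (\<lambda>v. indicator {a..b} v * (f v * G v))"
      by (auto simp: indicator_def)
    finally show "(\<lambda>v. indicator {a..b} v * (f v * G v)) \<in> borel_measurable borel" .
  qed (use fb Gb Bf in \<open>auto simp: abs_mult intro!: mult_mono\<close>)
  have Fg: "set_integrable lborel {a..b} (\<lambda>v. F v * g v)"
  proof (rule set_integrable_bounded_Icc[where B="BF * Bg"])
    have "(\<lambda>v. (indicator {a..b} v * F v) * (indicator {a..b} v * g v)) \<in> borel_measurable borel"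
      using Fm gm by (rule borel_measurable_times)
    also have "(\<lambda>v. (indicator {a..b} v * F v) * (indicator {a..b} v * g v)) = (\<lambda>v. indicator {a..b} v * (F v * g v))"
      by (auto simp: indicator_def)
    finally show "(\<lambda>v. indicator {a..b} v * (F v * g v)) \<in> borel_measurable borel" .
    have "0 \<le> BF" using Fb[of a] ab by auto
    fix v assume "v \<in> {a..b}"
    thus "\<bar>F v * g v\<bar> \<le> BF * Bg"
      unfolding abs_mult using Fb gb \<open>0 \<le> BF\<close> by (intro mult_mono) auto
  qed
  show "set_integrable lborel {a..b} (\<lambda>v. f v * G v + F v * g v)"
    using fG Fg by (rule set_integral_add(1))
  have "(\<integral>v. f0 v * (G b - G v) \<partial>lborel) = (LBINT v:{a..b}. G b * f v - f v * G v)"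
    unfolding set_lebesgue_integral_def
    by (rule Bochner_Integration.integral_cong) (auto simp: f0_def algebra_simps)
  also have "\<dots> = G b * (LBINT v:{a..b}. f v) - (LBINT v:{a..b}. f v * G v)"
    using fi fG by (subst set_integral_diff(2)) (auto simp: set_integral_mult_right)
  finally have 1: "(\<integral>v. f0 v * (G b - G v) \<partial>lborel) = G b * (F b - F a) - (LBINT v:{a..b}. f v * G v)"
    using F[of b] ab by simp
  have "(\<integral>w. g0 w * (F w - F a) \<partial>lborel) = (LBINT v:{a..b}. F v * g v - F a * g v)"
    unfolding set_lebesgue_integral_def
    by (rule Bochner_Integration.integral_cong) (auto simp: g0_def algebra_simps)
  also have "\<dots> = (LBINT v:{a..b}. F v * g v) - F a * (LBINT v:{a..b}. g v)"
    using gi Fg by (subst set_integral_diff(2)) (auto simp: set_integral_mult_right)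
  finally have 2: "(\<integral>w. g0 w * (F w - F a) \<partial>lborel) = (LBINT v:{a..b}. F v * g v) - F a * (G b - G a)"
    using G[of b] ab by simp
  have "(LBINT v:{a..b}. f v * G v + F v * g v) = (LBINT v:{a..b}. f v * G v) + (LBINT v:{a..b}. F v * g v)"
    using fG Fg by (rule set_integral_add(2))
  with 1 2 eq show "F b * G b - F a * G a = (LBINT v:{a..b}. f v * G v + F v * g v)"
    by (simp add: algebra_simps)
qed

section \<open>Controlled chains and Kolmogorov's forward equation\<close>

locale controlled_hjb = hjb_solution N K T \<pi> C lam e W + controlled_chain M F N K T lam X u
  for N K T \<pi> C lam e W and M :: "'w measure" and F X u
begin

sublocale PS: pair_sigma_finite lborel M
  by unfold_locales

text \<open>The integrands for which expectations and time integrals along a controlled path may be exchanged.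
Jump rates, costs and the terms of the equation for \<open>W\<close> are all of this kind.\<close>

definition tame :: "(real \<Rightarrow> nat \<Rightarrow> nat \<Rightarrow> real) \<Rightarrow> bool" where
  "tame G \<longleftrightarrow> (\<forall>i a. (\<lambda>v. indicator {0..T} v * G v i a) \<in> borel_measurable borel) \<and>
     (\<exists>B. \<forall>v\<in>{0..T}. \<forall>i\<le>N. \<forall>a\<le>K. \<bar>G v i a\<bar> \<le> B)"

definition expect :: "'w set \<Rightarrow> (real \<Rightarrow> nat \<Rightarrow> nat \<Rightarrow> real) \<Rightarrow> real \<Rightarrow> real" where
  "expect A G v = (\<integral>\<omega>. indicator A \<omega> * G v (X v \<omega>) (u v \<omega>) \<partial>M)"

lemma u_le: "t \<in> {0..T} \<Longrightarrow> \<omega> \<in> space M \<Longrightarrow> u t \<omega> \<le> K"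
  using u_feasible[of t \<omega>] by (auto simp: feasible_def)

lemma X_le: "t \<in> {0..T} \<Longrightarrow> \<omega> \<in> space M \<Longrightarrow> X t \<omega> \<le> N"
  using X_state[of t \<omega>] by auto

lemma sets_F_M: "t \<in> {0..T} \<Longrightarrow> A \<in> sets (F t) \<Longrightarrow> A \<in> sets M"
  using subalgebra_F[of t] by (auto simp: subalgebra_def)

lemma X_meas: "t \<in> {0..T} \<Longrightarrow> X t \<in> M \<rightarrow>\<^sub>M count_space UNIV"
  using measurable_from_subalg[OF subalgebra_F X_adapted] .

lemma u_meas: "t \<in> {0..T} \<Longrightarrow> u t \<in> M \<rightarrow>\<^sub>M count_space UNIV"
  using measurable_from_subalg[OF subalgebra_F u_adapted] .

text \<open>The process is jointly measurable on \<open>{0..T}\<close> only, so time is first clamped to this interval; then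
\<open>G\<close> is evaluated at two random variables with countably many values.\<close>

lemma tame_joint_measurable:
  assumes G: "tame G" and A: "A \<in> sets M" and sr: "0 \<le> s" "r \<le> T"
  shows "(\<lambda>(v, \<omega>). indicator {s..r} v * (indicator A \<omega> * G v (X v \<omega>) (u v \<omega>))) \<in> borel_measurable (lborel \<Otimes>\<^sub>M M)"
proof -
  define cl where "cl t = max 0 (min T t)" for t
  have cl: "cl t \<in> {0..T}" "t \<in> {0..T} \<Longrightarrow> cl t = t" for t using T_pos by (auto simp: cl_def)
  have clm: "cl \<in> lborel \<rightarrow>\<^sub>M restrict_space borel {0..T}"
  proof (rule measurable_restrict_space2)
    show "cl \<in> space lborel \<rightarrow> {0..T}" using cl(1) by auto
    show "cl \<in> borel_measurable lborel" unfolding cl_def by measurable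
  qed
  have pm: "(\<lambda>p. (cl (fst p), snd p)) \<in> lborel \<Otimes>\<^sub>M M \<rightarrow>\<^sub>M restrict_space borel {0..T} \<Otimes>\<^sub>M M"
    by (intro measurable_Pair measurable_compose[OF measurable_fst clm] measurable_snd)
  have Xm: "(\<lambda>p. X (cl (fst p)) (snd p)) \<in> lborel \<Otimes>\<^sub>M M \<rightarrow>\<^sub>M count_space UNIV"
    using measurable_compose[OF pm X_measurable] by simp
  have um: "(\<lambda>p. u (cl (fst p)) (snd p)) \<in> lborel \<Otimes>\<^sub>M M \<rightarrow>\<^sub>M count_space UNIV"
    using measurable_compose[OF pm u_measurable] by simp
  have Gm: "(\<lambda>p. indicator {0..T} (fst p) * G (fst p) i a) \<in> borel_measurable (lborel \<Otimes>\<^sub>M M)" for i a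
  proof (rule measurable_compose[OF measurable_fst])
    show "(\<lambda>v. indicator {0..T} v * G v i a) \<in> borel_measurable lborel"
      using G by (simp add: tame_def)
  qed
  have "(\<lambda>p. indicator {0..T} (fst p) * G (fst p) (X (cl (fst p)) (snd p)) a) \<in> borel_measurable (lborel \<Otimes>\<^sub>M M)" for a
    by (rule measurable_compose_countable[OF Gm Xm])
  hence "(\<lambda>p. indicator {0..T} (fst p) * G (fst p) (X (cl (fst p)) (snd p)) (u (cl (fst p)) (snd p))) \<in> borel_measurable (lborel \<Otimes>\<^sub>M M)"
    by (rule measurable_compose_countable[OF _ um])
  moreover have "indicator ({s..r} \<times> A) \<in> borel_measurable (lborel \<Otimes>\<^sub>M M)"
    by (rule borel_measurable_indicator) (use A in auto)
  ultimately have "(\<lambda>p. indicator ({s..r} \<times> A) p * (indicator {0..T} (fst p) * G (fst p) (X (cl (fst p)) (snd p)) (u (cl (fst p)) (snd p))))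
     \<in> borel_measurable (lborel \<Otimes>\<^sub>M M)"
    by (intro borel_measurable_times[of "indicator ({s..r} \<times> A)"])
  also have "(\<lambda>p. indicator ({s..r} \<times> A) p * (indicator {0..T} (fst p) * G (fst p) (X (cl (fst p)) (snd p)) (u (cl (fst p)) (snd p))))
     = (\<lambda>(v, \<omega>). indicator {s..r} v * (indicator A \<omega> * G v (X v \<omega>) (u v \<omega>)))"
    using sr by (auto simp: fun_eq_iff indicator_def cl)
  finally show ?thesis .
qed

lemma tame_joint_integrable:
  assumes G: "tame G" and A: "A \<in> sets M" and sr: "0 \<le> s" "r \<le> T"
  shows "integrable (lborel \<Otimes>\<^sub>M M) (\<lambda>(v, \<omega>). indicator {s..r} v * (indicator A \<omega> * G v (X v \<omega>) (u v \<omega>)))"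
proof -
  obtain B where B: "\<And>v i a. v \<in> {0..T} \<Longrightarrow> i \<le> N \<Longrightarrow> a \<le> K \<Longrightarrow> \<bar>G v i a\<bar> \<le> B"
    using G unfolding tame_def by blast
  show ?thesis
  proof (rule integrableI_bounded_set[where A="{s..r} \<times> A" and B=B])
    show "{s..r} \<times> A \<in> sets (lborel \<Otimes>\<^sub>M M)" using A by auto
    show "(\<lambda>(v, \<omega>). indicator {s..r} v * (indicator A \<omega> * G v (X v \<omega>) (u v \<omega>))) \<in> borel_measurable (lborel \<Otimes>\<^sub>M M)"
      by (rule tame_joint_measurable[OF assms])
    have "emeasure lborel {s..r} < \<infinity>" by (cases "s \<le> r") simp_all
    thus "emeasure (lborel \<Otimes>\<^sub>M M) ({s..r} \<times> A) < \<infinity>"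
      using A by (simp add: emeasure_pair_measure_Times ennreal_mult_less_top emeasure_eq_measure)
    show "AE p in lborel \<Otimes>\<^sub>M M. p \<in> {s..r} \<times> A \<longrightarrow>
        norm (case p of (v, \<omega>) \<Rightarrow> indicator {s..r} v * (indicator A \<omega> * G v (X v \<omega>) (u v \<omega>))) \<le> B"
    proof (rule AE_I2, clarsimp)
      fix v \<omega> assume "s \<le> v" "v \<le> r" "\<omega> \<in> A"
      thus "\<bar>G v (X v \<omega>) (u v \<omega>)\<bar> \<le> B"
        using sr sets.sets_into_space[OF A] by (intro B X_le u_le) auto
    qed
  qed (auto intro!: AE_I2 simp: indicator_def)
qed

lemma tame_section:
  assumes G: "tame G" and A: "A \<in> sets M" and v: "v \<in> {0..T}"
  shows "integrable M (\<lambda>\<omega>. indicator A \<omega> * G v (X v \<omega>) (u v \<omega>))"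
proof -
  obtain B where B: "\<And>v i a. v \<in> {0..T} \<Longrightarrow> i \<le> N \<Longrightarrow> a \<le> K \<Longrightarrow> \<bar>G v i a\<bar> \<le> B"
    using G unfolding tame_def by blast
  have "(\<lambda>\<omega>. G v (X v \<omega>) a) \<in> borel_measurable M" for a
    by (rule measurable_compose_countable[OF _ X_meas[OF v]]) simp
  hence "(\<lambda>\<omega>. G v (X v \<omega>) (u v \<omega>)) \<in> borel_measurable M"
    by (rule measurable_compose_countable[OF _ u_meas[OF v]])
  hence m: "(\<lambda>\<omega>. indicator A \<omega> * G v (X v \<omega>) (u v \<omega>)) \<in> borel_measurable M"
    using A by (intro borel_measurable_times borel_measurable_indicator)
  show ?thesis
  proof (rule integrable_const_bound[of _ "\<bar>B\<bar>"])
    show "AE \<omega> in M. norm (indicator A \<omega> * G v (X v \<omega>) (u v \<omega>)) \<le> \<bar>B\<bar>"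
    proof (rule AE_I2)
      fix \<omega> assume "\<omega> \<in> space M"
      hence "\<bar>G v (X v \<omega>) (u v \<omega>)\<bar> \<le> B" using v by (intro B X_le u_le) auto
      thus "norm (indicator A \<omega> * G v (X v \<omega>) (u v \<omega>)) \<le> \<bar>B\<bar>" by (auto simp: indicator_def)
    qed
  qed (rule m)
qed

lemma expect_bounded:
  assumes G: "tame G" and A: "A \<in> sets M"
  obtains B where "\<And>v. v \<in> {0..T} \<Longrightarrow> \<bar>expect A G v\<bar> \<le> B"
proof -
  obtain B where B: "\<And>v i a. v \<in> {0..T} \<Longrightarrow> i \<le> N \<Longrightarrow> a \<le> K \<Longrightarrow> \<bar>G v i a\<bar> \<le> B"
    using G unfolding tame_def by blast
  have "\<bar>expect A G v\<bar> \<le> \<bar>B\<bar>" if v: "v \<in> {0..T}" for v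
  proof -
    have b: "\<bar>indicator A \<omega> * G v (X v \<omega>) (u v \<omega>)\<bar> \<le> \<bar>B\<bar>" if "\<omega> \<in> space M" for \<omega>
    proof -
      have "\<bar>G v (X v \<omega>) (u v \<omega>)\<bar> \<le> B" using v that by (intro B X_le u_le) auto
      thus ?thesis by (auto simp: indicator_def)
    qed
    have "\<bar>expect A G v\<bar> \<le> (\<integral>\<omega>. \<bar>indicator A \<omega> * G v (X v \<omega>) (u v \<omega>)\<bar> \<partial>M)"
      unfolding expect_def by (rule integral_abs_bound)
    also have "\<dots> \<le> (\<integral>\<omega>. \<bar>B\<bar> \<partial>M)"
      by (intro integral_mono integrable_abs tame_section[OF G A v]) (auto intro: b)
    also have "\<dots> = \<bar>B\<bar>" by (simp add: prob_space)
    finally show ?thesis .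
  qed
  thus ?thesis by (rule that)
qed

lemma expect_linear:
  assumes "tame G" "tame G'" "A \<in> sets M" "v \<in> {0..T}"
  shows "expect A (\<lambda>v i a. G v i a + G' v i a) v = expect A G v + expect A G' v"
    "expect A (\<lambda>v i a. G v i a - G' v i a) v = expect A G v - expect A G' v"
  using tame_section[OF assms(1,3,4)] tame_section[OF assms(2,3,4)]
  by (simp_all add: expect_def distrib_left right_diff_distrib)

lemma expect_sum:
  assumes "\<And>k. k \<in> I \<Longrightarrow> tame (G k)" "A \<in> sets M" "v \<in> {0..T}"
  shows "expect A (\<lambda>v i a. \<Sum>k\<in>I. G k v i a) v = (\<Sum>k\<in>I. expect A (G k) v)"
  using tame_section[OF assms(1) assms(2,3)]
  by (simp add: expect_def sum_distrib_left)

lemma expect_scale: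
  "expect A (\<lambda>v i a. G v i a * w v) v = expect A G v * w v"
  by (simp add: expect_def mult.assoc[symmetric])

lemma expect_mono:
  assumes "tame G" "tame G'" "A \<in> sets M" "v \<in> {0..T}"
    and "\<And>\<omega>. \<omega> \<in> space M \<Longrightarrow> G v (X v \<omega>) (u v \<omega>) \<le> G' v (X v \<omega>) (u v \<omega>)"
  shows "expect A G v \<le> expect A G' v"
  unfolding expect_def
  by (intro integral_mono tame_section assms) (auto simp: indicator_def assms(5))

lemma expect_time_integral:
  assumes G: "tame G" and A: "A \<in> sets M" and sr: "0 \<le> s" "r \<le> T"
  shows "(\<integral>\<omega>. indicator A \<omega> * (LBINT v:{s..r}. G v (X v \<omega>) (u v \<omega>)) \<partial>M) = (LBINT v:{s..r}. expect A G v)"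
    "set_integrable lborel {s..r} (expect A G)"
    "integrable M (\<lambda>\<omega>. indicator A \<omega> * (LBINT v:{s..r}. G v (X v \<omega>) (u v \<omega>)))"
proof -
  note int = tame_joint_integrable[OF assms]
  have fst: "(\<integral>\<omega>. indicator {s..r} v * (indicator A \<omega> * G v (X v \<omega>) (u v \<omega>)) \<partial>M) = indicator {s..r} v *\<^sub>R expect A G v" for v
    by (simp add: expect_def)
  have snd: "(\<integral>v. indicator {s..r} v * (indicator A \<omega> * G v (X v \<omega>) (u v \<omega>)) \<partial>lborel)
      = indicator A \<omega> * (LBINT v:{s..r}. G v (X v \<omega>) (u v \<omega>))" for \<omega>
    unfolding set_lebesgue_integral_def
    by (subst integral_mult_right_zero[symmetric], rule Bochner_Integration.integral_cong) (auto simp: indicator_def)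
  show "set_integrable lborel {s..r} (expect A G)"
    using PS.integrable_fst'[OF int] unfolding set_integrable_def by (simp only: prod.case fst)
  show "(\<integral>\<omega>. indicator A \<omega> * (LBINT v:{s..r}. G v (X v \<omega>) (u v \<omega>)) \<partial>M) = (LBINT v:{s..r}. expect A G v)"
    using PS.Fubini_integral[OF int] unfolding snd fst by (simp add: set_lebesgue_integral_def)
  show "integrable M (\<lambda>\<omega>. indicator A \<omega> * (LBINT v:{s..r}. G v (X v \<omega>) (u v \<omega>)))"
    using PS.integrable_snd[OF int] unfolding snd .
qed

lemma expect_time_nn_integral:
  assumes G: "tame G" and A: "A \<in> sets M" and sr: "0 \<le> s" "r \<le> T"
    and pos: "\<And>v i a. v \<in> {0..T} \<Longrightarrow> 0 \<le> G v i a"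
  shows "(\<integral>\<^sup>+\<omega>. (\<integral>\<^sup>+v. ennreal (indicator {s..r} v * (indicator A \<omega> * G v (X v \<omega>) (u v \<omega>))) \<partial>lborel) \<partial>M)
       = ennreal (LBINT v:{s..r}. expect A G v)"
proof -
  note int = tame_joint_integrable[OF assms(1-4)]
  have fst: "(\<integral>\<omega>. indicator {s..r} v * (indicator A \<omega> * G v (X v \<omega>) (u v \<omega>)) \<partial>M) = indicator {s..r} v *\<^sub>R expect A G v" for v
    by (simp add: expect_def)
  let ?f = "\<lambda>(v, \<omega>). indicator {s..r} v * (indicator A \<omega> * G v (X v \<omega>) (u v \<omega>)) :: real"
  have m: "(\<lambda>p. ennreal (?f p)) \<in> borel_measurable (lborel \<Otimes>\<^sub>M M)"
    using tame_joint_measurable[OF assms(1-4)] by (rule measurable_compose) simp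
  have "(\<integral>\<^sup>+\<omega>. (\<integral>\<^sup>+v. ennreal (?f (v, \<omega>)) \<partial>lborel) \<partial>M) = (\<integral>\<^sup>+p. ennreal (?f p) \<partial>(lborel \<Otimes>\<^sub>M M))"
    by (rule PS.nn_integral_snd[OF m])
  also have "\<dots> = ennreal (\<integral>p. ?f p \<partial>(lborel \<Otimes>\<^sub>M M))"
    by (rule nn_integral_eq_integral[OF int]) (use pos sr in \<open>auto intro!: AE_I2 simp: indicator_def\<close>)
  also have "(\<integral>p. ?f p \<partial>(lborel \<Otimes>\<^sub>M M)) = (LBINT v:{s..r}. expect A G v)"
    using PS.integral_fst'[OF int, unfolded prod.case fst] unfolding set_lebesgue_integral_def by (rule sym)
  finally show "(\<integral>\<^sup>+\<omega>. (\<integral>\<^sup>+v. ennreal (indicator {s..r} v * (indicator A \<omega> * G v (X v \<omega>) (u v \<omega>))) \<partial>lborel) \<partial>M)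
       = ennreal (LBINT v:{s..r}. expect A G v)" by simp
qed

definition flow_rate :: "nat \<Rightarrow> nat \<Rightarrow> real \<Rightarrow> nat \<Rightarrow> nat \<Rightarrow> real" where
  "flow_rate i j v i' a = (if i' = i then jump_rate N (lam v) a i j else 0)"

lemma tame_add: "tame G \<Longrightarrow> tame G' \<Longrightarrow> tame (\<lambda>v i a. G v i a + G' v i a)"
proof -
  assume G: "tame G" and G': "tame G'"
  obtain B where B: "\<And>v i a. v \<in> {0..T} \<Longrightarrow> i \<le> N \<Longrightarrow> a \<le> K \<Longrightarrow> \<bar>G v i a\<bar> \<le> B"
    using G unfolding tame_def by blast
  obtain B' where B': "\<And>v i a. v \<in> {0..T} \<Longrightarrow> i \<le> N \<Longrightarrow> a \<le> K \<Longrightarrow> \<bar>G' v i a\<bar> \<le> B'"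
    using G' unfolding tame_def by blast
  have "\<bar>G v i a + G' v i a\<bar> \<le> B + B'" if "v \<in> {0..T}" "i \<le> N" "a \<le> K" for v i a
    using B[OF that] B'[OF that] by linarith
  moreover have "(\<lambda>v. indicator {0..T} v * (G v i a + G' v i a)) \<in> borel_measurable borel" for i a
    using G G' unfolding tame_def distrib_left by (intro borel_measurable_add) simp_all
  ultimately show ?thesis unfolding tame_def by blast
qed

lemma tame_mult: "tame G \<Longrightarrow> tame G' \<Longrightarrow> tame (\<lambda>v i a. G v i a * G' v i a)"
proof -
  assume G: "tame G" and G': "tame G'"
  obtain B where B: "\<And>v i a. v \<in> {0..T} \<Longrightarrow> i \<le> N \<Longrightarrow> a \<le> K \<Longrightarrow> \<bar>G v i a\<bar> \<le> B"
    using G unfolding tame_def by blast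
  obtain B' where B': "\<And>v i a. v \<in> {0..T} \<Longrightarrow> i \<le> N \<Longrightarrow> a \<le> K \<Longrightarrow> \<bar>G' v i a\<bar> \<le> B'"
    using G' unfolding tame_def by blast
  have "\<bar>G v i a * G' v i a\<bar> \<le> B * B'" if "v \<in> {0..T}" "i \<le> N" "a \<le> K" for v i a
    unfolding abs_mult using B[OF that] B'[OF that] by (intro mult_mono) auto
  moreover have "(\<lambda>v. indicator {0..T} v * (G v i a * G' v i a)) \<in> borel_measurable borel" for i a
  proof -
    have "(\<lambda>v. (indicator {0..T} v * G v i a) * (indicator {0..T} v * G' v i a)) \<in> borel_measurable borel"
      by (rule borel_measurable_times) (use G G' in \<open>simp_all add: tame_def\<close>)
    also have "(\<lambda>v. (indicator {0..T} v * G v i a) * (indicator {0..T} v * G' v i a)) = (\<lambda>v. indicator {0..T} v * (G v i a * G' v i a))"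
      by (auto simp: indicator_def)
    finally show ?thesis .
  qed
  ultimately show ?thesis unfolding tame_def by blast
qed

lemma tame_const: "tame (\<lambda>v i a. c i a)"
proof -
  define B where "B = Max ((\<lambda>(i, a). \<bar>c i a\<bar>) ` ({..N} \<times> {..K}))"
  have "\<bar>c i a\<bar> \<le> B" if "i \<le> N" "a \<le> K" for i a
    unfolding B_def by (rule Max_ge) (use that in force)+
  moreover have "(\<lambda>v. indicator {0..T} v * c i a) \<in> borel_measurable borel" for i a by simp
  ultimately show ?thesis unfolding tame_def by blast
qed

lemma tame_time:
  assumes "(\<lambda>v. indicator {0..T} v * f v) \<in> borel_measurable borel" "\<And>v. v \<in> {0..T} \<Longrightarrow> \<bar>f v\<bar> \<le> B"
  shows "tame (\<lambda>v i a. f v)"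
  using assms unfolding tame_def by blast

lemma tame_lam: "tame (\<lambda>v i a. lam v)"
  by (rule tame_time[OF lam_meas, of C]) (use lam_pos lam_le in \<open>force simp: abs_of_pos\<close>)

lemma tame_e: "tame (\<lambda>v i a. e v)"
  by (rule tame_time[OF e_meas, of C]) (use e_pos e_le in \<open>force simp: abs_of_pos\<close>)

lemma tame_diff: "tame G \<Longrightarrow> tame G' \<Longrightarrow> tame (\<lambda>v i a. G v i a - G' v i a)"
  using tame_add[of G "\<lambda>v i a. (- 1) * G' v i a"] tame_mult[OF tame_const[of "\<lambda>_ _. - 1"], of G'] by simp

lemma tame_sum: "(\<And>k. k \<in> I \<Longrightarrow> tame (G k)) \<Longrightarrow> tame (\<lambda>v i a. \<Sum>k\<in>I. G k v i a)"
proof (induction I rule: infinite_finite_induct)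
  case (insert x I)
  thus ?case using tame_add[of "G x" "\<lambda>v i a. \<Sum>k\<in>I. G k v i a"] by simp
qed (use tame_const[of "\<lambda>_ _. 0"] in simp_all)

lemma tame_flow_rate: "tame (flow_rate i j)"
proof -
  have "tame (\<lambda>v i' a. of_bool (i' = i \<and> j = i + 1 \<and> i < N) * lam v
      + of_bool (i' = i \<and> \<not> (j = i + 1 \<and> i < N) \<and> i = j + 1) * real a)"
    by (intro tame_add tame_mult tame_lam tame_const)
  also have "(\<lambda>v i' a. of_bool (i' = i \<and> j = i + 1 \<and> i < N) * lam v
      + of_bool (i' = i \<and> \<not> (j = i + 1 \<and> i < N) \<and> i = j + 1) * real a) = flow_rate i j"
    by (auto simp: fun_eq_iff flow_rate_def jump_rate_def)
  finally show ?thesis .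
qed

lemma flow_rate_nonneg: "v \<in> {0..T} \<Longrightarrow> 0 \<le> flow_rate i j v i' a"
  using lam_pos[of v] by (auto simp: flow_rate_def jump_rate_def)

definition flow :: "'w set \<Rightarrow> nat \<Rightarrow> nat \<Rightarrow> real \<Rightarrow> real \<Rightarrow> ennreal" where
  "flow A i j s r = (\<integral>\<^sup>+\<omega>\<in>A. of_nat (card (jump_times (\<lambda>t. X t \<omega>) i j s r)) \<partial>M)"

text \<open>The intensity assumption of a controlled chain in integrated form: the expected number of jumps is
the time integral of the expected jump rate.\<close>

lemma flow_eq:
  assumes ij: "i \<le> N" "j \<le> N" "i \<noteq> j" and sr: "0 \<le> s" "s \<le> r" "r \<le> T" and A: "A \<in> sets (F s)"
  shows "flow A i j s r = ennreal (LBINT v:{s..r}. expect A (flow_rate i j) v)"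
proof -
  have AM: "A \<in> sets M" by (rule sets_F_M[OF _ A]) (use sr in auto)
  have "flow A i j s r = (\<integral>\<^sup>+\<omega>\<in>A. (\<integral>\<^sup>+v\<in>{s..r}.
            ennreal (if X v \<omega> = i then jump_rate N (lam v) (u v \<omega>) i j else 0) \<partial>lborel) \<partial>M)"
    unfolding flow_def using X_intensity[of i j s r A] ij sr A by auto
  also have "\<dots> = (\<integral>\<^sup>+\<omega>. (\<integral>\<^sup>+v. ennreal (indicator {s..r} v * (indicator A \<omega> * flow_rate i j v (X v \<omega>) (u v \<omega>))) \<partial>lborel) \<partial>M)"
  proof (rule nn_integral_cong)
    fix \<omega>
    show "(\<integral>\<^sup>+v\<in>{s..r}. ennreal (if X v \<omega> = i then jump_rate N (lam v) (u v \<omega>) i j else 0) \<partial>lborel) * indicator A \<omega>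
       = (\<integral>\<^sup>+v. ennreal (indicator {s..r} v * (indicator A \<omega> * flow_rate i j v (X v \<omega>) (u v \<omega>))) \<partial>lborel)"
      by (cases "\<omega> \<in> A") (auto intro!: nn_integral_cong simp: flow_rate_def indicator_def)
  qed
  also have "\<dots> = ennreal (LBINT v:{s..r}. expect A (flow_rate i j) v)"
    by (rule expect_time_nn_integral[OF tame_flow_rate AM sr(1,3) flow_rate_nonneg])
  finally show ?thesis .
qed

text \<open>The pathwise balance of the grid counts, taken to the limit and integrated over \<open>A\<close>. Passing through
grid counts supplies the measurability that additivity of the integral needs.\<close>

lemma flow_balance:
  assumes A: "A \<in> sets M" and sr: "0 \<le> s" "s \<le> r" "r \<le> T" and j: "j \<le> N"
  shows "emeasure M {\<omega>\<in>A. X r \<omega> = j} + (\<Sum>i\<in>{0..N} - {j}. flow A j i s r)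
    = emeasure M {\<omega>\<in>A. X s \<omega> = j} + (\<Sum>i\<in>{0..N} - {j}. flow A i j s r)"
proof -
  define cnt where "cnt n i k \<omega> = (\<Sum>l<n. of_bool (X (grid_point s r n l) \<omega> = i \<and> X (grid_point s r n (Suc l)) \<omega> = k) :: nat)" for n i k \<omega>
  define J where "J i k \<omega> = card (jump_times (\<lambda>t. X t \<omega>) i k s r)" for i k \<omega>
  define g where "g i k \<omega> = liminf (\<lambda>n. of_nat (cnt n i k \<omega>) :: ennreal)" for i k \<omega>
  have cellT: "grid_point s r n l \<in> {0..T}" if "l \<le> n" for n l
  proof -
    have "(r - s) * (real l / real n) \<le> (r - s) * 1"
      using sr that by (intro mult_left_mono) (auto simp: divide_le_eq_1)
    thus ?thesis using sr by (auto simp: grid_point_def)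
  qed
  have cnt_meas: "(\<lambda>\<omega>. of_nat (cnt n i k \<omega>) :: ennreal) \<in> borel_measurable M" for n i k
  proof -
    have "(\<lambda>\<omega>. of_bool (X (grid_point s r n l) \<omega> = i \<and> X (grid_point s r n (Suc l)) \<omega> = k) :: ennreal) \<in> borel_measurable M" if "l < n" for l
    proof -
      have [measurable]: "X (grid_point s r n l) \<in> M \<rightarrow>\<^sub>M count_space UNIV" "X (grid_point s r n (Suc l)) \<in> M \<rightarrow>\<^sub>M count_space UNIV"
        using that by (auto intro!: X_meas cellT)
      show ?thesis by (simp add: of_bool_def)
    qed
    thus ?thesis unfolding cnt_def of_nat_sum of_nat_of_bool by (intro borel_measurable_sum) auto
  qed
  have g_meas [measurable]: "g i k \<in> borel_measurable M" for i k
    unfolding g_def[abs_def] using cnt_meas by (rule borel_measurable_liminf)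
  have ev: "\<forall>\<^sub>F n in sequentially. J i k \<omega> = cnt n i k \<omega>" if "step_path T (\<lambda>t. X t \<omega>)" "i \<noteq> k" for i k \<omega>
    unfolding J_def cnt_def by (rule jump_count_eq_grid_count[OF that(1) sr that(2)])
  have gJ: "g i k \<omega> = of_nat (J i k \<omega>)" if "step_path T (\<lambda>t. X t \<omega>)" "i \<noteq> k" for i k \<omega>
    unfolding g_def
  proof (rule lim_imp_Liminf)
    show "(\<lambda>n. of_nat (cnt n i k \<omega>) :: ennreal) \<longlonglongrightarrow> of_nat (J i k \<omega>)"
      by (rule tendsto_eventually) (use ev[OF that] in eventually_elim, simp)
  qed simp
  have flow_g: "flow A i k s r = (\<integral>\<^sup>+\<omega>. g i k \<omega> * indicator A \<omega> \<partial>M)" if "i \<noteq> k" for i k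
    unfolding flow_def
  proof (rule nn_integral_cong_AE)
    show "AE \<omega> in M. of_nat (card (jump_times (\<lambda>t. X t \<omega>) i k s r)) * indicator A \<omega> = g i k \<omega> * indicator A \<omega>"
      using X_step by eventually_elim (use gJ that in \<open>simp add: J_def\<close>)
  qed
  have bal: "of_bool (X r \<omega> = j) + (\<Sum>i\<in>{0..N} - {j}. g j i \<omega>) = (of_bool (X s \<omega> = j) + (\<Sum>i\<in>{0..N} - {j}. g i j \<omega>) :: ennreal)"
    if \<omega>: "\<omega> \<in> space M" "step_path T (\<lambda>t. X t \<omega>)" for \<omega>
  proof -
    have "\<forall>\<^sub>F n in sequentially. \<forall>i\<in>{0..N} - {j}. J j i \<omega> = cnt n j i \<omega> \<and> J i j \<omega> = cnt n i j \<omega>"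
      by (intro eventually_ball_finite ballI eventually_conj ev \<omega>) auto
    then obtain n0 where "\<forall>n\<ge>n0. \<forall>i\<in>{0..N} - {j}. J j i \<omega> = cnt n j i \<omega> \<and> J i j \<omega> = cnt n i j \<omega>"
      unfolding eventually_sequentially by blast
    hence n: "\<And>i. i \<in> {0..N} - {j} \<Longrightarrow> J j i \<omega> = cnt (Suc n0) j i \<omega> \<and> J i j \<omega> = cnt (Suc n0) i j \<omega>"
      using le_SucI by blast
    have ends: "grid_point s r (Suc n0) (Suc n0) = r" "grid_point s r (Suc n0) 0 = s" by (simp_all add: grid_point_def)
    have "of_bool (X r \<omega> = j) + (\<Sum>i\<in>{0..N} - {j}. cnt (Suc n0) j i \<omega>)
        = of_bool (X s \<omega> = j) + (\<Sum>i\<in>{0..N} - {j}. cnt (Suc n0) i j \<omega>)"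
      using grid_count_balance[of "Suc n0" "\<lambda>l. X (grid_point s r (Suc n0) l) \<omega>" N j]
      unfolding cnt_def ends using X_le[OF cellT \<omega>(1)] j by simp
    hence "of_bool (X r \<omega> = j) + (\<Sum>i\<in>{0..N} - {j}. J j i \<omega>) = of_bool (X s \<omega> = j) + (\<Sum>i\<in>{0..N} - {j}. J i j \<omega>)"
      using n by simp
    from arg_cong[OF this, of "of_nat :: nat \<Rightarrow> ennreal"] show ?thesis
      using gJ[OF \<omega>(2)] by simp
  qed
  have Xm [measurable]: "X r \<in> M \<rightarrow>\<^sub>M count_space UNIV" "X s \<in> M \<rightarrow>\<^sub>M count_space UNIV"
    using sr by (auto intro!: X_meas)
  note [measurable] = A
  have em: "emeasure M {\<omega>\<in>A. X q \<omega> = j} = (\<integral>\<^sup>+\<omega>. of_bool (X q \<omega> = j) * indicator A \<omega> \<partial>M)"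
    if [measurable]: "X q \<in> M \<rightarrow>\<^sub>M count_space UNIV" for q
  proof -
    have "{\<omega>\<in>A. X q \<omega> = j} = {\<omega>\<in>space M. X q \<omega> = j} \<inter> A" using sets.sets_into_space[OF A] by auto
    hence S: "{\<omega>\<in>A. X q \<omega> = j} \<in> sets M" by simp
    show ?thesis
      unfolding nn_integral_indicator[OF S, symmetric]
      by (rule nn_integral_cong) (auto simp: indicator_def)
  qed
  have add: "(\<integral>\<^sup>+\<omega>. (of_bool (X q \<omega> = j) + (\<Sum>i\<in>I. h i \<omega>)) * indicator A \<omega> \<partial>M)
      = emeasure M {\<omega>\<in>A. X q \<omega> = j} + (\<Sum>i\<in>I. \<integral>\<^sup>+\<omega>. h i \<omega> * indicator A \<omega> \<partial>M)"
    if [measurable]: "X q \<in> M \<rightarrow>\<^sub>M count_space UNIV" "\<And>i. h i \<in> borel_measurable M" for q I and h :: "nat \<Rightarrow> 'w \<Rightarrow> ennreal"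
  proof -
    have "(\<integral>\<^sup>+\<omega>. (of_bool (X q \<omega> = j) + (\<Sum>i\<in>I. h i \<omega>)) * indicator A \<omega> \<partial>M)
      = (\<integral>\<^sup>+\<omega>. of_bool (X q \<omega> = j) * indicator A \<omega> + (\<Sum>i\<in>I. h i \<omega> * indicator A \<omega>) \<partial>M)"
      by (simp only: distrib_right sum_distrib_right)
    also have "\<dots> = (\<integral>\<^sup>+\<omega>. of_bool (X q \<omega> = j) * indicator A \<omega> \<partial>M) + (\<integral>\<^sup>+\<omega>. (\<Sum>i\<in>I. h i \<omega> * indicator A \<omega>) \<partial>M)"
      unfolding of_bool_def by (rule nn_integral_add) measurable
    also have "(\<integral>\<^sup>+\<omega>. (\<Sum>i\<in>I. h i \<omega> * indicator A \<omega>) \<partial>M) = (\<Sum>i\<in>I. \<integral>\<^sup>+\<omega>. h i \<omega> * indicator A \<omega> \<partial>M)"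
      by (rule nn_integral_sum) measurable
    finally show ?thesis unfolding em[OF that(1)] .
  qed
  have "emeasure M {\<omega>\<in>A. X r \<omega> = j} + (\<Sum>i\<in>{0..N} - {j}. flow A j i s r)
     = (\<integral>\<^sup>+\<omega>. (of_bool (X r \<omega> = j) + (\<Sum>i\<in>{0..N} - {j}. g j i \<omega>)) * indicator A \<omega> \<partial>M)"
    unfolding add[OF Xm(1) g_meas] by (intro arg_cong2[where f="(+)"] refl sum.cong flow_g) auto
  also have "\<dots> = (\<integral>\<^sup>+\<omega>. (of_bool (X s \<omega> = j) + (\<Sum>i\<in>{0..N} - {j}. g i j \<omega>)) * indicator A \<omega> \<partial>M)"
  proof (rule nn_integral_cong_AE)
    show "AE \<omega> in M. (of_bool (X r \<omega> = j) + (\<Sum>i\<in>{0..N} - {j}. g j i \<omega>)) * indicator A \<omega>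
       = (of_bool (X s \<omega> = j) + (\<Sum>i\<in>{0..N} - {j}. g i j \<omega>)) * indicator A \<omega>"
      using X_step AE_space by eventually_elim (simp only: bal)
  qed
  also have "\<dots> = emeasure M {\<omega>\<in>A. X s \<omega> = j} + (\<Sum>i\<in>{0..N} - {j}. flow A i j s r)"
    unfolding add[OF Xm(2) g_meas] by (intro arg_cong2[where f="(+)"] refl sum.cong flow_g[symmetric]) auto
  finally show ?thesis .
qed

end

section \<open>Verification\<close>

lemma set_integral_sum_finite:
  fixes f :: "'i \<Rightarrow> 'a \<Rightarrow> real"
  assumes "\<And>j. j \<in> I \<Longrightarrow> set_integrable M S (f j)"
  shows "(LINT v:S|M. (\<Sum>j\<in>I. f j v)) = (\<Sum>j\<in>I. LINT v:S|M. f j v)"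
  using assms unfolding set_lebesgue_integral_def set_integrable_def scaleR_sum_right
  by (intro Bochner_Integration.integral_sum) auto

context controlled_hjb
begin

definition prob_in :: "'w set \<Rightarrow> nat \<Rightarrow> real \<Rightarrow> real" where
  "prob_in A j v = measure M {\<omega>\<in>A. X v \<omega> = j}"

definition net_rate :: "nat \<Rightarrow> real \<Rightarrow> nat \<Rightarrow> nat \<Rightarrow> real" where
  "net_rate j v i a = (\<Sum>k\<in>{0..N} - {j}. flow_rate k j v i a - flow_rate j k v i a)"

lemma tame_net_rate: "tame (net_rate j)"
proof -
  have "tame (\<lambda>v i a. \<Sum>k\<in>{0..N} - {j}. flow_rate k j v i a - flow_rate j k v i a)"
    by (intro tame_sum tame_diff tame_flow_rate)
  thus ?thesis by (simp add: net_rate_def[abs_def])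
qed

lemma expect_state:
  assumes "A \<in> sets M" "v \<in> {0..T}"
  shows "expect A (\<lambda>v i a. of_bool (i = j)) v = prob_in A j v"
proof -
  note [measurable] = assms(1) X_meas[OF assms(2)]
  have "{\<omega>\<in>A. X v \<omega> = j} = {\<omega>\<in>space M. X v \<omega> = j} \<inter> A"
    using sets.sets_into_space[OF assms(1)] by auto
  hence S: "{\<omega>\<in>A. X v \<omega> = j} \<in> sets M" by simp
  have "expect A (\<lambda>v i a. of_bool (i = j)) v = (\<integral>\<omega>. indicator {\<omega>\<in>A. X v \<omega> = j} \<omega> \<partial>M)"
    unfolding expect_def by (rule Bochner_Integration.integral_cong) (auto simp: indicator_def)
  also have "\<dots> = prob_in A j v" using S by (simp add: prob_in_def sets.Int_space_eq2)
  finally show ?thesis .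
qed

text \<open>Kolmogorov's forward equation for the masses of the states on the event \<open>A\<close>.\<close>

lemma prob_in_evolution:
  assumes t: "0 \<le> t" "t \<le> r" "r \<le> T" and A: "A \<in> sets (F t)" and j: "j \<le> N"
  shows "prob_in A j r = prob_in A j t + (LBINT v:{t..r}. expect A (net_rate j) v)"
proof -
  have AM: "A \<in> sets M" by (rule sets_F_M[OF _ A]) (use t in auto)
  define a where "a i k = (LBINT v:{t..r}. expect A (flow_rate i k) v)" for i k
  have int: "set_integrable lborel {t..r} (expect A (flow_rate i k))" for i k
    by (rule expect_time_integral(2)[OF tame_flow_rate AM]) (use t in auto)
  have pos: "0 \<le> a i k" for i k
    unfolding a_def set_lebesgue_integral_def expect_def
  proof (intro integral_nonneg_AE AE_I2)
    fix v
    have "0 \<le> expectation (\<lambda>\<omega>. indicator A \<omega> * flow_rate i k v (X v \<omega>) (u v \<omega>))" if "v \<in> {t..r}"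
      using that t flow_rate_nonneg[of v] by (intro integral_nonneg_AE AE_I2) (auto simp: indicator_def)
    thus "0 \<le> indicat_real {t..r} v *\<^sub>R expectation (\<lambda>\<omega>. indicator A \<omega> * flow_rate i k v (X v \<omega>) (u v \<omega>))"
      by (auto simp: indicator_def)
  qed
  have "ennreal (prob_in A j r) + (\<Sum>i\<in>{0..N} - {j}. ennreal (a j i)) = ennreal (prob_in A j t) + (\<Sum>i\<in>{0..N} - {j}. ennreal (a i j))"
  proof -
    have "flow A i k t r = ennreal (a i k)" if "i \<le> N" "k \<le> N" "i \<noteq> k" for i k
      unfolding a_def by (rule flow_eq[OF that t A])
    thus ?thesis
      using flow_balance[OF AM t j] j by (simp add: prob_in_def emeasure_eq_measure)
  qed
  hence "ennreal (prob_in A j r + (\<Sum>i\<in>{0..N} - {j}. a j i)) = ennreal (prob_in A j t + (\<Sum>i\<in>{0..N} - {j}. a i j))"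
    using pos by (simp add: sum_ennreal ennreal_plus[symmetric] prob_in_def sum_nonneg del: ennreal_plus)
  hence "prob_in A j r + (\<Sum>i\<in>{0..N} - {j}. a j i) = prob_in A j t + (\<Sum>i\<in>{0..N} - {j}. a i j)"
    by (subst (asm) ennreal_inj) (auto simp: prob_in_def pos intro!: add_nonneg_nonneg sum_nonneg)
  moreover have "(LBINT v:{t..r}. expect A (net_rate j) v) = (\<Sum>k\<in>{0..N} - {j}. a k j - a j k)"
  proof -
    have "(LBINT v:{t..r}. expect A (net_rate j) v)
       = (LBINT v:{t..r}. (\<Sum>k\<in>{0..N} - {j}. expect A (flow_rate k j) v - expect A (flow_rate j k) v))"
    proof (rule set_lebesgue_integral_cong)
      show "\<forall>v. v \<in> {t..r} \<longrightarrow> expect A (net_rate j) v = (\<Sum>k\<in>{0..N} - {j}. expect A (flow_rate k j) v - expect A (flow_rate j k) v)"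
      proof (intro allI impI)
        fix v assume "v \<in> {t..r}"
        hence v: "v \<in> {0..T}" using t by auto
        have "expect A (net_rate j) v = (\<Sum>k\<in>{0..N} - {j}. expect A (\<lambda>v i a. flow_rate k j v i a - flow_rate j k v i a) v)"
          unfolding net_rate_def[abs_def]
          by (rule expect_sum[OF _ AM v]) (intro tame_diff tame_flow_rate)
        thus "expect A (net_rate j) v = (\<Sum>k\<in>{0..N} - {j}. expect A (flow_rate k j) v - expect A (flow_rate j k) v)"
          by (simp add: expect_linear(2)[OF tame_flow_rate tame_flow_rate AM v])
      qed
    qed simp
    also have "\<dots> = (\<Sum>k\<in>{0..N} - {j}. LBINT v:{t..r}. expect A (flow_rate k j) v - expect A (flow_rate j k) v)"
      by (rule set_integral_sum_finite) (intro set_integral_diff(1) int)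
    also have "\<dots> = (\<Sum>k\<in>{0..N} - {j}. a k j - a j k)"
      unfolding a_def by (intro sum.cong refl set_integral_diff(2) int)
    finally show ?thesis .
  qed
  ultimately show ?thesis by (simp add: sum_subtractf)
qed

text \<open>Minus the generator (including the time derivative) applied to \<open>W\<close>, written as a sum over the
states so that it matches the forward equation term by term.\<close>

definition drift :: "real \<Rightarrow> nat \<Rightarrow> nat \<Rightarrow> real" where
  "drift v i a = (\<Sum>j\<in>{0..N}. of_bool (i = j) * hjb_rhs W j v - net_rate j v i a * W j v)"

lemma tame_W: "tame (\<lambda>v i a. W j v)"
proof -
  obtain B where B: "\<And>t. t \<in> {0..T} \<Longrightarrow> \<bar>W j t\<bar> \<le> B" using W_bounded by blast
  have "W j \<in> borel_measurable borel" by (rule borel_measurable_continuous_onI[OF W_cont])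
  hence "(\<lambda>v. indicator {0..T} v * W j v) \<in> borel_measurable borel" by simp
  thus ?thesis by (rule tame_time[OF _ B])
qed

lemma tame_hjb_rhs: "j \<le> N \<Longrightarrow> tame (\<lambda>v i a. hjb_rhs W j v)"
  using hjb_rhs_bounded_measurable[of j] tame_time by metis

lemma tame_drift: "tame drift"
proof -
  have "tame (\<lambda>v i a. \<Sum>j\<in>{0..N}. of_bool (i = j) * hjb_rhs W j v - net_rate j v i a * W j v)"
    by (intro tame_sum tame_diff tame_mult tame_const tame_hjb_rhs tame_net_rate tame_W) auto
  thus ?thesis by (simp add: drift_def[abs_def])
qed

lemma W_final: "j \<le> N \<Longrightarrow> W j T = 0"
  using W_eq[of j T] T_pos by simp

lemma W_primitive:
  assumes j: "j \<le> N" and t: "0 \<le> t" "t \<le> r" "r \<le> T"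
  shows "W j r = W j t + (LBINT v:{t..r}. - hjb_rhs W j v)"
proof -
  have "integral {t..r} (hjb_rhs W j) + integral {r..T} (hjb_rhs W j) = integral {t..T} (hjb_rhs W j)"
    by (rule Henstock_Kurzweil_Integration.integral_combine) (use t hjb_rhs_integrable(2)[OF j, of t T] in auto)
  moreover have "(LBINT v:{t..r}. hjb_rhs W j v) = integral {t..r} (hjb_rhs W j)"
    by (rule set_borel_integral_eq_integral(2)[OF hjb_rhs_integrable(1)[OF j]]) (use t in auto)
  moreover have "(LBINT v:{t..r}. - hjb_rhs W j v) = - (LBINT v:{t..r}. hjb_rhs W j v)"
    by (rule set_integral_uminus) (rule hjb_rhs_integrable(1)[OF j], use t in auto)
  ultimately show ?thesis using W_eq[OF j, of t] W_eq[OF j, of r] t by simp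
qed

lemma indicator_measurable_of_set_integrable:
  "set_integrable lborel S f \<Longrightarrow> (\<lambda>v. indicator S v * f v) \<in> borel_measurable borel"
  for f :: "real \<Rightarrow> real"
  using borel_measurable_integrable[of lborel "\<lambda>v. indicator S v *\<^sub>R f v"]
  by (simp add: set_integrable_def)

text \<open>Dynkin's formula. The masses \<open>prob_in A j\<close> and the functions \<open>W j\<close> are both primitives of bounded
functions, so integration by parts applies state by state; \<open>W\<close> vanishes at \<open>T\<close>, and at \<open>t\<close> all the mass
of \<open>A\<close> sits in \<open>i\<close>.\<close>

lemma W_times_mass:
  assumes t: "t \<in> {0..T}" and A: "A \<in> sets (F t)" and Ai: "\<And>\<omega>. \<omega> \<in> A \<Longrightarrow> X t \<omega> = i" and i: "i \<le> N"
  shows "W i t * measure M A = (LBINT v:{t..T}. expect A drift v)"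
proof -
  have AM: "A \<in> sets M" by (rule sets_F_M[OF t A])
  have t': "0 \<le> t" "t \<le> T" using t by auto
  have meas: "(\<lambda>v. indicator {t..T} v * expect A G v) \<in> borel_measurable borel" if "tame G" for G
    using expect_time_integral(2)[OF that AM t'(1), of T] indicator_measurable_of_set_integrable by blast
  define f where "f j v = expect A (net_rate j) v * W j v + prob_in A j v * (- hjb_rhs W j v)" for j v
  have step: "prob_in A j T * W j T - prob_in A j t * W j t = (LBINT v:{t..T}. f j v) \<and> set_integrable lborel {t..T} (f j)"
    if j: "j \<le> N" for j
  proof -
    obtain Bf where Bf: "\<And>v. v \<in> {0..T} \<Longrightarrow> \<bar>expect A (net_rate j) v\<bar> \<le> Bf"
      using expect_bounded[OF tame_net_rate AM] by blast
    obtain Bg where Bg: "(\<lambda>s. indicator {0..T} s * hjb_rhs W j s) \<in> borel_measurable borel"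
        "\<And>v. v \<in> {0..T} \<Longrightarrow> \<bar>hjb_rhs W j v\<bar> \<le> Bg"
      using hjb_rhs_bounded_measurable[OF j] by blast
    obtain BW where BW: "\<And>v. v \<in> {0..T} \<Longrightarrow> \<bar>W j v\<bar> \<le> BW" using W_bounded by blast
    have gm: "(\<lambda>v. indicator {t..T} v * - hjb_rhs W j v) \<in> borel_measurable borel"
    proof -
      have "(\<lambda>v. - (indicator {t..T} v * (indicator {0..T} v * hjb_rhs W j v))) \<in> borel_measurable borel"
        by (intro borel_measurable_uminus borel_measurable_times[OF _ Bg(1)]) simp
      also have "(\<lambda>v. - (indicator {t..T} v * (indicator {0..T} v * hjb_rhs W j v))) = (\<lambda>v. indicator {t..T} v * - hjb_rhs W j v)"
        using t' by (auto simp: indicator_def)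
      finally show ?thesis .
    qed
    have Wm: "(\<lambda>v. indicator {t..T} v * W j v) \<in> borel_measurable borel"
      using borel_measurable_continuous_onI[OF W_cont[of j]] by simp
    have "(\<lambda>v. indicator {t..T} v * expect A (\<lambda>v i a. of_bool (i = j)) v) \<in> borel_measurable borel"
      by (intro meas tame_const)
    also have "(\<lambda>v. indicator {t..T} v * expect A (\<lambda>v i a. of_bool (i = j)) v) = (\<lambda>v. indicator {t..T} v * prob_in A j v)"
      using t' expect_state[OF AM] by (auto simp: indicator_def fun_eq_iff)
    finally have Fm: "(\<lambda>v. indicator {t..T} v * prob_in A j v) \<in> borel_measurable borel" .
    have Fb: "\<bar>prob_in A j v\<bar> \<le> 1" for v by (simp add: prob_in_def)
    show ?thesis
      unfolding f_def
      by (intro conjI integration_by_parts_primitives[where Bf=Bf and Bg=Bg and BG=BW and BF=1]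
          meas tame_net_rate gm Wm Fm prob_in_evolution W_primitive Fb)
         (use t' j A Bf Bg BW in auto)
  qed
  have mass: "prob_in A j t = (if j = i then measure M A else 0)" for j
  proof (cases "j = i")
    case True
    hence "{\<omega>\<in>A. X t \<omega> = j} = A" using Ai by auto
    thus ?thesis using True by (simp add: prob_in_def)
  next
    case False
    hence "{\<omega>\<in>A. X t \<omega> = j} = {}" using Ai by auto
    thus ?thesis using False unfolding prob_in_def by (simp only: measure_empty if_False)
  qed
  have "(\<Sum>j\<in>{0..N}. prob_in A j t * W j t) = (\<Sum>j\<in>{0..N}. if j = i then W i t * measure M A else 0)"
    by (intro sum.cong) (auto simp: mass)
  hence "(\<Sum>j\<in>{0..N}. prob_in A j t * W j t) = W i t * measure M A"
    using i by (simp add: sum.delta)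
  moreover have "(\<Sum>j\<in>{0..N}. LBINT v:{t..T}. f j v) = (\<Sum>j\<in>{0..N}. - (prob_in A j t * W j t))"
    using step W_final by (intro sum.cong) auto
  ultimately have "W i t * measure M A = - (\<Sum>j\<in>{0..N}. LBINT v:{t..T}. f j v)"
    by (simp add: sum_negf)
  also have "(\<Sum>j\<in>{0..N}. LBINT v:{t..T}. f j v) = (LBINT v:{t..T}. (\<Sum>j\<in>{0..N}. f j v))"
    using step by (intro set_integral_sum_finite[symmetric]) auto
  also have "\<dots> = (LBINT v:{t..T}. - expect A drift v)"
  proof (rule set_lebesgue_integral_cong)
    show "\<forall>v. v \<in> {t..T} \<longrightarrow> (\<Sum>j\<in>{0..N}. f j v) = - expect A drift v"
    proof (intro allI impI)
      fix v assume "v \<in> {t..T}"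
      hence v: "v \<in> {0..T}" using t' by auto
      have "expect A drift v = (\<Sum>j\<in>{0..N}. expect A (\<lambda>v i a. of_bool (i = j) * hjb_rhs W j v - net_rate j v i a * W j v) v)"
        unfolding drift_def[abs_def]
        by (rule expect_sum[OF _ AM v]) (intro tame_diff tame_mult tame_const tame_hjb_rhs tame_net_rate tame_W, auto)
      also have "\<dots> = (\<Sum>j\<in>{0..N}. - f j v)"
      proof (rule sum.cong)
        fix j assume "j \<in> {0..N}"
        hence j: "j \<le> N" by simp
        have "expect A (\<lambda>v i a. of_bool (i = j) * hjb_rhs W j v - net_rate j v i a * W j v) v
           = expect A (\<lambda>v i a. of_bool (i = j) * hjb_rhs W j v) v - expect A (\<lambda>v i a. net_rate j v i a * W j v) v"
          by (rule expect_linear(2)[OF _ _ AM v]) (intro tame_mult tame_const tame_hjb_rhs tame_net_rate tame_W j)+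
        also have "\<dots> = prob_in A j v * hjb_rhs W j v - expect A (net_rate j) v * W j v"
          unfolding expect_scale[of A "\<lambda>v i a. of_bool (i = j)" "hjb_rhs W j"] expect_scale[of A "net_rate j" "W j"]
          by (simp add: expect_state[OF AM v])
        finally show "expect A (\<lambda>v i a. of_bool (i = j) * hjb_rhs W j v - net_rate j v i a * W j v) v = - f j v"
          by (simp add: f_def)
      qed simp
      finally show "(\<Sum>j\<in>{0..N}. f j v) = - expect A drift v" by (simp add: sum_negf)
    qed
  qed simp
  also have "\<dots> = - (LBINT v:{t..T}. expect A drift v)"
    by (rule set_integral_uminus, rule expect_time_integral(2)[OF tame_drift AM]) (use t' in auto)
  finally show ?thesis by simp
qed

lemma drift_eq:
  assumes i: "i \<le> N"
  shows "drift v i a = hjb_rhs W i v - (if i < N then lam v * (W (i + 1) v - W i v) else 0)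
     + (if i = 0 then 0 else real a * (W i v - W (i - 1) v))"
proof -
  define R where "R = jump_rate N (lam v) a"
  have fr: "flow_rate k j v i a = (if k = i then R k j else 0)" for k j by (simp add: flow_rate_def R_def)
  have "(\<Sum>j\<in>{0..N}. net_rate j v i a * W j v) =
     (\<Sum>j\<in>{0..N}. (if j = i then 0 else R i j * W j v) - (if j = i then (\<Sum>k\<in>{0..N} - {i}. R i k * W i v) else 0))"
  proof (rule sum.cong)
    fix j assume "j \<in> {0..N}"
    have "net_rate j v i a = (\<Sum>k\<in>{0..N} - {j}. if k = i then R k j else 0) - (\<Sum>k\<in>{0..N} - {j}. if j = i then R j k else 0)"
      by (simp add: net_rate_def fr sum_subtractf)
    also have "(\<Sum>k\<in>{0..N} - {j}. if k = i then R k j else 0) = (if j = i then 0 else R i j)"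
      using i by (auto simp: sum.delta')
    finally show "net_rate j v i a * W j v = (if j = i then 0 else R i j * W j v) - (if j = i then (\<Sum>k\<in>{0..N} - {i}. R i k * W i v) else 0)"
      by (auto simp: sum_distrib_right)
  qed simp
  also have "\<dots> = (\<Sum>j\<in>{0..N}. if j = i then 0 else R i j * W j v) - (\<Sum>k\<in>{0..N} - {i}. R i k * W i v)"
    using i by (simp add: sum_subtractf sum.delta)
  also have "(\<Sum>k\<in>{0..N} - {i}. R i k * W i v) = (\<Sum>j\<in>{0..N}. if j = i then 0 else R i j * W i v)"
    by (rule sum.mono_neutral_cong_left) auto
  also have "(\<Sum>j\<in>{0..N}. if j = i then 0 else R i j * W j v) - \<dots> = (\<Sum>j\<in>{0..N}. if j = i then 0 else R i j * (W j v - W i v))"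
    by (auto simp: sum_subtractf[symmetric] right_diff_distrib intro!: sum.cong)
  also have "\<dots> = (\<Sum>j\<in>{0..N}. (if j = i + 1 then (if i < N then lam v * (W (i + 1) v - W i v) else 0) else 0)
      + (if j = i - 1 then (if i = 0 then 0 else real a * (W (i - 1) v - W i v)) else 0))"
    by (intro sum.cong refl) (auto simp: R_def jump_rate_def)
  also have "\<dots> = (if i < N then lam v * (W (i + 1) v - W i v) else 0)
      + (if i = 0 then 0 else real a * (W (i - 1) v - W i v))"
  proof -
    have "i - 1 \<le> N" using i by simp
    thus ?thesis using i by (auto simp: sum.distrib sum.delta)
  qed
  finally have net: "(\<Sum>j\<in>{0..N}. net_rate j v i a * W j v) = (if i < N then lam v * (W (i + 1) v - W i v) else 0)
      + (if i = 0 then 0 else real a * (W (i - 1) v - W i v))" .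
  have "(\<Sum>j\<in>{0..N}. of_bool (i = j) * hjb_rhs W j v) = (\<Sum>j\<in>{0..N}. if j = i then hjb_rhs W j v else 0)"
    by (intro sum.cong) auto
  also have "\<dots> = hjb_rhs W i v" using i by (simp add: sum.delta)
  finally show ?thesis
    unfolding drift_def sum_subtractf net by (auto simp: algebra_simps)
qed

text \<open>Here the minimisation in the equation for \<open>W\<close> meets the control problem: any feasible action costs at
least the drift, and the threshold action costs exactly the drift.\<close>

lemma drift_le_running_cost:
  assumes v: "v \<in> {0..T}" and i: "i \<le> N" and a: "a \<in> feasible K i"
  shows "drift v i a \<le> running_cost N \<pi> (lam v) (e v) i a"
    "a = (if i \<noteq> 0 \<and> e v < delta i v then min i K else 0) \<Longrightarrow> drift v i a = running_cost N \<pi> (lam v) (e v) i a"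
proof -
  have ai: "real a \<le> act i" using a by (simp add: feasible_def act_def)
  have d: "drift v i a = real a * delta i v - act i * excess i v + \<pi> * lam v * (if i = N then 1 else 0)" if "i \<noteq> 0"
    unfolding drift_eq[OF i] using i that by (auto simp: hjb_rhs_def delta_def excess_def)
  have d0: "drift v i a = 0" "a = 0" if "i = 0"
    unfolding drift_eq[OF i] using i that N_ge a by (auto simp: hjb_rhs_def act_bounds feasible_def)
  have "real a * (delta i v - e v) \<le> real a * excess i v" by (intro mult_left_mono) (auto simp: excess_def)
  also have "\<dots> \<le> act i * excess i v" by (intro mult_right_mono ai excess_nonneg)
  finally show "drift v i a \<le> running_cost N \<pi> (lam v) (e v) i a"
    using d d0 N_ge by (cases "i = 0") (auto simp: running_cost_def algebra_simps)
  assume opt: "a = (if i \<noteq> 0 \<and> e v < delta i v then min i K else 0)"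
  show "drift v i a = running_cost N \<pi> (lam v) (e v) i a"
  proof (cases "i = 0")
    case False
    have "real a * (delta i v - e v) = act i * excess i v"
      using opt False by (auto simp: excess_def act_def)
    thus ?thesis using d[OF False] by (simp add: running_cost_def algebra_simps)
  qed (use d0 N_ge in \<open>simp add: running_cost_def\<close>)
qed

lemma tame_running_cost: "tame (\<lambda>v i a. running_cost N \<pi> (lam v) (e v) i a)"
  unfolding running_cost_def by (intro tame_add tame_mult tame_const tame_lam tame_e)

lemma cost_to_go_eq:
  assumes t: "t \<in> {0..T}" and pos: "0 < measure M {\<omega>\<in>space M. X t \<omega> = i}"
  defines "A \<equiv> {\<omega>\<in>space M. X t \<omega> = i}"
  shows "cost_to_go N T \<pi> lam e M X u t i
    = (LBINT v:{t..T}. expect A (\<lambda>v i a. running_cost N \<pi> (lam v) (e v) i a) v) / measure M A"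
proof -
  note [measurable] = X_meas[OF t]
  have A [measurable]: "A \<in> sets M" unfolding A_def by simp
  define f where "f \<omega> = (LBINT s:{t..T}. running_cost N \<pi> (lam s) (e s) (X s \<omega>) (u s \<omega>))" for \<omega>
  have "integrable M (\<lambda>\<omega>. indicator (space M) \<omega> * f \<omega>)"
    unfolding f_def by (rule expect_time_integral(3)[OF tame_running_cost]) (use t in auto)
  hence "(\<lambda>\<omega>. indicator (space M) \<omega> * f \<omega>) \<in> borel_measurable M" by (rule borel_measurable_integrable)
  hence fm: "f \<in> borel_measurable M" by (rule measurable_cong[THEN iffD1, rotated]) simp
  have "uniform_measure M A = density M (\<lambda>\<omega>. ennreal (indicator A \<omega> / measure M A))"
    unfolding uniform_measure_def
    by (intro arg_cong[where f="density M"] ext)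
       (use pos in \<open>auto simp: emeasure_eq_measure A_def indicator_def divide_ennreal ennreal_1[symmetric] simp del: ennreal_1\<close>)
  hence "cost_to_go N T \<pi> lam e M X u t i = (\<integral>\<omega>. f \<omega> \<partial>density M (\<lambda>\<omega>. ennreal (indicator A \<omega> / measure M A)))"
    unfolding cost_to_go_def f_def A_def by simp
  also have "\<dots> = (\<integral>\<omega>. (indicator A \<omega> / measure M A) *\<^sub>R f \<omega> \<partial>M)"
    by (rule integral_density[OF fm]) (auto intro!: AE_I2 simp: indicator_def)
  also have "\<dots> = (\<integral>\<omega>. (indicator A \<omega> * f \<omega>) / measure M A \<partial>M)"
    by (rule Bochner_Integration.integral_cong) auto
  also have "\<dots> = (\<integral>\<omega>. indicator A \<omega> * f \<omega> \<partial>M) / measure M A" by simp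
  also have "(\<integral>\<omega>. indicator A \<omega> * f \<omega> \<partial>M) = (LBINT v:{t..T}. expect A (\<lambda>v i a. running_cost N \<pi> (lam v) (e v) i a) v)"
    unfolding f_def by (rule expect_time_integral(1)[OF tame_running_cost A]) (use t in auto)
  finally show ?thesis .
qed

text \<open>Dynkin's formula on the event \<open>X t = i\<close>, which belongs to \<open>F t\<close>, compared with the running cost.\<close>

lemma verification:
  assumes t: "t \<in> {0..T}" and i: "i \<le> N" and pos: "0 < measure M {\<omega>\<in>space M. X t \<omega> = i}"
  shows "W i t \<le> cost_to_go N T \<pi> lam e M X u t i"
    "(\<And>v \<omega>. v \<in> {0..T} \<Longrightarrow> \<omega> \<in> space M \<Longrightarrow>
        u v \<omega> = (if X v \<omega> \<noteq> 0 \<and> e v < delta (X v \<omega>) v then min (X v \<omega>) K else 0)) \<Longrightarrow>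
     cost_to_go N T \<pi> lam e M X u t i = W i t"
proof -
  define A where "A = {\<omega>\<in>space M. X t \<omega> = i}"
  let ?c = "\<lambda>v i a. running_cost N \<pi> (lam v) (e v) i a"
  have AF: "A \<in> sets (F t)"
  proof -
    have "X t -` {i} \<inter> space (F t) \<in> sets (F t)" by (rule measurable_sets[OF X_adapted[OF t]]) simp
    moreover have "X t -` {i} \<inter> space (F t) = A"
      using subalgebra_F[OF t] by (auto simp: A_def subalgebra_def)
    ultimately show ?thesis by simp
  qed
  have AM: "A \<in> sets M" by (rule sets_F_M[OF t AF])
  have W: "W i t * measure M A = (LBINT v:{t..T}. expect A drift v)"
    by (rule W_times_mass[OF t AF _ i]) (simp add: A_def)
  have "(LBINT v:{t..T}. expect A drift v) \<le> (LBINT v:{t..T}. expect A ?c v)"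
  proof (rule set_integral_mono)
    show "set_integrable lborel {t..T} (expect A drift)" "set_integrable lborel {t..T} (expect A ?c)"
      using t by (auto intro!: expect_time_integral(2) tame_drift tame_running_cost AM)
    fix v assume "v \<in> {t..T}"
    hence v: "v \<in> {0..T}" using t by auto
    show "expect A drift v \<le> expect A ?c v"
      by (rule expect_mono[OF tame_drift tame_running_cost AM v])
         (intro drift_le_running_cost(1) v X_le u_feasible)
  qed
  thus "W i t \<le> cost_to_go N T \<pi> lam e M X u t i"
    unfolding cost_to_go_eq[OF t pos] using W pos by (simp add: A_def[symmetric] le_divide_eq)
  assume opt: "\<And>v \<omega>. v \<in> {0..T} \<Longrightarrow> \<omega> \<in> space M \<Longrightarrow>
        u v \<omega> = (if X v \<omega> \<noteq> 0 \<and> e v < delta (X v \<omega>) v then min (X v \<omega>) K else 0)"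
  have "(LBINT v:{t..T}. expect A drift v) = (LBINT v:{t..T}. expect A ?c v)"
  proof (rule set_lebesgue_integral_cong)
    show "\<forall>v. v \<in> {t..T} \<longrightarrow> expect A drift v = expect A ?c v"
    proof (intro allI impI)
      fix v assume "v \<in> {t..T}"
      hence v: "v \<in> {0..T}" using t by auto
      show "expect A drift v = expect A ?c v"
        unfolding expect_def
        by (rule Bochner_Integration.integral_cong[OF refl])
           (simp add: drift_le_running_cost(2)[OF v X_le[OF v] u_feasible[OF v] opt[OF v]])
    qed
  qed simp
  thus "cost_to_go N T \<pi> lam e M X u t i = W i t"
    unfolding cost_to_go_eq[OF t pos] using W pos by (simp add: A_def[symmetric] divide_eq_eq)
qed

end

section \<open>Independent coordinates and exponential waiting times\<close>

text \<open>The form in which independence is used: a coordinate is independent of all earlier ones, hence it may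
be integrated out while they are held fixed.\<close>

lemma nn_integral_PiM_coordinate:
  fixes D :: "nat \<Rightarrow> real measure" and h :: "(nat \<Rightarrow> real) \<Rightarrow> real \<Rightarrow> ennreal"
  assumes prob: "\<And>i. prob_space (D i)" and sets: "\<And>i. sets (D i) = sets borel"
    and h: "(\<lambda>(x, y). h x y) \<in> borel_measurable (Pi\<^sub>M {..<n} D \<Otimes>\<^sub>M D n)"
    and past: "\<And>\<omega> y. h (restrict \<omega> {..<n}) y = h \<omega> y"
  shows "(\<integral>\<^sup>+\<omega>. h \<omega> (\<omega> n) \<partial>Pi\<^sub>M UNIV D) = (\<integral>\<^sup>+\<omega>. (\<integral>\<^sup>+y. h \<omega> y \<partial>D n) \<partial>Pi\<^sub>M UNIV D)"
proof -
  interpret prob_space "D i" for i by (rule prob)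
  interpret P: product_prob_space D UNIV by unfold_locales
  let ?J = "{..<n}"
  define g where "g x = h x (x n)" for x
  have g_past: "g (restrict \<omega> (insert n ?J)) = g \<omega>" for \<omega>
    unfolding g_def using past[of "restrict \<omega> (insert n ?J)"] past[of \<omega>]
    by (simp add: Int_absorb1 subset_insertI)
  have gm: "g \<in> borel_measurable (Pi\<^sub>M (insert n ?J) D)"
  proof -
    have "(\<lambda>x. (restrict x ?J, x n)) \<in> Pi\<^sub>M (insert n ?J) D \<rightarrow>\<^sub>M Pi\<^sub>M ?J D \<Otimes>\<^sub>M D n"
      by (intro measurable_Pair measurable_restrict_subset measurable_component_singleton) auto
    from measurable_compose[OF this h] show ?thesis by (simp add: g_def[abs_def] past)
  qed
  have "(\<integral>\<^sup>+\<omega>. g \<omega> \<partial>Pi\<^sub>M UNIV D) = (\<integral>\<^sup>+\<omega>. g (restrict \<omega> (insert n ?J)) \<partial>Pi\<^sub>M UNIV D)"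
    by (simp only: g_past)
  also have "\<dots> = (\<integral>\<^sup>+x. g x \<partial>distr (Pi\<^sub>M UNIV D) (Pi\<^sub>M (insert n ?J) D) (\<lambda>\<omega>. restrict \<omega> (insert n ?J)))"
  proof (rule nn_integral_distr[symmetric])
    show "(\<lambda>\<omega>. restrict \<omega> (insert n ?J)) \<in> Pi\<^sub>M UNIV D \<rightarrow>\<^sub>M Pi\<^sub>M (insert n ?J) D"
      by (rule measurable_restrict_subset) simp
  qed (simp add: gm)
  also have "\<dots> = (\<integral>\<^sup>+x. g x \<partial>Pi\<^sub>M (insert n ?J) D)"
    by (subst P.distr_PiM_restrict_finite) auto
  also have "\<dots> = (\<integral>\<^sup>+x. (\<integral>\<^sup>+y. g (x(n := y)) \<partial>D n) \<partial>Pi\<^sub>M ?J D)"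
    by (rule P.product_nn_integral_insert[OF _ _ gm]) auto
  also have "\<dots> = (\<integral>\<^sup>+x. (\<integral>\<^sup>+y. h x y \<partial>D n) \<partial>Pi\<^sub>M ?J D)"
  proof (intro nn_integral_cong)
    fix x :: "nat \<Rightarrow> real" and y
    have "restrict (x(n := y)) ?J = restrict x ?J" by (auto simp: restrict_def)
    thus "g (x(n := y)) = h x y" unfolding g_def by (metis past fun_upd_same)
  qed
  also have "\<dots> = (\<integral>\<^sup>+x. (\<integral>\<^sup>+y. h x y \<partial>D n) \<partial>distr (Pi\<^sub>M UNIV D) (Pi\<^sub>M ?J D) (\<lambda>\<omega>. restrict \<omega> ?J))"
    by (subst P.distr_PiM_restrict_finite) auto
  also have "\<dots> = (\<integral>\<^sup>+\<omega>. (\<integral>\<^sup>+y. h (restrict \<omega> ?J) y \<partial>D n) \<partial>Pi\<^sub>M UNIV D)"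
  proof (rule nn_integral_distr)
    show "(\<lambda>\<omega>. restrict \<omega> ?J) \<in> Pi\<^sub>M UNIV D \<rightarrow>\<^sub>M Pi\<^sub>M ?J D" by (rule measurable_restrict_subset) auto
    have "(\<lambda>x. \<integral>\<^sup>+y. h x y \<partial>D n) \<in> borel_measurable (Pi\<^sub>M ?J D)"
      using h by (rule borel_measurable_nn_integral)
    thus "(\<lambda>x. \<integral>\<^sup>+y. h x y \<partial>D n) \<in> borel_measurable (distr (Pi\<^sub>M UNIV D) (Pi\<^sub>M ?J D) (\<lambda>\<omega>. restrict \<omega> ?J))"
      by simp
  qed
  finally show ?thesis by (simp add: past g_def)
qed

lemma nn_integral_exponential:
  fixes f :: "real \<Rightarrow> ennreal"
  assumes "0 < c" and [measurable]: "f \<in> borel_measurable borel"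
  shows "(\<integral>\<^sup>+x. f x \<partial>density lborel (exponential_density c)) = (\<integral>\<^sup>+x. ennreal (c * exp (- c * x)) * f x * indicator {0..} x \<partial>lborel)"
proof -
  have "(\<integral>\<^sup>+x. f x \<partial>density lborel (exponential_density c)) = (\<integral>\<^sup>+x. ennreal (exponential_density c x) * f x \<partial>lborel)"
    by (rule nn_integral_density) auto
  also have "\<dots> = (\<integral>\<^sup>+x. ennreal (c * exp (- c * x)) * f x * indicator {0..} x \<partial>lborel)"
    by (rule nn_integral_cong) (auto simp: exponential_density_def indicator_def mult.commute)
  finally show ?thesis .
qed

lemma exponential_tail:
  assumes c: "0 < c" and y: "0 \<le> y"
  shows "emeasure (density lborel (exponential_density c)) {x. y < x} = ennreal (exp (- c * y))"
proof -
  have "emeasure (density lborel (exponential_density c)) {x. y < x} = (\<integral>\<^sup>+x. indicator {x. y < x} x \<partial>density lborel (exponential_density c))"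
    by (rule nn_integral_indicator[symmetric]) simp
  also have "\<dots> = (\<integral>\<^sup>+x. ennreal (c * exp (- c * x)) * indicator {x. y < x} x * indicator {0..} x \<partial>lborel)"
    by (rule nn_integral_exponential[OF c]) simp
  also have "\<dots> = (\<integral>\<^sup>+x. ennreal (c * exp (- c * x)) * indicator {y..} x \<partial>lborel)"
  proof (rule nn_integral_cong_AE)
    have "AE x in lborel. x \<noteq> y" by (rule AE_lborel_singleton)
    thus "AE x in lborel. ennreal (c * exp (- c * x)) * indicator {x. y < x} x * indicator {0..} x
        = ennreal (c * exp (- c * x)) * indicator {y..} x"
      by eventually_elim (use y in \<open>auto simp: indicator_def\<close>)
  qed
  also have "\<dots> = ennreal (0 - (- exp (- c * y)))"
  proof (rule nn_integral_FTC_atLeast[where F="\<lambda>x. - exp (- c * x)"])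
    show "((\<lambda>x. - exp (- c * x)) \<longlongrightarrow> 0) at_top"
    proof -
      have "LIM x at_top. c * x :> at_top"
        using c by (intro filterlim_tendsto_pos_mult_at_top[OF tendsto_const]) (auto simp: filterlim_ident)
      hence "((\<lambda>x. exp (- (c * x))) \<longlongrightarrow> 0) at_top"
        by (intro filterlim_compose[OF exp_at_bot] filterlim_compose[OF filterlim_uminus_at_bot_at_top])
      thus ?thesis using tendsto_minus by fastforce
    qed
  qed (use c in \<open>auto intro!: derivative_eq_intros\<close>)
  finally show ?thesis by simp
qed

text \<open>That the value is below \<open>1\<close> is what excludes explosion.\<close>

lemma exponential_laplace:
  assumes c: "0 < c"
  shows "(\<integral>\<^sup>+x. ennreal (exp (- max 0 x)) \<partial>density lborel (exponential_density c)) = ennreal (c / (c + 1))"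
proof -
  have c1: "0 < c + 1" using c by simp
  interpret E: prob_space "density lborel (exponential_density (c + 1))"
    by (rule prob_space_exponential_density[OF c1])
  have "(\<integral>\<^sup>+x. ennreal (exp (- max 0 x)) \<partial>density lborel (exponential_density c))
      = (\<integral>\<^sup>+x. ennreal (c * exp (- c * x)) * ennreal (exp (- max 0 x)) * indicator {0..} x \<partial>lborel)"
    by (rule nn_integral_exponential[OF c]) simp
  also have "\<dots> = (\<integral>\<^sup>+x. ennreal (c / (c + 1)) * (ennreal ((c + 1) * exp (- (c + 1) * x)) * 1 * indicator {0..} x) \<partial>lborel)"
  proof (rule nn_integral_cong)
    fix x
    have "c * exp (- c * x) * exp (- x) = c / (c + 1) * ((c + 1) * exp (- (c + 1) * x))"
      using c by (simp add: exp_add[symmetric] field_simps)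
    hence "ennreal (c * exp (- c * x)) * ennreal (exp (- x)) = ennreal (c / (c + 1)) * ennreal ((c + 1) * exp (- (c + 1) * x))"
      using c by (simp add: ennreal_mult[symmetric])
    thus "ennreal (c * exp (- c * x)) * ennreal (exp (- max 0 x)) * indicator {0..} x
      = ennreal (c / (c + 1)) * (ennreal ((c + 1) * exp (- (c + 1) * x)) * 1 * indicator {0..} x)"
      by (auto simp: indicator_def)
  qed
  also have "\<dots> = ennreal (c / (c + 1)) * (\<integral>\<^sup>+x. ennreal ((c + 1) * exp (- (c + 1) * x)) * 1 * indicator {0..} x \<partial>lborel)"
    by (rule nn_integral_cmult) simp
  also have "(\<integral>\<^sup>+x. ennreal ((c + 1) * exp (- (c + 1) * x)) * 1 * indicator {0..} x \<partial>lborel)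
      = (\<integral>\<^sup>+x. 1 \<partial>density lborel (exponential_density (c + 1)))"
    by (rule nn_integral_exponential[OF c1, symmetric]) simp
  also have "\<dots> = 1" using E.emeasure_space_1 by simp
  finally show ?thesis by simp
qed

section \<open>A controlled chain with given feedback\<close>

text \<open>A Markov jump process that has the time-dependent arrival rate \<open>l\<close> and the feedback action \<open>a\<close> is
obtained by thinning a Poisson process of constant rate \<open>c\<close>: at each of its points a uniform mark
decides whether an arrival, a departure or nothing happens, according to the rates at that very
time. The condition \<open>l v + K \<le> c\<close> makes the acceptance probabilities add up to at most \<open>1\<close>.\<close>

locale uniformized_chain =
  fixes N K :: nat and T c :: real and l :: "real \<Rightarrow> real" and a :: "real \<Rightarrow> nat \<Rightarrow> nat" and i0 :: nat
  assumes T_pos: "0 < T" and c_pos: "0 < c"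
    and l_meas [measurable]: "l \<in> borel_measurable borel" and l_nonneg: "0 \<le> l v" and l_le: "l v + real K \<le> c"
    and a_meas [measurable]: "(\<lambda>v. a v i) \<in> borel \<rightarrow>\<^sub>M count_space UNIV" and a_le: "a v i \<le> min i K"
    and i0_le: "i0 \<le> N"
begin

text \<open>Even coordinates are the waiting times between points, odd ones the marks.\<close>

definition D :: "nat \<Rightarrow> real measure" where
  "D n = (if even n then density lborel (exponential_density c) else uniform_measure lborel {0..<1})"

abbreviation M :: "(nat \<Rightarrow> real) measure" where "M \<equiv> Pi\<^sub>M UNIV D"

definition move :: "real \<Rightarrow> nat \<Rightarrow> real \<Rightarrow> nat" where
  "move v i z = (if z < l v / c then (if i < N then i + 1 else i)
     else if z < (l v + real (a v i)) / c then i - 1 else i)"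

text \<open>Waiting times are cut off at \<open>0\<close> so that epochs are monotone for every sample point.\<close>

primrec epoch :: "nat \<Rightarrow> (nat \<Rightarrow> real) \<Rightarrow> real" where
  "epoch 0 \<omega> = 0"
| "epoch (Suc k) \<omega> = epoch k \<omega> + max 0 (\<omega> (2 * k))"

primrec state_after :: "nat \<Rightarrow> (nat \<Rightarrow> real) \<Rightarrow> nat" where
  "state_after 0 \<omega> = i0"
| "state_after (Suc k) \<omega> = move (epoch (Suc k) \<omega>) (state_after k \<omega>) (\<omega> (2 * k + 1))"

definition X :: "real \<Rightarrow> (nat \<Rightarrow> real) \<Rightarrow> nat" where
  "X t \<omega> = (if \<exists>k. t < epoch (Suc k) \<omega> then state_after (LEAST k. t < epoch (Suc k) \<omega>) \<omega> else 0)"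

definition stay :: "nat \<Rightarrow> real \<Rightarrow> (nat \<Rightarrow> real) set" where
  "stay k t = {\<omega>. epoch k \<omega> \<le> t \<and> t < epoch (Suc k) \<omega>}"

lemma D_prob: "prob_space (D n)"
  unfolding D_def
  by (cases "even n") (auto intro!: prob_space_exponential_density prob_space_uniform_measure c_pos)

lemma D_sets [measurable_cong, simp]: "sets (D n) = sets borel"
  by (simp add: D_def)

lemma D_space [simp]: "space (D n) = UNIV"
  by (simp add: D_def)

sublocale M: prob_space M
  by (rule prob_space_PiM) (rule D_prob)

lemma M_space [simp]: "space M = UNIV"
  by (simp add: space_PiM)

lemma state_after_le: "state_after k \<omega> \<le> N"
  by (induction k) (auto simp: i0_le move_def)

lemma epoch_mono: "k \<le> k' \<Longrightarrow> epoch k \<omega> \<le> epoch k' \<omega>"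
  by (induction k' rule: dec_induct) auto

lemma stay_index:
  assumes "\<omega> \<in> stay k t"
  shows "(LEAST k. t < epoch (Suc k) \<omega>) = k" "X t \<omega> = state_after k \<omega>"
proof -
  show L: "(LEAST k. t < epoch (Suc k) \<omega>) = k"
  proof (rule Least_equality)
    show "t < epoch (Suc k) \<omega>" using assms by (simp add: stay_def)
    fix y assume y: "t < epoch (Suc y) \<omega>"
    show "k \<le> y"
    proof (rule ccontr)
      assume "\<not> k \<le> y"
      hence "epoch (Suc y) \<omega> \<le> epoch k \<omega>" by (intro epoch_mono) auto
      thus False using y assms by (simp add: stay_def)
    qed
  qed
  have "\<exists>k. t < epoch (Suc k) \<omega>" using assms by (auto simp: stay_def)
  thus "X t \<omega> = state_after k \<omega>" unfolding X_def L by simp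
qed

lemma stay_exists:
  assumes "0 \<le> t" "t < epoch (Suc k) \<omega>"
  obtains j where "j \<le> k" "\<omega> \<in> stay j t"
proof
  define j where "j = (LEAST k. t < epoch (Suc k) \<omega>)"
  show "j \<le> k" unfolding j_def by (rule Least_le) (rule assms)
  have 1: "t < epoch (Suc j) \<omega>" unfolding j_def by (rule LeastI) (rule assms)
  have "epoch j \<omega> \<le> t"
  proof (cases j)
    case (Suc i)
    hence "i < (LEAST k. t < epoch (Suc k) \<omega>)" by (simp add: j_def)
    from not_less_Least[OF this] show ?thesis using Suc by simp
  qed (use assms in simp)
  thus "\<omega> \<in> stay j t" using 1 by (simp add: stay_def)
qed

lemma stay_disjoint: "\<omega> \<in> stay k t \<Longrightarrow> \<omega> \<in> stay k' t \<Longrightarrow> k = k'"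
  using stay_index(1)[of \<omega> k t] stay_index(1)[of \<omega> k' t] by simp

lemma epoch_cong: "(\<And>n. n < 2 * k \<Longrightarrow> \<omega> n = \<omega>' n) \<Longrightarrow> epoch k \<omega> = epoch k \<omega>'"
  by (induction k) auto

lemma state_after_cong: "(\<And>n. n < 2 * k \<Longrightarrow> \<omega> n = \<omega>' n) \<Longrightarrow> state_after k \<omega> = state_after k \<omega>'"
proof (induction k)
  case (Suc k)
  have "epoch (Suc k) \<omega> = epoch (Suc k) \<omega>'" by (rule epoch_cong) (rule Suc.prems)
  moreover have "state_after k \<omega> = state_after k \<omega>'" by (rule Suc.IH) (use Suc.prems in auto)
  moreover have "\<omega> (2 * k + 1) = \<omega>' (2 * k + 1)" by (rule Suc.prems) simp
  ultimately show ?case by (simp only: state_after.simps)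
qed simp

lemma move_measurable: "(\<lambda>(v, z). move v i z) \<in> borel \<Otimes>\<^sub>M borel \<rightarrow>\<^sub>M count_space UNIV"
proof -
  have [measurable]: "(\<lambda>v. real (a v i)) \<in> borel_measurable borel"
    by (rule measurable_compose[OF a_meas]) simp
  show ?thesis unfolding move_def by measurable
qed

lemma coordinate_measurable: "n \<in> J \<Longrightarrow> (\<lambda>\<omega>. \<omega> n) \<in> borel_measurable (Pi\<^sub>M J D)"
  using measurable_component_singleton[of n J D] measurable_cong_sets[OF refl D_sets[of n]] by blast

lemma epoch_measurable: "{..<2 * k} \<subseteq> J \<Longrightarrow> epoch k \<in> borel_measurable (Pi\<^sub>M J D)"
proof (induction k)
  case 0
  have "epoch 0 = (\<lambda>\<omega>. 0)" by (simp add: fun_eq_iff)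
  thus ?case by simp
next
  case (Suc k)
  have "epoch (Suc k) = (\<lambda>\<omega>. epoch k \<omega> + max 0 (\<omega> (2 * k)))" by (simp add: fun_eq_iff)
  moreover have "epoch k \<in> borel_measurable (Pi\<^sub>M J D)" by (rule Suc.IH) (use Suc.prems in auto)
  moreover have "(\<lambda>\<omega>. \<omega> (2 * k)) \<in> borel_measurable (Pi\<^sub>M J D)"
    by (rule coordinate_measurable) (use Suc.prems in auto)
  ultimately show ?case by simp
qed

lemma state_after_measurable: "{..<2 * k} \<subseteq> J \<Longrightarrow> state_after k \<in> Pi\<^sub>M J D \<rightarrow>\<^sub>M count_space UNIV"
proof (induction k)
  case 0
  have "state_after 0 = (\<lambda>\<omega>. i0)" by (simp add: fun_eq_iff)
  thus ?case by simp
next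
  case (Suc k)
  have e: "epoch (Suc k) \<in> borel_measurable (Pi\<^sub>M J D)" by (rule epoch_measurable) (rule Suc.prems)
  have z: "(\<lambda>\<omega>. \<omega> (2 * k + 1)) \<in> borel_measurable (Pi\<^sub>M J D)"
    by (rule coordinate_measurable) (use Suc.prems in auto)
  have IH: "state_after k \<in> Pi\<^sub>M J D \<rightarrow>\<^sub>M count_space UNIV" by (rule Suc.IH) (use Suc.prems in auto)
  have "(\<lambda>\<omega>. (epoch (Suc k) \<omega>, \<omega> (2 * k + 1))) \<in> Pi\<^sub>M J D \<rightarrow>\<^sub>M borel \<Otimes>\<^sub>M borel"
    using e z by (rule measurable_Pair)
  from measurable_compose[OF this move_measurable]
  have "(\<lambda>\<omega>. move (epoch (Suc k) \<omega>) i (\<omega> (2 * k + 1))) \<in> Pi\<^sub>M J D \<rightarrow>\<^sub>M count_space UNIV" for i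
    by (simp only: prod.case)
  from measurable_compose_countable[OF this IH]
  have "(\<lambda>\<omega>. move (epoch (Suc k) \<omega>) (state_after k \<omega>) (\<omega> (2 * k + 1))) \<in> Pi\<^sub>M J D \<rightarrow>\<^sub>M count_space UNIV" .
  moreover have "state_after (Suc k) = (\<lambda>\<omega>. move (epoch (Suc k) \<omega>) (state_after k \<omega>) (\<omega> (2 * k + 1)))"
    by (simp add: fun_eq_iff)
  ultimately show ?case by (simp only:)
qed

end

context uniformized_chain
begin

text \<open>The information carried by the first \<open>k\<close> waiting times and marks.\<close>

definition past :: "nat \<Rightarrow> (nat \<Rightarrow> real) measure" where
  "past k = vimage_algebra UNIV (\<lambda>\<omega>. restrict \<omega> {..<2 * k}) (Pi\<^sub>M {..<2 * k} D)"

lemma past_space [simp]: "space (past k) = UNIV"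
  by (simp add: past_def)

lemma restrict_space_PiM: "(\<lambda>\<omega>. restrict \<omega> J) \<in> UNIV \<rightarrow> space (Pi\<^sub>M J D)"
  by (auto simp: space_PiM)

lemma past_measurableI:
  assumes "f \<in> Pi\<^sub>M {..<2 * k} D \<rightarrow>\<^sub>M N'" "\<And>\<omega>. f (restrict \<omega> {..<2 * k}) = f \<omega>"
  shows "f \<in> past k \<rightarrow>\<^sub>M N'"
  using measurable_compose[OF measurable_vimage_algebra1[OF restrict_space_PiM] assms(1)]
  by (simp add: past_def assms(2))

lemma past_setE:
  assumes "B \<in> sets (past k)"
  obtains B' where "B' \<in> sets (Pi\<^sub>M {..<2 * k} D)" "B = {\<omega>. restrict \<omega> {..<2 * k} \<in> B'}"
  using assms unfolding past_def sets_vimage_algebra2[OF restrict_space_PiM] by auto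

lemma past_setI:
  "B' \<in> sets (Pi\<^sub>M {..<2 * k} D) \<Longrightarrow> {\<omega>. restrict \<omega> {..<2 * k} \<in> B'} \<in> sets (past k)"
  unfolding past_def sets_vimage_algebra2[OF restrict_space_PiM] by auto

lemma past_mono:
  assumes "k \<le> k'"
  shows "sets (past k) \<subseteq> sets (past k')"
proof
  fix B assume "B \<in> sets (past k)"
  then obtain B' where B': "B' \<in> sets (Pi\<^sub>M {..<2 * k} D)" "B = {\<omega>. restrict \<omega> {..<2 * k} \<in> B'}"
    by (rule past_setE)
  have sub: "{..<2 * k} \<subseteq> {..<2 * k'}" using assms by auto
  let ?B = "(\<lambda>\<omega>. restrict \<omega> {..<2 * k}) -` B' \<inter> space (Pi\<^sub>M {..<2 * k'} D)"
  have "?B \<in> sets (Pi\<^sub>M {..<2 * k'} D)"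
    using measurable_restrict_subset[OF sub] B'(1) by (rule measurable_sets)
  from past_setI[OF this] have "{\<omega>. restrict \<omega> {..<2 * k'} \<in> ?B} \<in> sets (past k')" .
  moreover have "{\<omega>. restrict \<omega> {..<2 * k'} \<in> ?B} = B"
  proof -
    have "restrict (restrict \<omega> {..<2 * k'}) {..<2 * k} = restrict \<omega> {..<2 * k}" for \<omega> :: "nat \<Rightarrow> real"
      using assms by (auto simp: restrict_def fun_eq_iff)
    moreover have "restrict \<omega> {..<2 * k'} \<in> space (Pi\<^sub>M {..<2 * k'} D)" for \<omega>
      using restrict_space_PiM by blast
    ultimately show ?thesis by (simp add: B'(2))
  qed
  ultimately show "B \<in> sets (past k')" by simp
qed

lemma epoch_restrict: "{..<2 * k} \<subseteq> J \<Longrightarrow> epoch k (restrict \<omega> J) = epoch k \<omega>"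
  by (rule epoch_cong) auto

lemma state_after_restrict: "{..<2 * k} \<subseteq> J \<Longrightarrow> state_after k (restrict \<omega> J) = state_after k \<omega>"
  by (rule state_after_cong) auto

lemma past_measurable:
  "epoch k \<in> borel_measurable (past k)" "state_after k \<in> past k \<rightarrow>\<^sub>M count_space UNIV"
  by (auto intro!: past_measurableI epoch_measurable state_after_measurable epoch_restrict state_after_restrict)

lemma epoch_le_past: "{\<omega>. epoch k \<omega> \<le> t} \<in> sets (past k)"
proof -
  have "epoch k -` {..t} \<inter> space (past k) \<in> sets (past k)"
    by (rule measurable_sets[OF past_measurable(1)]) simp
  thus ?thesis by (simp add: vimage_def)
qed

lemma stay_past: "j < k \<Longrightarrow> stay j t \<in> sets (past k)"
proof -
  assume jk: "j < k"
  have "{\<omega>. epoch j \<omega> \<le> t} \<in> sets (past k)" "{\<omega>. epoch (Suc j) \<omega> \<le> t} \<in> sets (past k)"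
    by (rule subsetD[OF past_mono epoch_le_past], use jk in simp)+
  hence "{\<omega>. epoch j \<omega> \<le> t} - {\<omega>. epoch (Suc j) \<omega> \<le> t} \<in> sets (past k)" by (rule sets.Diff)
  moreover have "{\<omega>. epoch j \<omega> \<le> t} - {\<omega>. epoch (Suc j) \<omega> \<le> t} = stay j t"
    by (auto simp: stay_def)
  ultimately show ?thesis by simp
qed

text \<open>A filtration for which the jump mechanism is transparent: between two epochs an event of the history
at time \<open>s\<close> depends on the finished waiting times and marks only.\<close>

definition history_sets :: "real \<Rightarrow> (nat \<Rightarrow> real) set set" where
  "history_sets s = {A \<in> sets M. \<forall>k. \<exists>B\<in>sets (past k). A \<inter> stay k s = B \<inter> stay k s}"

definition history :: "real \<Rightarrow> (nat \<Rightarrow> real) measure" where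
  "history s = sigma UNIV (history_sets (max 0 s))"

lemma history_sigma_algebra: "sigma_algebra UNIV (history_sets s)"
  unfolding sigma_algebra_iff2
proof (intro conjI ballI allI impI)
  show "history_sets s \<subseteq> Pow UNIV" by simp
  show "{} \<in> history_sets s" by (auto simp: history_sets_def intro!: bexI[of _ "{}"])
  fix A assume A: "A \<in> history_sets s"
  have "UNIV - A \<in> sets M" using A sets.compl_sets[of A M] by (simp add: history_sets_def)
  moreover have "\<exists>B\<in>sets (past k). (UNIV - A) \<inter> stay k s = B \<inter> stay k s" for k
  proof -
    obtain B where B: "B \<in> sets (past k)" "A \<inter> stay k s = B \<inter> stay k s"
      using A by (auto simp: history_sets_def)
    have "UNIV - B \<in> sets (past k)" using sets.compl_sets[OF B(1)] by simp
    thus ?thesis using B(2) by (intro bexI[of _ "UNIV - B"]) auto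
  qed
  ultimately show "UNIV - A \<in> history_sets s" by (simp add: history_sets_def)
next
  fix A :: "nat \<Rightarrow> (nat \<Rightarrow> real) set" assume A: "range A \<subseteq> history_sets s"
  have "(\<Union>i. A i) \<in> sets M" using A by (intro sets.countable_UN) (auto simp: history_sets_def)
  moreover have "\<exists>B\<in>sets (past k). (\<Union>i. A i) \<inter> stay k s = B \<inter> stay k s" for k
  proof -
    have "\<forall>i. \<exists>B. B \<in> sets (past k) \<and> A i \<inter> stay k s = B \<inter> stay k s"
    proof
      fix i
      have "A i \<in> history_sets s" using A by auto
      thus "\<exists>B. B \<in> sets (past k) \<and> A i \<inter> stay k s = B \<inter> stay k s"
        unfolding history_sets_def by auto
    qed
    then obtain B where B: "\<And>i. B i \<in> sets (past k)" "\<And>i. A i \<inter> stay k s = B i \<inter> stay k s" by metis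
    have "(\<Union>i. B i) \<in> sets (past k)" using B(1) by (intro sets.countable_UN) auto
    moreover have "(\<Union>i. A i) \<inter> stay k s = (\<Union>i. B i) \<inter> stay k s" using B(2) by blast
    ultimately show ?thesis by blast
  qed
  ultimately show "(\<Union>i. A i) \<in> history_sets s" by (simp add: history_sets_def)
qed

lemma sets_history: "sets (history s) = history_sets (max 0 s)"
  unfolding history_def by (rule sigma_algebra.sets_measure_of_eq[OF history_sigma_algebra])

lemma space_history [simp]: "space (history s) = UNIV"
  by (simp add: history_def space_measure_of_conv)

text \<open>The description of the history extends from \<open>stay k s\<close> to all sample points whose next epoch is after
\<open>s\<close>: if an earlier period is still running at \<open>s\<close>, it ends no later than epoch \<open>k\<close>, and this is visible in the
\<open>k\<close>-th past. Monotonicity of the filtration and the intensity identity both rest on it.\<close>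

lemma history_before_next_epoch:
  assumes A: "A \<in> history_sets s" and s: "0 \<le> s"
  obtains B where "B \<in> sets (past k)" "A \<inter> {\<omega>. s < epoch (Suc k) \<omega>} = B \<inter> {\<omega>. s < epoch (Suc k) \<omega>}"
proof -
  have "\<forall>j. \<exists>B. B \<in> sets (past j) \<and> A \<inter> stay j s = B \<inter> stay j s"
    using A by (auto simp: history_sets_def)
  then obtain B where B: "\<And>j. B j \<in> sets (past j)" "\<And>j. A \<inter> stay j s = B j \<inter> stay j s" by metis
  \<comment> \<open>before \<open>k\<close> the period running at \<open>s\<close> is known to the past; period \<open>k\<close> itself only through its start\<close>
  define C where "C = (\<Union>j<k. B j \<inter> stay j s) \<union> (B k \<inter> {\<omega>. epoch k \<omega> \<le> s})"
  have Bj: "B j \<inter> stay j s \<in> sets (past k)" if "j < k" for j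
    using B(1)[of j] past_mono[of j k] that stay_past[OF that] by (intro sets.Int) auto
  have "(\<Union>j<k. B j \<inter> stay j s) \<in> sets (past k)"
    by (rule sets.finite_UN) (use Bj in auto)
  moreover have "B k \<inter> {\<omega>. epoch k \<omega> \<le> s} \<in> sets (past k)" by (rule sets.Int[OF B(1) epoch_le_past])
  ultimately have "C \<in> sets (past k)" unfolding C_def by (rule sets.Un)
  moreover have "\<omega> \<in> A \<longleftrightarrow> \<omega> \<in> C" if \<omega>: "s < epoch (Suc k) \<omega>" for \<omega>
  proof -
    obtain j where j: "j \<le> k" "\<omega> \<in> stay j s" using stay_exists[OF s \<omega>] by blast
    have AB: "\<omega> \<in> A \<longleftrightarrow> \<omega> \<in> B j" using B(2)[of j] j(2) by blast
    show ?thesis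
    proof (cases "j = k")
      case True
      have "\<omega> \<notin> stay i s" if "i < k" for i using stay_disjoint[OF j(2), of i] that True by auto
      moreover have "epoch k \<omega> \<le> s" using j(2) True by (simp add: stay_def)
      ultimately show ?thesis using AB True by (auto simp: C_def)
    next
      case False
      hence "Suc j \<le> k" using j(1) by simp
      hence "\<not> epoch k \<omega> \<le> s" using epoch_mono[of "Suc j" k \<omega>] j(2) by (simp add: stay_def)
      moreover have "\<omega> \<in> stay i s \<longleftrightarrow> i = j" for i using stay_disjoint[OF j(2), of i] j(2) by auto
      ultimately show ?thesis using AB \<open>Suc j \<le> k\<close> by (auto simp: C_def)
    qed
  qed
  ultimately show ?thesis using that[of C] by blast
qed

lemma history_filtration: "filtration UNIV history"
proof
  show "space (history i) = UNIV" for i by simp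
  fix s r :: real assume sr: "s \<le> r"
  show "sets (history s) \<subseteq> sets (history r)"
    unfolding sets_history
  proof
    fix A assume A: "A \<in> history_sets (max 0 s)"
    have "\<exists>B\<in>sets (past k). A \<inter> stay k (max 0 r) = B \<inter> stay k (max 0 r)" for k
    proof -
      obtain B where B: "B \<in> sets (past k)"
        "A \<inter> {\<omega>. max 0 s < epoch (Suc k) \<omega>} = B \<inter> {\<omega>. max 0 s < epoch (Suc k) \<omega>}"
        by (rule history_before_next_epoch[OF A, of k]) auto
      have "stay k (max 0 r) \<subseteq> {\<omega>. max 0 s < epoch (Suc k) \<omega>}" using sr by (auto simp: stay_def)
      thus ?thesis using B by (intro bexI[of _ B]) blast+
    qed
    thus "A \<in> history_sets (max 0 r)" using A by (simp add: history_sets_def)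
  qed
qed

lemma epoch_M [measurable]: "epoch k \<in> borel_measurable M"
  by (rule epoch_measurable) simp

lemma state_after_M [measurable]: "state_after k \<in> M \<rightarrow>\<^sub>M count_space UNIV"
  by (rule state_after_measurable) simp

lemma X_joint: "(\<lambda>(t, \<omega>). X t \<omega>) \<in> borel \<Otimes>\<^sub>M M \<rightarrow>\<^sub>M count_space UNIV"
proof -
  have e: "(\<lambda>p. epoch k (snd p)) \<in> borel_measurable (borel \<Otimes>\<^sub>M M)" for k
    by (rule measurable_compose[OF measurable_snd epoch_M])
  have P: "Measurable.pred (borel \<Otimes>\<^sub>M M) (\<lambda>p. fst p < epoch (Suc k) (snd p))" for k
  proof -
    note [measurable] = e
    show ?thesis by measurable
  qed
  have L: "(\<lambda>p. LEAST k. fst p < epoch (Suc k) (snd p)) \<in> borel \<Otimes>\<^sub>M M \<rightarrow>\<^sub>M count_space UNIV"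
    by (rule measurable_Least) (rule P)
  have "(\<lambda>p. state_after k (snd p)) \<in> borel \<Otimes>\<^sub>M M \<rightarrow>\<^sub>M count_space UNIV" for k
    by (rule measurable_compose[OF measurable_snd state_after_M])
  from measurable_compose_countable[OF this L]
  have "(\<lambda>p. state_after (LEAST k. fst p < epoch (Suc k) (snd p)) (snd p)) \<in> borel \<Otimes>\<^sub>M M \<rightarrow>\<^sub>M count_space UNIV" .
  moreover have "Measurable.pred (borel \<Otimes>\<^sub>M M) (\<lambda>p. \<exists>k. fst p < epoch (Suc k) (snd p))"
    by (intro pred_intros_countable P)
  ultimately have "(\<lambda>p. if \<exists>k. fst p < epoch (Suc k) (snd p) then state_after (LEAST k. fst p < epoch (Suc k) (snd p)) (snd p) else 0)
     \<in> borel \<Otimes>\<^sub>M M \<rightarrow>\<^sub>M count_space UNIV"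
    by (intro measurable_If) auto
  thus ?thesis by (simp add: X_def case_prod_beta')
qed

lemma X_M: "X t \<in> M \<rightarrow>\<^sub>M count_space UNIV"
proof -
  have "(\<lambda>\<omega>. (t, \<omega>)) \<in> M \<rightarrow>\<^sub>M borel \<Otimes>\<^sub>M M" by simp
  from measurable_compose[OF this X_joint] show ?thesis by simp
qed

lemma X_le: "X t \<omega> \<le> N"
  by (auto simp: X_def state_after_le)

lemma X_history:
  assumes "0 \<le> t"
  shows "X t \<in> history t \<rightarrow>\<^sub>M count_space UNIV"
proof (rule measurableI)
  fix Q :: "nat set"
  have "X t -` Q \<inter> space M \<in> sets M" by (rule measurable_sets[OF X_M]) simp
  moreover have "\<exists>B\<in>sets (past k). X t -` Q \<inter> stay k t = B \<inter> stay k t" for k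
  proof
    have "state_after k -` Q \<inter> space (past k) \<in> sets (past k)"
      by (rule measurable_sets[OF past_measurable(2)]) simp
    thus "state_after k -` Q \<in> sets (past k)" by simp
    show "X t -` Q \<inter> stay k t = state_after k -` Q \<inter> stay k t"
      using stay_index(2) by auto
  qed
  ultimately show "X t -` Q \<inter> space (history t) \<in> sets (history t)"
    using assms by (simp add: sets_history history_sets_def max_def)
qed simp

lemma gap_pos_AE: "AE \<omega> in M. \<forall>k. 0 < \<omega> (2 * k)"
proof -
  interpret prob_space "D i" for i by (rule D_prob)
  interpret P: product_prob_space D UNIV by unfold_locales
  have "AE \<omega> in M. 0 < \<omega> (2 * k)" for k
  proof (rule P.AE_component)
    have "AE x in lborel. x \<noteq> (0::real)" by (rule AE_lborel_singleton)
    hence "AE x in lborel. 0 < ennreal (exponential_density c x) \<longrightarrow> 0 < x"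
      by eventually_elim (auto simp: exponential_density_def)
    hence E: "AE x in density lborel (\<lambda>x. ennreal (exponential_density c x)). 0 < x"
      by (subst AE_density) auto
    have D: "D (2 * k) = density lborel (exponential_density c)" by (simp add: D_def)
    show "AE x in D (2 * k). 0 < x" unfolding D by (rule E)
  qed simp
  thus ?thesis by (simp add: AE_all_countable)
qed

lemma laplace_epoch: "(\<integral>\<^sup>+\<omega>. ennreal (exp (- epoch k \<omega>)) \<partial>M) = ennreal ((c / (c + 1)) ^ k)"
proof (induction k)
  case 0
  thus ?case by (simp add: M.emeasure_space_1[simplified])
next
  case (Suc k)
  let ?h = "\<lambda>\<omega> y. ennreal (exp (- epoch k \<omega>)) * ennreal (exp (- max 0 y))"
  have "(\<integral>\<^sup>+\<omega>. ennreal (exp (- epoch (Suc k) \<omega>)) \<partial>M) = (\<integral>\<^sup>+\<omega>. ?h \<omega> (\<omega> (2 * k)) \<partial>M)"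
    by (simp add: ennreal_mult[symmetric] exp_add[symmetric])
  also have "\<dots> = (\<integral>\<^sup>+\<omega>. (\<integral>\<^sup>+y. ?h \<omega> y \<partial>D (2 * k)) \<partial>M)"
  proof (rule nn_integral_PiM_coordinate[OF D_prob D_sets])
    have [measurable]: "epoch k \<in> borel_measurable (Pi\<^sub>M {..<2 * k} D)" by (rule epoch_measurable) simp
    show "(\<lambda>(\<omega>, y). ?h \<omega> y) \<in> borel_measurable (Pi\<^sub>M {..<2 * k} D \<Otimes>\<^sub>M D (2 * k))"
      by measurable
  qed (simp add: epoch_restrict)
  also have "\<dots> = (\<integral>\<^sup>+\<omega>. ennreal (exp (- epoch k \<omega>)) * ennreal (c / (c + 1)) \<partial>M)"
  proof (rule nn_integral_cong)
    fix \<omega>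
    have "(\<integral>\<^sup>+y. ?h \<omega> y \<partial>D (2 * k)) = ennreal (exp (- epoch k \<omega>)) * (\<integral>\<^sup>+y. ennreal (exp (- max 0 y)) \<partial>D (2 * k))"
      by (rule nn_integral_cmult) measurable
    thus "(\<integral>\<^sup>+y. ?h \<omega> y \<partial>D (2 * k)) = ennreal (exp (- epoch k \<omega>)) * ennreal (c / (c + 1))"
      using exponential_laplace[OF c_pos] by (simp add: D_def)
  qed
  also have "\<dots> = (\<integral>\<^sup>+\<omega>. ennreal (exp (- epoch k \<omega>)) \<partial>M) * ennreal (c / (c + 1))"
    by (rule nn_integral_multc) measurable
  also have "\<dots> = ennreal ((c / (c + 1)) ^ Suc k)"
    unfolding Suc.IH using c_pos by (simp add: ennreal_mult[symmetric] mult.commute)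
  finally show ?case .
qed

text \<open>On the event that all epochs are at most \<open>T\<close>, the variables \<open>exp (- epoch k)\<close> are at least
\<open>exp (- T)\<close>, but their expectations tend to \<open>0\<close>.\<close>

lemma no_explosion: "AE \<omega> in M. \<exists>k. T < epoch k \<omega>"
proof -
  define Z where "Z = {\<omega>. \<forall>k. epoch k \<omega> \<le> T}"
  have "Z = (\<Inter>k. epoch k -` {..T} \<inter> space M)" by (auto simp: Z_def)
  also have "\<dots> \<in> sets M"
  proof (rule sets.countable_INT)
    have "epoch k -` {..T} \<inter> space M \<in> sets M" for k by (rule measurable_sets[OF epoch_M]) simp
    thus "range (\<lambda>k. epoch k -` {..T} \<inter> space M) \<subseteq> sets M" by blast
  qed simp
  finally have Z: "Z \<in> sets M" .
  have bound: "ennreal (exp (- T)) * emeasure M Z \<le> ennreal ((c / (c + 1)) ^ k)" for k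
  proof -
    have "ennreal (exp (- T)) * emeasure M Z = (\<integral>\<^sup>+\<omega>. ennreal (exp (- T)) * indicator Z \<omega> \<partial>M)"
      using Z by (simp add: nn_integral_cmult_indicator)
    also have "\<dots> \<le> (\<integral>\<^sup>+\<omega>. ennreal (exp (- epoch k \<omega>)) \<partial>M)"
      by (rule nn_integral_mono) (auto simp: Z_def indicator_def)
    finally show ?thesis unfolding laplace_epoch .
  qed
  have "(\<lambda>k. ennreal ((c / (c + 1)) ^ k)) \<longlonglongrightarrow> ennreal 0"
    using c_pos by (intro tendsto_ennrealI LIMSEQ_realpow_zero) auto
  from LIMSEQ_le_const[OF this] bound have "ennreal (exp (- T)) * emeasure M Z \<le> ennreal 0" by blast
  hence "emeasure M Z = 0" by simp
  hence "Z \<in> null_sets M" using Z by (rule null_setsI)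
  hence "AE \<omega> in M. \<omega> \<notin> Z" by (rule AE_not_in)
  thus ?thesis by eventually_elim (auto simp: Z_def not_le)
qed

text \<open>With positive probability the first waiting time exceeds \<open>t\<close>, and the process has not moved.\<close>

lemma start_positive:
  assumes "t \<in> {0..T}"
  shows "0 < measure M {\<omega>\<in>space M. X t \<omega> = i0}"
proof -
  interpret prob_space "D i" for i by (rule D_prob)
  interpret P: product_prob_space D UNIV by unfold_locales
  have m: "{\<omega>\<in>space M. X t \<omega> = i0} \<in> sets M"
  proof -
    have "X t -` {i0} \<inter> space M \<in> sets M" by (rule measurable_sets[OF X_M]) simp
    thus ?thesis by (simp add: vimage_def)
  qed
  have "ennreal (exp (- c * t)) = emeasure (D 0) {x. t < x}"
    using exponential_tail[OF c_pos, of t] assms by (simp add: D_def)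
  also have "\<dots> = emeasure M {\<omega>\<in>space M. \<omega> 0 \<in> {x. t < x}}"
    by (rule P.emeasure_PiM_Collect_single[symmetric]) auto
  also have "\<dots> \<le> emeasure M {\<omega>\<in>space M. X t \<omega> = i0}"
  proof (rule emeasure_mono[OF _ m], safe)
    fix \<omega> :: "nat \<Rightarrow> real" assume "t < \<omega> 0"
    hence "\<omega> \<in> stay 0 t" using assms by (simp add: stay_def)
    from stay_index(2)[OF this] show "X t \<omega> = i0" by simp
  qed
  finally have "ennreal (exp (- c * t)) \<le> ennreal (measure M {\<omega>\<in>space M. X t \<omega> = i0})"
    by (simp add: M.emeasure_eq_measure)
  hence "exp (- c * t) \<le> measure M {\<omega>\<in>space M. X t \<omega> = i0}" by simp
  thus ?thesis by (rule less_le_trans[rotated]) simp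
qed

end

section \<open>The intensity of the jumps\<close>

context uniformized_chain
begin

definition rate :: "nat \<Rightarrow> nat \<Rightarrow> real \<Rightarrow> real" where
  "rate i j v = jump_rate N (l v) (a v i) i j"

lemma rate_nonneg: "0 \<le> rate i j v"
  using l_nonneg by (simp add: rate_def jump_rate_def)

lemma rate_measurable [measurable]: "rate i j \<in> borel_measurable borel"
proof -
  have [measurable]: "(\<lambda>v. real (a v i)) \<in> borel_measurable borel"
    by (rule measurable_compose[OF a_meas]) simp
  show ?thesis unfolding rate_def[abs_def] jump_rate_def by measurable
qed

text \<open>The mark is uniform, so the probability of a move is the length of an interval.\<close>

lemma move_probability:
  assumes ij: "i \<noteq> j"
  shows "emeasure (uniform_measure lborel {0..<1}) {z. move v i z = j} = ennreal (rate i j v / c)"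
proof -
  have lc: "0 \<le> l v / c" "l v / c \<le> (l v + real (a v i)) / c" "(l v + real (a v i)) / c \<le> 1"
  proof -
    have "real (a v i) \<le> real K" using a_le[of v i] by simp
    hence "l v + real (a v i) \<le> c" using l_le[of v] by linarith
    thus "(l v + real (a v i)) / c \<le> 1" using c_pos by simp
    show "0 \<le> l v / c" using l_nonneg c_pos by simp
    show "l v / c \<le> (l v + real (a v i)) / c" using c_pos by (intro divide_right_mono) auto
  qed
  have set: "{0..<1} \<inter> {z. move v i z = j} =
      (if j = i + 1 \<and> i < N then {0..<l v / c} else if i = j + 1 then {l v / c..<(l v + real (a v i)) / c} else {})"
  proof (cases "j = i + 1 \<and> i < N")
    case True
    thus ?thesis using lc by (auto simp: move_def)
  next
    case F1: False
    show ?thesis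
    proof (cases "i = j + 1")
      case True
      thus ?thesis using lc by (auto simp: move_def)
    next
      case False
      have "move v i z \<noteq> j" for z
      proof (cases "i = 0")
        case True
        hence "a v i = 0" using a_le[of v i] by simp
        thus ?thesis using F1 False ij True by (auto simp: move_def)
      next
        case False
        thus ?thesis using F1 \<open>i \<noteq> j + 1\<close> ij by (auto simp: move_def)
      qed
      thus ?thesis using F1 False by auto
    qed
  qed
  have m: "{z. move v i z = j} \<in> sets lborel"
  proof -
    have "(\<lambda>z. (v, z)) \<in> borel \<rightarrow>\<^sub>M borel \<Otimes>\<^sub>M borel" by simp
    from measurable_compose[OF this move_measurable] have "(\<lambda>z. move v i z) \<in> borel \<rightarrow>\<^sub>M count_space UNIV" by simp
    from measurable_sets[OF this, of "{j}"] show ?thesis by (simp add: vimage_def)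
  qed
  have "emeasure (uniform_measure lborel {0..<1}) {z. move v i z = j} = emeasure lborel ({0..<1} \<inter> {z. move v i z = j})"
    using m by (subst emeasure_uniform_measure) (auto simp: divide_ennreal_def)
  also have "\<dots> = ennreal (rate i j v / c)"
    unfolding set using lc by (auto simp: rate_def jump_rate_def diff_divide_distrib[symmetric])
  finally show ?thesis .
qed

definition next_jump :: "nat \<Rightarrow> nat \<Rightarrow> nat \<Rightarrow> real \<Rightarrow> real \<Rightarrow> (nat \<Rightarrow> real) set" where
  "next_jump k i j s r = {\<omega>. s < epoch (Suc k) \<omega> \<and> epoch (Suc k) \<omega> \<le> r \<and> state_after k \<omega> = i \<and> state_after (Suc k) \<omega> = j}"

text \<open>Given the past up to epoch \<open>k\<close>, the next epoch has density \<open>c * exp (- c * (v - epoch k \<omega>))\<close>, and a jump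
to \<open>j\<close> at time \<open>v\<close> is accepted with probability \<open>rate i j v / c\<close>. The product, integrated, is the
conditional probability of a jump to \<open>j\<close> at the next epoch.\<close>

definition hazard :: "nat \<Rightarrow> nat \<Rightarrow> nat \<Rightarrow> real \<Rightarrow> real \<Rightarrow> (nat \<Rightarrow> real) \<Rightarrow> ennreal" where
  "hazard k i j s r \<omega> = (\<integral>\<^sup>+v. ennreal (rate i j v * exp (- c * (v - epoch k \<omega>)))
     * indicator {epoch k \<omega>..} v * indicator {s<..r} v \<partial>lborel)"

definition occupation :: "nat \<Rightarrow> nat \<Rightarrow> nat \<Rightarrow> real \<Rightarrow> real \<Rightarrow> (nat \<Rightarrow> real) \<Rightarrow> ennreal" where
  "occupation k i j s r \<omega> =
     (\<integral>\<^sup>+v. ennreal (rate i j v) * of_bool (\<omega> \<in> stay k v \<and> state_after k \<omega> = i) * indicator {s<..r} v \<partial>lborel)"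

lemma past_indicator:
  assumes B: "B \<in> sets (past k)" and n: "2 * k \<le> n"
  shows "indicator B (restrict \<omega> {..<n}) = (indicator B \<omega> :: ennreal)"
    "indicator B \<in> (borel_measurable (Pi\<^sub>M {..<n} D) :: ((nat \<Rightarrow> real) \<Rightarrow> ennreal) set)"
proof -
  obtain B' where B': "B' \<in> sets (Pi\<^sub>M {..<2 * k} D)" "B = {\<omega>. restrict \<omega> {..<2 * k} \<in> B'}"
    using past_setE[OF B] by blast
  have ind: "indicator B = (\<lambda>\<omega>. indicator B' (restrict \<omega> {..<2 * k}) :: ennreal)"
    by (simp add: B'(2) indicator_def fun_eq_iff)
  have "(\<lambda>\<omega>. restrict \<omega> {..<2 * k}) \<in> Pi\<^sub>M {..<n} D \<rightarrow>\<^sub>M Pi\<^sub>M {..<2 * k} D"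
    by (rule measurable_restrict_subset) (use n in auto)
  from measurable_compose[OF this borel_measurable_indicator[OF B'(1)]]
  show "indicator B \<in> (borel_measurable (Pi\<^sub>M {..<n} D) :: ((nat \<Rightarrow> real) \<Rightarrow> ennreal) set)"
    unfolding ind .
  have "restrict (restrict \<omega> {..<n}) {..<2 * k} = restrict \<omega> {..<2 * k}"
    using n by (auto simp: restrict_def fun_eq_iff)
  thus "indicator B (restrict \<omega> {..<n}) = (indicator B \<omega> :: ennreal)" by (simp add: ind)
qed

text \<open>Together with the next lemma this is the intensity identity for a single period. Here the mark and
then the waiting time are integrated out.\<close>

lemma next_jump_exact:
  assumes B: "B \<in> sets (past k)" and ij: "i \<noteq> j"
  shows "(\<integral>\<^sup>+\<omega>. indicator B \<omega> * indicator (next_jump k i j s r) \<omega> \<partial>M)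
    = (\<integral>\<^sup>+\<omega>. indicator B \<omega> * of_bool (state_after k \<omega> = i) * hazard k i j s r \<omega> \<partial>M)"
proof -
  \<comment> \<open>first integrate out the mark, then the waiting time\<close>
  define h1 where "h1 \<omega> z = indicator B \<omega> * of_bool (state_after k \<omega> = i) * indicator {s<..r} (epoch (Suc k) \<omega>) *
      (of_bool (move (epoch (Suc k) \<omega>) i z = j) :: ennreal)" for \<omega> z
  define h2 where "h2 \<omega> y = indicator B \<omega> * of_bool (state_after k \<omega> = i) *
     (indicator {s<..r} (epoch k \<omega> + max 0 y) * ennreal (rate i j (epoch k \<omega> + max 0 y) / c))" for \<omega> y
  have "(\<integral>\<^sup>+\<omega>. indicator B \<omega> * indicator (next_jump k i j s r) \<omega> \<partial>M) = (\<integral>\<^sup>+\<omega>. h1 \<omega> (\<omega> (2 * k + 1)) \<partial>M)"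
    by (rule nn_integral_cong) (auto simp: h1_def next_jump_def indicator_def)
  also have "\<dots> = (\<integral>\<^sup>+\<omega>. (\<integral>\<^sup>+z. h1 \<omega> z \<partial>D (2 * k + 1)) \<partial>M)"
  proof (rule nn_integral_PiM_coordinate[OF D_prob D_sets])
    let ?S = "Pi\<^sub>M {..<2 * k + 1} D"
    have [measurable]: "epoch (Suc k) \<in> borel_measurable ?S" "state_after k \<in> ?S \<rightarrow>\<^sub>M count_space UNIV"
        "indicator B \<in> (borel_measurable ?S :: ((nat \<Rightarrow> real) \<Rightarrow> ennreal) set)"
      subgoal
      proof -
        have "epoch (Suc k) = (\<lambda>\<omega>. epoch k \<omega> + max 0 (\<omega> (2 * k)))" by (simp add: fun_eq_iff)
        moreover have "epoch k \<in> borel_measurable ?S" by (rule epoch_measurable) auto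
        moreover have "(\<lambda>\<omega>. \<omega> (2 * k)) \<in> borel_measurable ?S" by (rule coordinate_measurable) auto
        ultimately show ?thesis by simp
      qed
      subgoal by (rule state_after_measurable) auto
      subgoal by (rule past_indicator(2)[OF B]) simp
      done
    have "(\<lambda>p. (epoch (Suc k) (fst p), snd p)) \<in> ?S \<Otimes>\<^sub>M D (2 * k + 1) \<rightarrow>\<^sub>M borel \<Otimes>\<^sub>M borel"
    proof (rule measurable_Pair)
      show "(\<lambda>p. epoch (Suc k) (fst p)) \<in> borel_measurable (?S \<Otimes>\<^sub>M D (2 * k + 1))"
        by (rule measurable_compose[OF measurable_fst]) fact
      show "(\<lambda>p. snd p) \<in> borel_measurable (?S \<Otimes>\<^sub>M D (2 * k + 1))"
        using measurable_snd[of ?S "D (2 * k + 1)"] measurable_cong_sets[OF refl D_sets] by blast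
    qed
    from measurable_compose[OF this move_measurable]
    have [measurable]: "(\<lambda>p. move (epoch (Suc k) (fst p)) i (snd p)) \<in> ?S \<Otimes>\<^sub>M D (2 * k + 1) \<rightarrow>\<^sub>M count_space UNIV"
      by (simp only: prod.case)
    have "(\<lambda>p. indicator B (fst p) * of_bool (state_after k (fst p) = i) * indicator {s<..r} (epoch (Suc k) (fst p)) *
      (of_bool (move (epoch (Suc k) (fst p)) i (snd p) = j) :: ennreal)) \<in> borel_measurable (?S \<Otimes>\<^sub>M D (2 * k + 1))"
      unfolding of_bool_def by measurable
    thus "(\<lambda>(\<omega>, z). h1 \<omega> z) \<in> borel_measurable (?S \<Otimes>\<^sub>M D (2 * k + 1))"
      by (simp only: h1_def case_prod_beta')
    fix \<omega> z
    have "epoch (Suc k) (restrict \<omega> {..<2 * k + 1}) = epoch (Suc k) \<omega>"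
      by (simp add: epoch_restrict)
    moreover have "state_after k (restrict \<omega> {..<2 * k + 1}) = state_after k \<omega>" by (rule state_after_restrict) auto
    ultimately show "h1 (restrict \<omega> {..<2 * k + 1}) z = h1 \<omega> z" by (simp add: h1_def past_indicator(1)[OF B] del: epoch.simps)
  qed
  also have "\<dots> = (\<integral>\<^sup>+\<omega>. h2 \<omega> (\<omega> (2 * k)) \<partial>M)"
  proof (rule nn_integral_cong)
    fix \<omega>
    let ?v = "epoch (Suc k) \<omega>"
    have mm: "{z. move ?v i z = j} \<in> sets (D (2 * k + 1))"
    proof -
      have "(\<lambda>z. (?v, z)) \<in> borel \<rightarrow>\<^sub>M borel \<Otimes>\<^sub>M borel" by simp
      from measurable_compose[OF this move_measurable] have "(\<lambda>z. move ?v i z) \<in> borel \<rightarrow>\<^sub>M count_space UNIV" by simp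
      from measurable_sets[OF this, of "{j}"] show ?thesis by (simp add: vimage_def)
    qed
    have "(\<integral>\<^sup>+z. h1 \<omega> z \<partial>D (2 * k + 1))
       = (\<integral>\<^sup>+z. (indicator B \<omega> * of_bool (state_after k \<omega> = i) * indicator {s<..r} ?v) * indicator {z. move ?v i z = j} z \<partial>D (2 * k + 1))"
      by (rule nn_integral_cong) (simp only: h1_def indicator_def of_bool_def mem_Collect_eq)
    also have "\<dots> = (indicator B \<omega> * of_bool (state_after k \<omega> = i) * indicator {s<..r} ?v) * emeasure (D (2 * k + 1)) {z. move ?v i z = j}"
      by (rule nn_integral_cmult_indicator[OF mm])
    also have "emeasure (D (2 * k + 1)) {z. move ?v i z = j} = ennreal (rate i j ?v / c)"
      using move_probability[OF ij, of ?v] by (simp add: D_def)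
    finally show "(\<integral>\<^sup>+z. h1 \<omega> z \<partial>D (2 * k + 1)) = h2 \<omega> (\<omega> (2 * k))"
      by (simp add: h2_def mult.assoc)
  qed
  also have "\<dots> = (\<integral>\<^sup>+\<omega>. (\<integral>\<^sup>+y. h2 \<omega> y \<partial>D (2 * k)) \<partial>M)"
  proof (rule nn_integral_PiM_coordinate[OF D_prob D_sets])
    let ?S = "Pi\<^sub>M {..<2 * k} D"
    have [measurable]: "epoch k \<in> borel_measurable ?S" "state_after k \<in> ?S \<rightarrow>\<^sub>M count_space UNIV"
        "indicator B \<in> (borel_measurable ?S :: ((nat \<Rightarrow> real) \<Rightarrow> ennreal) set)"
      by (auto intro!: epoch_measurable state_after_measurable past_indicator(2)[OF B])
    show "(\<lambda>(\<omega>, y). h2 \<omega> y) \<in> borel_measurable (?S \<Otimes>\<^sub>M D (2 * k))"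
      unfolding h2_def of_bool_def by measurable
    fix \<omega> y
    show "h2 (restrict \<omega> {..<2 * k}) y = h2 \<omega> y"
      by (simp add: h2_def past_indicator(1)[OF B] epoch_restrict state_after_restrict)
  qed
  also have "\<dots> = (\<integral>\<^sup>+\<omega>. indicator B \<omega> * of_bool (state_after k \<omega> = i) * hazard k i j s r \<omega> \<partial>M)"
  proof (rule nn_integral_cong)
    fix \<omega>
    let ?t = "epoch k \<omega>"
    define f where "f y = indicator {s<..r} (?t + max 0 y) * ennreal (rate i j (?t + max 0 y) / c)" for y :: real
    have fm [measurable]: "f \<in> borel_measurable borel" unfolding f_def by measurable
    have "(\<integral>\<^sup>+y. h2 \<omega> y \<partial>D (2 * k)) = indicator B \<omega> * of_bool (state_after k \<omega> = i) * (\<integral>\<^sup>+y. f y \<partial>D (2 * k))"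
      unfolding h2_def f_def[symmetric] by (rule nn_integral_cmult) measurable
    also have "(\<integral>\<^sup>+y. f y \<partial>D (2 * k)) = (\<integral>\<^sup>+y. ennreal (c * exp (- c * y)) * f y * indicator {0..} y \<partial>lborel)"
      using nn_integral_exponential[OF c_pos fm] by (simp add: D_def)
    also have "\<dots> = (\<integral>\<^sup>+v. ennreal (c * exp (- c * (- ?t + v))) * f (- ?t + v) * indicator {0..} (- ?t + v) \<partial>lborel)"
      using nn_integral_real_affine[of "\<lambda>y. ennreal (c * exp (- c * y)) * f y * indicator {0..} y" 1 "- ?t"] by simp
    also have "\<dots> = (\<integral>\<^sup>+v. ennreal (rate i j v * exp (- c * (v - ?t))) * indicator {?t..} v * indicator {s<..r} v \<partial>lborel)"
    proof (rule nn_integral_cong)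
      fix v
      show "ennreal (c * exp (- c * (- ?t + v))) * f (- ?t + v) * indicator {0..} (- ?t + v)
        = ennreal (rate i j v * exp (- c * (v - ?t))) * indicator {?t..} v * indicator {s<..r} v"
      proof (cases "?t \<le> v \<and> v \<in> {s<..r}")
        case True
        hence "f (- ?t + v) = ennreal (rate i j v / c)" by (simp add: f_def)
        moreover have "c * exp (- c * (- ?t + v)) * (rate i j v / c) = rate i j v * exp (- c * (v - ?t))"
          using c_pos by simp
        ultimately show ?thesis using True c_pos rate_nonneg[of i j v] by (simp add: ennreal_mult[symmetric])
      next
        case False
        thus ?thesis by (auto simp: f_def indicator_def)
      qed
    qed
    finally show "(\<integral>\<^sup>+y. h2 \<omega> y \<partial>D (2 * k)) = indicator B \<omega> * of_bool (state_after k \<omega> = i) * hazard k i j s r \<omega>"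
      unfolding hazard_def .
  qed
  finally show ?thesis .
qed

text \<open>By Tonelli's theorem the expected occupation is the rate integrated against the survival
probability \<open>exp (- c * (v - epoch k \<omega>))\<close>: the same \<open>hazard\<close> as for the jumps.\<close>

lemma stay_exact:
  assumes B: "B \<in> sets (past k)"
  shows "(\<integral>\<^sup>+\<omega>. indicator B \<omega> * occupation k i j s r \<omega> \<partial>M)
    = (\<integral>\<^sup>+\<omega>. indicator B \<omega> * of_bool (state_after k \<omega> = i) * hazard k i j s r \<omega> \<partial>M)"
proof -
  define h where "h \<omega> y = indicator B \<omega> * of_bool (state_after k \<omega> = i) *
     (\<integral>\<^sup>+v. (if epoch k \<omega> \<le> v \<and> s < v \<and> v \<le> r \<and> v < epoch k \<omega> + max 0 y then ennreal (rate i j v) else 0) \<partial>lborel)" for \<omega> and y :: real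
  have "(\<integral>\<^sup>+\<omega>. indicator B \<omega> * occupation k i j s r \<omega> \<partial>M)
    = (\<integral>\<^sup>+\<omega>. h \<omega> (\<omega> (2 * k)) \<partial>M)"
  proof (rule nn_integral_cong)
    fix \<omega>
    show "indicator B \<omega> * occupation k i j s r \<omega>
       = h \<omega> (\<omega> (2 * k))"
    proof (cases "state_after k \<omega> = i")
      case True
      have "ennreal (rate i j v) * of_bool (\<omega> \<in> stay k v \<and> state_after k \<omega> = i) * indicator {s<..r} v
          = (if epoch k \<omega> \<le> v \<and> s < v \<and> v \<le> r \<and> v < epoch k \<omega> + max 0 (\<omega> (2 * k)) then ennreal (rate i j v) else 0)" for v
        using True by (auto simp: stay_def indicator_def)
      thus ?thesis using True by (simp add: h_def occupation_def)
    qed (simp add: h_def occupation_def)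
  qed
  also have "\<dots> = (\<integral>\<^sup>+\<omega>. (\<integral>\<^sup>+y. h \<omega> y \<partial>D (2 * k)) \<partial>M)"
  proof (rule nn_integral_PiM_coordinate[OF D_prob D_sets])
    let ?S = "Pi\<^sub>M {..<2 * k} D"
    have [measurable]: "epoch k \<in> borel_measurable ?S" "state_after k \<in> ?S \<rightarrow>\<^sub>M count_space UNIV"
        "indicator B \<in> (borel_measurable ?S :: ((nat \<Rightarrow> real) \<Rightarrow> ennreal) set)"
      by (auto intro!: epoch_measurable state_after_measurable past_indicator(2)[OF B])
    show "(\<lambda>(\<omega>, y). h \<omega> y) \<in> borel_measurable (?S \<Otimes>\<^sub>M D (2 * k))"
      unfolding h_def of_bool_def by measurable
    fix \<omega> y
    show "h (restrict \<omega> {..<2 * k}) y = h \<omega> y"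
      by (simp add: h_def past_indicator(1)[OF B] epoch_restrict state_after_restrict)
  qed
  also have "\<dots> = (\<integral>\<^sup>+\<omega>. indicator B \<omega> * of_bool (state_after k \<omega> = i) * hazard k i j s r \<omega> \<partial>M)"
  proof (rule nn_integral_cong)
    fix \<omega>
    let ?t = "epoch k \<omega>"
    interpret E: prob_space "D (2 * k)" by (rule D_prob)
    interpret P: pair_sigma_finite lborel "D (2 * k)" by unfold_locales
    let ?g = "\<lambda>v y. (if ?t \<le> v \<and> s < v \<and> v \<le> r \<and> v < ?t + max 0 y then ennreal (rate i j v) else 0) :: ennreal"
    have gm: "(\<lambda>p. ?g (fst p) (snd p)) \<in> borel_measurable (lborel \<Otimes>\<^sub>M D (2 * k))"
      by measurable
    have "(\<lambda>y. \<integral>\<^sup>+v. ?g v y \<partial>lborel) \<in> borel_measurable (D (2 * k))"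
      by measurable
    hence "(\<integral>\<^sup>+y. h \<omega> y \<partial>D (2 * k)) = indicator B \<omega> * of_bool (state_after k \<omega> = i) * (\<integral>\<^sup>+y. (\<integral>\<^sup>+v. ?g v y \<partial>lborel) \<partial>D (2 * k))"
      unfolding h_def by (rule nn_integral_cmult)
    also have "(\<integral>\<^sup>+y. (\<integral>\<^sup>+v. ?g v y \<partial>lborel) \<partial>D (2 * k)) = (\<integral>\<^sup>+v. (\<integral>\<^sup>+y. ?g v y \<partial>D (2 * k)) \<partial>lborel)"
      using P.Fubini[OF gm] by (simp only: fst_conv snd_conv)
    also have "\<dots> = (\<integral>\<^sup>+v. ennreal (rate i j v * exp (- c * (v - ?t))) * indicator {?t..} v * indicator {s<..r} v \<partial>lborel)"
    proof (rule nn_integral_cong)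
      fix v
      show "(\<integral>\<^sup>+y. ?g v y \<partial>D (2 * k)) = ennreal (rate i j v * exp (- c * (v - ?t))) * indicator {?t..} v * indicator {s<..r} v"
      proof (cases "?t \<le> v \<and> v \<in> {s<..r}")
        case True
        have "(\<integral>\<^sup>+y. ?g v y \<partial>D (2 * k)) = (\<integral>\<^sup>+y. ennreal (rate i j v) * indicator {y. v - ?t < y} y \<partial>D (2 * k))"
          by (rule nn_integral_cong) (use True in \<open>auto simp: indicator_def max_def\<close>)
        also have "\<dots> = ennreal (rate i j v) * emeasure (D (2 * k)) {y. v - ?t < y}"
          by (rule nn_integral_cmult_indicator) simp
        also have "emeasure (D (2 * k)) {y. v - ?t < y} = ennreal (exp (- c * (v - ?t)))"
          using exponential_tail[OF c_pos, of "v - ?t"] True by (simp add: D_def)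
        finally show ?thesis using True rate_nonneg by (simp add: ennreal_mult)
      next
        case False
        thus ?thesis by (auto simp: indicator_def)
      qed
    qed
    finally show "(\<integral>\<^sup>+y. h \<omega> y \<partial>D (2 * k)) = indicator B \<omega> * of_bool (state_after k \<omega> = i) * hazard k i j s r \<omega>"
      unfolding hazard_def .
  qed
  finally show ?thesis .
qed

end

context uniformized_chain
begin

text \<open>Almost every sample point is regular; for those, epochs are distinct and only finitely many fall into
the horizon.\<close>

definition regular :: "(nat \<Rightarrow> real) \<Rightarrow> bool" where
  "regular \<omega> \<longleftrightarrow> (\<forall>k. 0 < \<omega> (2 * k)) \<and> (\<exists>k. T < epoch k \<omega>)"

lemma AE_regular: "AE \<omega> in M. regular \<omega>"
  using gap_pos_AE no_explosion by eventually_elim (simp add: regular_def)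

lemma regular_epoch_strict: "regular \<omega> \<Longrightarrow> epoch k \<omega> < epoch (Suc k) \<omega>"
  by (auto simp: regular_def)

lemma regular_epoch_inj: "regular \<omega> \<Longrightarrow> inj (\<lambda>k. epoch k \<omega>)"
  using strict_mono_Suc_iff[of "\<lambda>k. epoch k \<omega>"] regular_epoch_strict strict_mono_imp_inj_on by metis

lemma regular_stay:
  assumes "regular \<omega>" "t \<in> {0..T}"
  obtains k where "\<omega> \<in> stay k t"
proof -
  obtain k where "T < epoch k \<omega>" using assms by (auto simp: regular_def)
  hence "t < epoch (Suc k) \<omega>" using assms(2) epoch_mono[of k "Suc k" \<omega>] by (simp del: epoch.simps)
  thus ?thesis using stay_exists[of t k \<omega>] assms(2) that by auto
qed

lemma regular_finite_epochs: "regular \<omega> \<Longrightarrow> finite {k. epoch k \<omega> \<le> T}"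
proof -
  assume "regular \<omega>"
  then obtain n where n: "T < epoch n \<omega>" by (auto simp: regular_def)
  have "{k. epoch k \<omega> \<le> T} \<subseteq> {..<n}"
  proof
    fix k assume k: "k \<in> {k. epoch k \<omega> \<le> T}"
    show "k \<in> {..<n}"
    proof (rule ccontr)
      assume "k \<notin> {..<n}"
      thus False using epoch_mono[of n k \<omega>] n k by simp
    qed
  qed
  thus ?thesis by (rule finite_subset) simp
qed

lemma regular_step_path:
  assumes "regular \<omega>"
  shows "step_path T (\<lambda>t. X t \<omega>)"
  unfolding step_path_def
proof (intro exI[of _ "(\<lambda>k. epoch k \<omega>) ` {k. epoch k \<omega> \<le> T}"] conjI ballI impI)
  show "finite ((\<lambda>k. epoch k \<omega>) ` {k. epoch k \<omega> \<le> T})"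
    using regular_finite_epochs[OF assms] by simp
  fix t s assume t: "t \<in> {0..T}" and s: "s \<in> {t..T}"
    and no: "(\<lambda>k. epoch k \<omega>) ` {k. epoch k \<omega> \<le> T} \<inter> {t<..s} = {}"
  obtain k where k: "\<omega> \<in> stay k t" using regular_stay[OF assms t] by blast
  have "s < epoch (Suc k) \<omega>"
  proof (rule ccontr)
    assume "\<not> s < epoch (Suc k) \<omega>"
    hence "epoch (Suc k) \<omega> \<le> T" "epoch (Suc k) \<omega> \<in> {t<..s}" using s k unfolding stay_def by (simp_all del: epoch.simps)
    thus False using no by blast
  qed
  hence "\<omega> \<in> stay k s" using k s by (simp add: stay_def)
  thus "X s \<omega> = X t \<omega>" using stay_index(2) k by simp
qed

lemma left_value_in_stay:
  assumes "epoch k \<omega> < v" "v \<le> epoch (Suc k) \<omega>"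
  shows "\<forall>\<^sub>F w in at_left v. X w \<omega> = state_after k \<omega>"
  unfolding eventually_at_left_field
proof (intro exI[of _ "epoch k \<omega>"] conjI allI impI)
  fix w assume "epoch k \<omega> < w" "w < v"
  hence "\<omega> \<in> stay k w" using assms unfolding stay_def by (simp del: epoch.simps)
  thus "X w \<omega> = state_after k \<omega>" by (rule stay_index(2))
qed (rule assms)

text \<open>The path is constant between epochs and epochs are distinct, so every jump happens at an epoch, with
left limit the previous state.\<close>

lemma jump_times_epochs:
  assumes "regular \<omega>" "0 \<le> s" "r \<le> T" "i \<noteq> j"
  shows "jump_times (\<lambda>t. X t \<omega>) i j s r = (\<lambda>k. epoch (Suc k) \<omega>) ` {k. \<omega> \<in> next_jump k i j s r}"
proof (intro set_eqI iffI)
  fix v assume "v \<in> (\<lambda>k. epoch (Suc k) \<omega>) ` {k. \<omega> \<in> next_jump k i j s r}"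
  then obtain k where k: "v = epoch (Suc k) \<omega>" "s < v" "v \<le> r" "state_after k \<omega> = i" "state_after (Suc k) \<omega> = j"
    unfolding next_jump_def by blast
  have "\<forall>\<^sub>F w in at_left v. X w \<omega> = i"
    using left_value_in_stay[of k \<omega> v] regular_epoch_strict[OF assms(1), of k] k by simp
  moreover have "\<omega> \<in> stay (Suc k) v"
    using regular_epoch_strict[OF assms(1), of "Suc k"] k(1) unfolding stay_def by (simp del: epoch.simps)
  hence "X v \<omega> = j" using stay_index(2) k by simp
  ultimately show "v \<in> jump_times (\<lambda>t. X t \<omega>) i j s r" using k by (simp add: jump_times_def)
next
  fix v assume "v \<in> jump_times (\<lambda>t. X t \<omega>) i j s r"
  hence v: "s < v" "v \<le> r" "\<forall>\<^sub>F w in at_left v. X w \<omega> = i" "X v \<omega> = j" by (auto simp: jump_times_def)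
  have vT: "v \<in> {0..T}" using v assms by auto
  obtain k where k: "\<omega> \<in> stay k v" using regular_stay[OF assms(1) vT] by blast
  have left: "i = state_after n \<omega>" if "epoch n \<omega> < v" "v \<le> epoch (Suc n) \<omega>" for n
  proof -
    have "\<forall>\<^sub>F w in at_left v. i = state_after n \<omega>"
      using v(3) left_value_in_stay[OF that] by eventually_elim simp
    thus ?thesis by simp
  qed
  have "epoch k \<omega> = v"
  proof (rule ccontr)
    assume "epoch k \<omega> \<noteq> v"
    hence "epoch k \<omega> < v" "v \<le> epoch (Suc k) \<omega>" using k unfolding stay_def by (simp_all del: epoch.simps)
    from left[OF this] show False using stay_index(2)[OF k] v(4) assms(4) by simp
  qed
  moreover have "k \<noteq> 0" using calculation v(1) assms(2) by (intro notI) simp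
  then obtain n where n: "k = Suc n" by (cases k) auto
  moreover have "i = state_after n \<omega>"
    by (rule left) (use calculation regular_epoch_strict[OF assms(1), of n] in auto)
  ultimately show "v \<in> (\<lambda>k. epoch (Suc k) \<omega>) ` {k. \<omega> \<in> next_jump k i j s r}"
    using v stay_index(2)[OF k] unfolding next_jump_def by (intro image_eqI[of _ _ n]) (simp_all del: epoch.simps)
qed

lemma jump_count_sum:
  assumes "regular \<omega>" "0 \<le> s" "r \<le> T" "i \<noteq> j"
  shows "of_nat (card (jump_times (\<lambda>t. X t \<omega>) i j s r)) = (\<Sum>k. indicator (next_jump k i j s r) \<omega> :: ennreal)"
proof -
  let ?S = "{k. \<omega> \<in> next_jump k i j s r}"
  have "Suc ` ?S \<subseteq> {k. epoch k \<omega> \<le> T}" using assms(3) unfolding next_jump_def by (auto simp del: epoch.simps)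
  hence "finite (Suc ` ?S)" by (rule finite_subset) (rule regular_finite_epochs[OF assms(1)])
  hence fin: "finite ?S" by (rule finite_imageD) simp
  have "inj_on (\<lambda>k. epoch (Suc k) \<omega>) ?S"
    using regular_epoch_inj[OF assms(1)] by (auto simp: inj_on_def simp del: epoch.simps)
  hence "card (jump_times (\<lambda>t. X t \<omega>) i j s r) = card ?S"
    unfolding jump_times_epochs[OF assms] by (rule card_image)
  moreover have "(\<Sum>k. indicator (next_jump k i j s r) \<omega> :: ennreal) = (\<Sum>k\<in>?S. indicator (next_jump k i j s r) \<omega>)"
    by (rule suminf_finite[OF fin]) (simp add: indicator_def)
  moreover have "(\<Sum>k\<in>?S. indicator (next_jump k i j s r) \<omega>) = (\<Sum>k\<in>?S. 1 :: ennreal)"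
    by (rule sum.cong) auto
  ultimately show ?thesis by simp
qed

lemma occupation_sum:
  assumes "regular \<omega>" "0 \<le> s" "r \<le> T"
  shows "(\<integral>\<^sup>+v\<in>{s..r}. ennreal (if X v \<omega> = i then jump_rate N (l v) (a v (X v \<omega>)) i j else 0) \<partial>lborel)
    = (\<Sum>k. occupation k i j s r \<omega>)"
proof -
  let ?f = "\<lambda>k v. ennreal (rate i j v) * of_bool (\<omega> \<in> stay k v \<and> state_after k \<omega> = i) * indicator {s<..r} v"
  have "(\<integral>\<^sup>+v\<in>{s..r}. ennreal (if X v \<omega> = i then jump_rate N (l v) (a v (X v \<omega>)) i j else 0) \<partial>lborel)
    = (\<integral>\<^sup>+v. (\<Sum>k. ?f k v) \<partial>lborel)"
  proof (rule nn_integral_cong_AE)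
    \<comment> \<open>the left end point, at which the two integrands may differ, is a null set\<close>
    have "AE v in lborel. v \<noteq> s" by (rule AE_lborel_singleton)
    thus "AE v in lborel. ennreal (if X v \<omega> = i then jump_rate N (l v) (a v (X v \<omega>)) i j else 0) * indicator {s..r} v
        = (\<Sum>k. ?f k v)"
    proof eventually_elim
      fix v assume v: "v \<noteq> s"
      show "ennreal (if X v \<omega> = i then jump_rate N (l v) (a v (X v \<omega>)) i j else 0) * indicator {s..r} v
        = (\<Sum>k. ?f k v)"
      proof (cases "v \<in> {s<..r}")
        case True
        obtain n where n: "\<omega> \<in> stay n v" using regular_stay[OF assms(1), of v] True assms by auto
        have "(\<Sum>k. ?f k v)
          = (\<Sum>k\<in>{n}. ?f k v)"
          by (rule suminf_finite) (use stay_disjoint[OF n] in auto)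
        thus ?thesis using True n stay_index(2)[OF n] by (auto simp: rate_def)
      next
        case False
        thus ?thesis using v by simp
      qed
    qed
  qed
  also have "\<dots> = (\<Sum>k. occupation k i j s r \<omega>)"
    unfolding occupation_def
  proof (rule nn_integral_suminf)
    fix k
    show "(\<lambda>v. ?f k v) \<in> borel_measurable lborel"
      unfolding stay_def of_bool_def mem_Collect_eq by measurable
  qed
  finally show ?thesis .
qed

lemma next_jump_M [measurable]: "next_jump k i j s r \<in> sets M"
proof -
  have "next_jump k i j s r = {\<omega>\<in>space M. s < epoch (Suc k) \<omega> \<and> epoch (Suc k) \<omega> \<le> r \<and> state_after k \<omega> = i \<and> state_after (Suc k) \<omega> = j}"
    by (simp add: next_jump_def)
  also have "\<dots> \<in> sets M" by measurable
  finally show ?thesis .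
qed

text \<open>Both sides are split into periods between epochs. On the \<open>k\<close>-th period the event \<open>A\<close> may be replaced
by an event of the past, and then both sides equal the expected \<open>hazard\<close>.\<close>

lemma intensity:
  assumes ij: "i \<noteq> j" and sr: "0 \<le> s" "r \<le> T" and A: "A \<in> sets (history s)"
  shows "(\<integral>\<^sup>+\<omega>\<in>A. of_nat (card (jump_times (\<lambda>t. X t \<omega>) i j s r)) \<partial>M) =
        (\<integral>\<^sup>+\<omega>\<in>A. (\<integral>\<^sup>+v\<in>{s..r}.
            ennreal (if X v \<omega> = i then jump_rate N (l v) (a v (X v \<omega>)) i j else 0) \<partial>lborel) \<partial>M)"
proof -
  have A': "A \<in> history_sets s" using A sr by (simp add: sets_history max_def)
  hence AM [measurable]: "A \<in> sets M" by (simp add: history_sets_def)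
  have occupation_M [measurable]: "occupation k i j s r \<in> borel_measurable M" for k
    unfolding occupation_def stay_def of_bool_def mem_Collect_eq by measurable
  have each: "(\<integral>\<^sup>+\<omega>. indicator A \<omega> * indicator (next_jump k i j s r) \<omega> \<partial>M) = (\<integral>\<^sup>+\<omega>. indicator A \<omega> * occupation k i j s r \<omega> \<partial>M)" for k
  proof -
    obtain B where B: "B \<in> sets (past k)" "A \<inter> {\<omega>. s < epoch (Suc k) \<omega>} = B \<inter> {\<omega>. s < epoch (Suc k) \<omega>}"
      by (rule history_before_next_epoch[OF A' sr(1), of k])
    have AB: "\<omega> \<in> A \<longleftrightarrow> \<omega> \<in> B" if "s < epoch (Suc k) \<omega>" for \<omega> using B(2) that by blast
    have occupation_0: "occupation k i j s r \<omega> = 0" if "\<not> s < epoch (Suc k) \<omega>" for \<omega>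
    proof -
      have "occupation k i j s r \<omega> = (\<integral>\<^sup>+v. 0 \<partial>(lborel :: real measure))"
        unfolding occupation_def by (rule nn_integral_cong) (use that in \<open>auto simp: stay_def indicator_def simp del: epoch.simps\<close>)
      thus ?thesis by simp
    qed
    have "(\<integral>\<^sup>+\<omega>. indicator A \<omega> * indicator (next_jump k i j s r) \<omega> \<partial>M) = (\<integral>\<^sup>+\<omega>. indicator B \<omega> * indicator (next_jump k i j s r) \<omega> \<partial>M)"
      by (rule nn_integral_cong) (use AB in \<open>auto simp: next_jump_def indicator_def simp del: epoch.simps\<close>)
    also have "\<dots> = (\<integral>\<^sup>+\<omega>. indicator B \<omega> * occupation k i j s r \<omega> \<partial>M)"
      unfolding next_jump_exact[OF B(1) ij] stay_exact[OF B(1)] ..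
    also have "\<dots> = (\<integral>\<^sup>+\<omega>. indicator A \<omega> * occupation k i j s r \<omega> \<partial>M)"
    proof (rule nn_integral_cong)
      fix \<omega>
      show "indicator B \<omega> * occupation k i j s r \<omega> = indicator A \<omega> * occupation k i j s r \<omega>"
        using AB[of \<omega>] occupation_0[of \<omega>] by (cases "s < epoch (Suc k) \<omega>") (simp_all add: indicator_def del: epoch.simps)
    qed
    finally show ?thesis .
  qed
  have "(\<integral>\<^sup>+\<omega>\<in>A. of_nat (card (jump_times (\<lambda>t. X t \<omega>) i j s r)) \<partial>M)
      = (\<integral>\<^sup>+\<omega>. (\<Sum>k. indicator A \<omega> * indicator (next_jump k i j s r) \<omega>) \<partial>M)"
  proof (rule nn_integral_cong_AE)
    show "AE \<omega> in M. of_nat (card (jump_times (\<lambda>t. X t \<omega>) i j s r)) * indicator A \<omega> = (\<Sum>k. indicator A \<omega> * indicator (next_jump k i j s r) \<omega> :: ennreal)"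
      using AE_regular
    proof eventually_elim
      fix \<omega> assume "regular \<omega>"
      show "of_nat (card (jump_times (\<lambda>t. X t \<omega>) i j s r)) * indicator A \<omega> = (\<Sum>k. indicator A \<omega> * indicator (next_jump k i j s r) \<omega> :: ennreal)"
        unfolding jump_count_sum[OF \<open>regular \<omega>\<close> sr ij] ennreal_suminf_cmult by (rule mult.commute)
    qed
  qed
  also have "\<dots> = (\<Sum>k. \<integral>\<^sup>+\<omega>. indicator A \<omega> * indicator (next_jump k i j s r) \<omega> \<partial>M)"
    by (rule nn_integral_suminf) measurable
  also have "\<dots> = (\<Sum>k. \<integral>\<^sup>+\<omega>. indicator A \<omega> * occupation k i j s r \<omega> \<partial>M)" by (simp only: each)
  also have "\<dots> = (\<integral>\<^sup>+\<omega>. (\<Sum>k. indicator A \<omega> * occupation k i j s r \<omega>) \<partial>M)"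
    by (rule nn_integral_suminf[symmetric]) measurable
  also have "\<dots> = (\<integral>\<^sup>+\<omega>\<in>A. (\<integral>\<^sup>+v\<in>{s..r}. ennreal (if X v \<omega> = i then jump_rate N (l v) (a v (X v \<omega>)) i j else 0) \<partial>lborel) \<partial>M)"
  proof (rule nn_integral_cong_AE)
    show "AE \<omega> in M. (\<Sum>k. indicator A \<omega> * occupation k i j s r \<omega>) = (\<integral>\<^sup>+v\<in>{s..r}. ennreal (if X v \<omega> = i then jump_rate N (l v) (a v (X v \<omega>)) i j else 0) \<partial>lborel) * indicator A \<omega>"
      using AE_regular
    proof eventually_elim
      fix \<omega> assume "regular \<omega>"
      show "(\<Sum>k. indicator A \<omega> * occupation k i j s r \<omega>) = (\<integral>\<^sup>+v\<in>{s..r}. ennreal (if X v \<omega> = i then jump_rate N (l v) (a v (X v \<omega>)) i j else 0) \<partial>lborel) * indicator A \<omega>"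
        unfolding occupation_sum[OF \<open>regular \<omega>\<close> sr] ennreal_suminf_cmult by (rule mult.commute)
    qed
  qed
  finally show ?thesis .
qed

lemma is_controlled_chain:
  assumes lam: "\<And>t. t \<in> {0..T} \<Longrightarrow> lam t = l t"
  shows "controlled_chain M history N K T lam X (\<lambda>t \<omega>. a t (X t \<omega>))"
proof -
  have restr: "(\<lambda>p. p) \<in> restrict_space borel {0..T} \<Otimes>\<^sub>M M \<rightarrow>\<^sub>M borel \<Otimes>\<^sub>M M"
  proof -
    have "(\<lambda>x::real. x) \<in> restrict_space borel {0..T} \<rightarrow>\<^sub>M borel"
      by (rule measurable_restrict_space1) simp
    from measurable_Pair[OF measurable_compose[OF measurable_fst this] measurable_snd] show ?thesis by simp
  qed
  have um: "(\<lambda>(t, \<omega>). a t (X t \<omega>)) \<in> borel \<Otimes>\<^sub>M M \<rightarrow>\<^sub>M count_space UNIV"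
  proof -
    have "(\<lambda>p. X (fst p) (snd p)) \<in> borel \<Otimes>\<^sub>M M \<rightarrow>\<^sub>M count_space UNIV"
      using X_joint by (simp add: case_prod_beta')
    moreover have "(\<lambda>p. a (fst p) i) \<in> borel \<Otimes>\<^sub>M M \<rightarrow>\<^sub>M count_space UNIV" for i
      by (rule measurable_compose[OF measurable_fst a_meas])
    ultimately have "(\<lambda>p. a (fst p) (X (fst p) (snd p))) \<in> borel \<Otimes>\<^sub>M M \<rightarrow>\<^sub>M count_space UNIV"
      by (rule measurable_compose_countable[rotated])
    thus ?thesis by (simp add: case_prod_beta')
  qed
  interpret filtration "space M" history using history_filtration by simp
  show ?thesis
  proof
    fix t assume t: "t \<in> {0..T}"
    show "subalgebra M (history t)"
      unfolding subalgebra_def by (auto simp: sets_history history_sets_def)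
    show X: "X t \<in> history t \<rightarrow>\<^sub>M count_space UNIV" using X_history t by simp
    show "(\<lambda>\<omega>. a t (X t \<omega>)) \<in> history t \<rightarrow>\<^sub>M count_space UNIV"
      by (rule measurable_compose[OF X]) simp
    fix \<omega>
    show "X t \<omega> \<in> {0..N}" using X_le by simp
    show "a t (X t \<omega>) \<in> feasible K (X t \<omega>)" using a_le by (simp add: feasible_def)
  next
    show "(\<lambda>(t, \<omega>). X t \<omega>) \<in> restrict_space borel {0..T} \<Otimes>\<^sub>M M \<rightarrow>\<^sub>M count_space UNIV"
      using measurable_compose[OF restr X_joint] .
    show "(\<lambda>(t, \<omega>). a t (X t \<omega>)) \<in> restrict_space borel {0..T} \<Otimes>\<^sub>M M \<rightarrow>\<^sub>M count_space UNIV"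
      using measurable_compose[OF restr um] .
    show "AE \<omega> in M. step_path T (\<lambda>t. X t \<omega>)"
      using AE_regular by eventually_elim (rule regular_step_path)
  next
    fix i j :: nat and s r :: real and A :: "(nat \<Rightarrow> real) set"
    assume *: "i \<noteq> j" "0 \<le> s" "s \<le> r" "r \<le> T" "A \<in> sets (history s)"
    have "(\<integral>\<^sup>+v\<in>{s..r}. ennreal (if X v \<omega> = i then jump_rate N (lam v) (a v (X v \<omega>)) i j else 0) \<partial>lborel)
      = (\<integral>\<^sup>+v\<in>{s..r}. ennreal (if X v \<omega> = i then jump_rate N (l v) (a v (X v \<omega>)) i j else 0) \<partial>lborel)" for \<omega>
      by (rule nn_integral_cong) (use * lam in \<open>auto simp: indicator_def\<close>)
    thus "(\<integral>\<^sup>+\<omega>\<in>A. of_nat (card (jump_times (\<lambda>t. X t \<omega>) i j s r)) \<partial>M) =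
        (\<integral>\<^sup>+\<omega>\<in>A. (\<integral>\<^sup>+v\<in>{s..r}. ennreal (if X v \<omega> = i then jump_rate N (lam v) (a v (X v \<omega>)) i j else 0) \<partial>lborel) \<partial>M)"
      using intensity[OF *(1,2,4,5)] by simp
  qed
qed

end

section \<open>The value function and its threshold\<close>

context hjb_solution
begin

text \<open>The verification lemma bounds every cost from below by \<open>W\<close>; the bound is attained by the chain under
the threshold feedback, started in \<open>i\<close> at time \<open>0\<close>, which sits in \<open>i\<close> at time \<open>t\<close> with positive
probability.\<close>

lemma value_fun_eq:
  assumes t: "t \<in> {0..T}" and i: "i \<le> N"
  shows "value_fun N K T \<pi> lam e t i = W i t"
  unfolding value_fun_def
proof (rule cInf_eq_minimum)
  let ?S = "{cost_to_go N T \<pi> lam e M X u t i | (M :: (nat \<Rightarrow> real) measure) F X u.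
            controlled_chain M F N K T lam X u \<and> 0 < measure M {\<omega>\<in>space M. X t \<omega> = i}}"
  show "W i t \<le> x" if x_cost: "x \<in> ?S" for x
  proof -
    obtain M :: "(nat \<Rightarrow> real) measure" and F X u where x: "x = cost_to_go N T \<pi> lam e M X u t i"
        "controlled_chain M F N K T lam X u" "0 < measure M {\<omega>\<in>space M. X t \<omega> = i}"
      using x_cost by blast
    interpret controlled_chain M F N K T lam X u by (rule x(2))
    interpret controlled_hjb N K T \<pi> C lam e W M F X u by unfold_locales
    show ?thesis unfolding x(1) by (rule verification(1)[OF t i x(3)])
  qed
  show "W i t \<in> ?S"
  proof -
    \<comment> \<open>continued by \<open>0\<close> outside the horizon, the rate is a Borel function on the line\<close>
    define l where "l v = indicator {0..T} v * lam v" for v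
    define a where "a v j = (if j \<noteq> 0 \<and> v \<in> {0..T} \<and> indicator {0..T} v * e v < delta j v then min j K else 0)" for v j
    interpret U: uniformized_chain N K T "C + real K" l a i
    proof
      show "0 < T" by (rule T_pos)
      show "0 < C + real K" using C_pos by simp
      show "l \<in> borel_measurable borel" using lam_meas by (simp add: l_def[abs_def])
      show "0 \<le> l v" "l v + real K \<le> C + real K" for v
        using lam_pos[of v] lam_le[of v] C_pos by (auto simp: l_def indicator_def)
      show "(\<lambda>v. a v j) \<in> borel \<rightarrow>\<^sub>M count_space UNIV" for j
      proof -
        note [measurable] = e_meas
        have [measurable]: "delta j \<in> borel_measurable borel"
          by (intro borel_measurable_continuous_onI delta_cont)
        show ?thesis unfolding a_def by measurable
      qed
      show "a v j \<le> min j K" for v j by (simp add: a_def)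
    qed (rule i)
    have cc: "controlled_chain U.M U.history N K T lam U.X (\<lambda>t \<omega>. a t (U.X t \<omega>))"
      by (rule U.is_controlled_chain) (simp add: l_def)
    have pos: "0 < measure U.M {\<omega>\<in>space U.M. U.X t \<omega> = i}" by (rule U.start_positive[OF t])
    interpret controlled_chain U.M U.history N K T lam U.X "\<lambda>t \<omega>. a t (U.X t \<omega>)" by (rule cc)
    interpret controlled_hjb N K T \<pi> C lam e W U.M U.history U.X "\<lambda>t \<omega>. a t (U.X t \<omega>)" by unfold_locales
    have opt: "cost_to_go N T \<pi> lam e U.M U.X (\<lambda>t \<omega>. a t (U.X t \<omega>)) t i = W i t"
      by (rule verification(2)[OF t i pos]) (simp add: a_def)
    show ?thesis
      unfolding mem_Collect_eq by (rule exI conjI opt[symmetric] cc pos)+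
  qed
qed

lemma marginal_cost_eq:
  assumes "t \<in> {0..T}" "i \<le> N"
  shows "marginal_cost N K T \<pi> lam e i t = delta i t"
  using assms by (simp add: marginal_cost_def delta_def value_fun_eq)

lemma active_states_eq:
  assumes "t \<in> {0..T}"
  shows "active_states N K T \<pi> lam e t = {i\<in>{1..N}. e t < delta i t}"
  using assms by (auto simp: active_states_def marginal_cost_eq)

lemma i_min_le:
  assumes "t \<in> {0..T}" "i \<in> {1..N}" "e t < delta i t"
  shows "i_min N K T \<pi> lam e t \<le> i"
  using assms by (auto simp: i_min_def active_states_eq)

lemma i_min_cases:
  assumes "t \<in> {0..T}"
  shows "i_min N K T \<pi> lam e t = N + 1 \<or>
    i_min N K T \<pi> lam e t \<in> {1..N} \<and> e t < delta (i_min N K T \<pi> lam e t) t"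
proof (cases "active_states N K T \<pi> lam e t = {}")
  case False
  have "Min (active_states N K T \<pi> lam e t) \<in> active_states N K T \<pi> lam e t"
    by (rule Min_in) (use False in \<open>auto simp: active_states_def\<close>)
  thus ?thesis using False by (simp add: i_min_def active_states_eq[OF assms])
qed (simp add: i_min_def)

text \<open>A threshold that decreases between \<open>s\<close> and \<open>t\<close> means that some state is inactive at \<open>s\<close> and active at
\<open>t\<close>.\<close>

lemma i_min_mono_if_below_stays_below:
  assumes "\<And>i s t. i \<in> {1..N} \<Longrightarrow> 0 \<le> s \<Longrightarrow> s \<le> t \<Longrightarrow> t \<le> T \<Longrightarrow> delta i s \<le> e s \<Longrightarrow> delta i t \<le> e t"
  shows "mono_on {0..T} (i_min N K T \<pi> lam e)"
proof (rule mono_onI)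
  fix s t assume st: "s \<in> {0..T}" "t \<in> {0..T}" "s \<le> t"
  have "i_min N K T \<pi> lam e s \<le> N + 1" using i_min_cases[OF st(1)] by auto
  moreover have "i_min N K T \<pi> lam e s \<le> i" if "i \<in> {1..N}" "e t < delta i t" for i
  proof (rule i_min_le[OF st(1) that(1)])
    show "e s < delta i s"
      using assms[OF that(1), of s t] st that(2) by force
  qed
  ultimately show "i_min N K T \<pi> lam e s \<le> i_min N K T \<pi> lam e t"
    using i_min_cases[OF st(2)] by auto
qed

end

text \<open>On the union of the open pieces the function is continuous; what remains is a finite set.\<close>

lemma rate_function_measurable:
  assumes gr: "grid T m \<tau>" and f: "rate_function T m \<tau> f"
  shows "(\<lambda>t. indicator {0..T} t * f t) \<in> borel_measurable borel"
proof -
  define S where "S = (\<Union>k\<le>m. {\<tau> k<..<\<tau> (k + 1)})"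
  have "continuous_on S f"
  proof -
    have "isCont f x" if "x \<in> S" for x
      using that f C1_pieceD(1)[of f \<tau>] by (auto simp: S_def rate_function_def)
    thus ?thesis by (intro continuous_at_imp_continuous_on) blast
  qed
  hence "(\<lambda>t. indicator S t *\<^sub>R f t) \<in> borel_measurable borel"
    by (intro borel_measurable_continuous_on_indicator) (auto simp: S_def)
  thus ?thesis
  proof (rule measurable_discrete_difference[where X="\<tau> ` {..m + 1}"])
    fix t assume "t \<notin> \<tau> ` {..m + 1}"
    moreover have "t \<in> {0..T} \<longleftrightarrow> t \<in> S" if t: "t \<notin> \<tau> ` {..m + 1}"
    proof
      assume "t \<in> {0..T}"
      moreover have "\<tau> (m + 1) = T" using gr by (simp add: grid_def)
      hence "t \<noteq> T" using t by force
      ultimately obtain k where k: "k \<le> m" "t \<in> {\<tau> k..<\<tau> (k + 1)}" using grid_locate[OF gr, of t] by auto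
      moreover have "t \<noteq> \<tau> k" using t k by auto
      ultimately have "t \<in> {\<tau> k<..<\<tau> (k + 1)}" by auto
      thus "t \<in> S" unfolding S_def using k(1) by blast
    next
      assume "t \<in> S"
      then obtain k where "k \<le> m" "\<tau> k < t" "t < \<tau> (k + 1)" by (auto simp: S_def)
      thus "t \<in> {0..T}" using grid_bounds[OF gr, of k] grid_bounds[OF gr, of "k + 1"] by auto
    qed
    ultimately show "indicator S t *\<^sub>R f t = indicator {0..T} t * f t" by (simp add: indicator_def)
  qed (auto intro!: countable_finite)
qed

theorem theorem2:
  fixes N K m :: nat and T \<pi> :: real and \<tau> :: "nat \<Rightarrow> real" and lam e :: "real \<Rightarrow> real"
  assumes "1 \<le> N" and "1 \<le> K" and "0 < T" and "0 < \<pi>"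
    and "grid T m \<tau>"
    and "rate_function T m \<tau> lam"
    and "rate_function T m \<tau> e"
    and "has_left_limits m \<tau> e"
    and "no_downward_jumps m \<tau> e"
  shows "((\<forall>k\<le>m. \<forall>t\<in>{\<tau> k<..<\<tau> (k + 1)}.
             deriv e t > - lam t * min (delta_lower N K T \<pi> lam t) (\<pi> * exp (- cum_rate lam t T)))
           \<longrightarrow> mono_on {0..T} (i_min N K T \<pi> lam e)) \<and>
         (mono_on {0..T} (i_min N K T \<pi> lam e) \<longrightarrow>
           (\<forall>k\<le>m. \<forall>t\<in>{\<tau> k<..<\<tau> (k + 1)}.
             2 \<le> i_min N K T \<pi> lam e t \<longrightarrow>
             marginal_cost N K T \<pi> lam e (i_min N K T \<pi> lam e t - 1) t = e t \<longrightarrow>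
             deriv e t \<ge> - lam t * (\<pi> - e t)))"
proof -
  have "bounded (lam ` {0..T})" "bounded (e ` {0..T})"
    using assms(6,7) by (simp_all add: rate_function_def)
  then obtain C1 C2 where "\<forall>x\<in>lam ` {0..T}. norm x \<le> C1" "\<forall>x\<in>e ` {0..T}. norm x \<le> C2"
    unfolding bounded_iff by blast
  hence C1: "\<And>t. t \<in> {0..T} \<Longrightarrow> \<bar>lam t\<bar> \<le> C1" and C2: "\<And>t. t \<in> {0..T} \<Longrightarrow> \<bar>e t\<bar> \<le> C2"
    by auto
  interpret depletion_control N K T \<pi> "max C1 C2" lam e
  proof
    show "(\<lambda>t. indicator {0..T} t * lam t) \<in> borel_measurable borel"
        "(\<lambda>t. indicator {0..T} t * e t) \<in> borel_measurable borel"
      using rate_function_measurable assms by blast+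
  next
    fix t assume "t \<in> {0..T}"
    thus "0 < lam t" "lam t \<le> max C1 C2" "0 < e t" "e t \<le> max C1 C2"
      using assms(6,7) C1[of t] C2[of t] by (auto simp: rate_function_def)
  next
    fix t assume "t \<in> {0..<T}"
    thus "continuous (at_right t) lam" "continuous (at_right t) e"
      using assms(6,7) by (auto simp: rate_function_def)
  qed (use assms in auto)
  obtain W where W: "\<And>i. continuous_on UNIV (W i)"
    "\<And>i t. i \<le> N \<Longrightarrow> t \<in> {0..T} \<Longrightarrow> W i t = integral {t..T} (hjb_rhs W i)"
    using hjb_solution_exists by blast
  interpret hjb_solution N K T \<pi> "max C1 C2" lam e W
    by unfold_locales (use W in auto)
  have C1_lam: "lam C1_differentiable_on {\<tau> k<..<\<tau> (k + 1)}" and C1_e: "e C1_differentiable_on {\<tau> k<..<\<tau> (k + 1)}"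
    if "k \<le> m" for k
    using assms(6,7) that by (auto simp: rate_function_def)
  have inside: "0 < t" "t < T" if "k \<le> m" "t \<in> {\<tau> k<..<\<tau> (k + 1)}" for k t
    using grid_bounds[OF assms(5), of k] grid_bounds[OF assms(5), of "k + 1"] that by auto
  show ?thesis
  proof (intro conjI impI allI ballI)
    assume slope: "\<forall>k\<le>m. \<forall>t\<in>{\<tau> k<..<\<tau> (k + 1)}.
      deriv e t > - lam t * min (delta_lower N K T \<pi> lam t) (\<pi> * exp (- cum_rate lam t T))"
    show "mono_on {0..T} (i_min N K T \<pi> lam e)"
    proof (rule i_min_mono_if_below_stays_below)
      fix i s t assume i: "i \<in> {1..N}" and st: "0 \<le> s" "s \<le> t" "t \<le> T" and below: "delta i s \<le> e s"
      show "delta i t \<le> e t"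
      proof (rule stays_below_on_horizon[OF _ _ assms(5) C1_lam C1_e assms(8,9) _ below st])
        fix k v assume k: "k \<le> m" and v: "v \<in> {\<tau> k<..<\<tau> (k + 1)}"
        have vT: "v \<in> {0..T}" using inside[OF k v] by auto
        have "lam v * min (delta_lower N K T \<pi> lam v) (\<pi> * exp (- cum_rate lam v T)) \<le> lam v * gap i v"
          using gap_ge_delta_lower[of i v] i vT lam_pos[OF vT] by (intro mult_left_mono) auto
        thus "- lam v * gap i v < deriv e v" using slope k v by force
      qed (use i in auto)
    qed
  next
    fix k t assume mono: "mono_on {0..T} (i_min N K T \<pi> lam e)" and k: "k \<le> m" and t: "t \<in> {\<tau> k<..<\<tau> (k + 1)}"
      and two: "2 \<le> i_min N K T \<pi> lam e t"
      and touch: "marginal_cost N K T \<pi> lam e (i_min N K T \<pi> lam e t - 1) t = e t"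
    define i where "i = i_min N K T \<pi> lam e t - 1"
    have tT: "t \<in> {0..T}" using inside[OF k t] by auto
    have i: "1 \<le> i" "i \<le> N" using two i_min_cases[OF tT] by (auto simp: i_def)
    show "- lam t * (\<pi> - e t) \<le> deriv e t"
    proof (rule slope_at_crossing[OF i inside[OF k t]])
      show "isCont lam t" by (rule C1_pieceD(1)[OF C1_lam[OF k] t])
      show "(e has_real_derivative deriv e t) (at t)" by (rule C1_pieceD(2)[OF C1_e[OF k] t])
      show "delta i t = e t" using touch marginal_cost_eq[OF tT i(2)] by (simp add: i_def)
      fix s assume s: "t \<le> s" "s \<le> T"
      hence sT: "s \<in> {0..T}" using tT by auto
      have "i_min N K T \<pi> lam e t \<le> i_min N K T \<pi> lam e s"
        by (rule mono_onD[OF mono tT sT s(1)])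
      hence "\<not> i_min N K T \<pi> lam e s \<le> i" using two by (simp add: i_def)
      thus "delta i s \<le> e s" using i_min_le[OF sT, of i] i by force
    qed
  qed
qed

end
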